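(* Let $d\ge1$, $N\in\mathbb N$, $\kappa\in\mathbb R^{d+1}$ with all $\kappa_i>-1$. For $\nu,\mu\in\mathbb N_0^d$ with $|\nu|=|\mu|=n\le N$ and $\tau\in S_{d+1}$, the connection coefficients $\mathsf h^\tau_{\nu,\mu}(\kappa)$ of the Hahn polynomials and $c^\tau_{\nu,\mu}(\kappa)$ of the Jacobi polynomials on the simplex, and their normalized versions, satisfy $$\mathsf h^\tau_{\nu,\mu}(\kappa)=\frac{p_\mu^{\kappa}}{p_\nu^{\tau\kappa}}\,c^\tau_{\nu,\mu}(\kappa)\qquad\text{and}\qquad\widehat{\mathsf h}^{\,\tau}_{\nu,\mu}(\kappa)=\widehat c^{\,\tau}_{\nu,\mu}(\kappa).$$
   Context: **Vectors.** $|y|$ is the sum of the entries of $y$; $\mathbf y_j=(y_1,\dots,y_j)$; $\mathbf y^j$ is the tail of $y$ from the $j$-th to the last entry ($\boldsymbol\kappa^j=(\kappa_j,\dots,\kappa_{d+1})$, $\boldsymbol\nu^j=(\nu_j,\dots,\nu_d)$); empty parts have sum $0$. $(a)_k=a(a+1)\cdots(a+k-1)$. For multi-indices, $(a)_\alpha=\prod_i(a_i)_{\alpha_i}$, $\alpha!=\prod_i\alpha_i!$, $y^\alpha=\prod_iy_i^{\alpha_i}$. **Jacobi polynomials on the simplex.** $T^d=\{x\in\mathbb R^d:x_i\ge0,|x|\le1\}$, $W_\kappa(x)=x_1^{\kappa_1}\cdots x_d^{\kappa_d}(1-|x|)^{\kappa_{d+1}}$, $\langle f,g\rangle_{W_\kappa}=\frac{\Gamma(|\kappa|+d+1)}{\prod_{i=1}^{d+1}\Gamma(\kappa_i+1)}\int_{T^d}fgW_\kappa\,dx$.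 Put $a_j=a_j(\kappa,\nu)=|\boldsymbol\kappa^{j+1}|+2|\boldsymbol\nu^{j+1}|+d-j$, $$P_\nu^\kappa(x)=\prod_{j=1}^d(1-|\mathbf x_{j-1}|)^{\nu_j}P_{\nu_j}^{(a_j,\kappa_j)}\Big(\frac{2x_j}{1-|\mathbf x_{j-1}|}-1\Big),\qquad p_\nu^\kappa=\prod_{j=1}^dP_{\nu_j}^{(a_j,\kappa_j)}(1)=\prod_{j=1}^d\frac{(a_j(\kappa,\nu)+1)_{\nu_j}}{\nu_j!},$$ with $P_n^{(\alpha,\beta)}$ the classical Jacobi polynomials ($P_n^{(\alpha,\beta)}(1)=(\alpha+1)_n/n!$). For each $n$, $\{P_\nu^\kappa:|\nu|=n\}$ is an orthogonal basis of the space of polynomials of degree $n$ orthogonal to all lower-degree polynomials with respect to $\langle\cdot,\cdot\rangle_{W_\kappa}$. $A_\nu(\kappa)=\langle P_\nu^\kappa,P_\nu^\kappa\rangle_{W_\kappa}$. **Permutations.** For $\tau\in S_{d+1}$ and $y\in\mathbb R^{d+1}$, $\tau y=(y_{\tau(1)},\dots,y_{\tau(d+1)})$; for $x\in T^d$, $\tau x=(x_{\tau(1)},\dots,x_{\tau(d)})$ with $x_{d+1}:=1-|x|$. Define $c^\tau_{\nu,\mu}(\kappa)$ by $P_\nu^{\tau\kappa}(\tau x)=\sum_{|\mu|=n}c^\tau_{\nu,\mu}(\kappa)P_\mu^\kappa(x)$, $|\nu|=n$, and $\widehat c^{\,\tau}_{\nu,\mu}(\kappa)=\sqrt{A_\mu(\kappa)/A_\nu(\tau\kappa)}\,c^\tau_{\nu,\mu}(\kappa)$.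 **Hahn polynomials.** $\mathbb Z_N^{d+1}=\{\alpha\in\mathbb N_0^{d+1}:|\alpha|=N\}$, $\mathbf 1=(1,\dots,1)\in\mathbb N^{d+1}$, $\mathsf H_{\kappa,N}(\alpha)=(\kappa+\mathbf 1)_\alpha/\alpha!$, and $$\langle f,g\rangle_{\mathsf H_{\kappa,N}}=\frac{N!}{(|\kappa|+d+1)_N}\sum_{\alpha\in\mathbb Z_N^{d+1}}f(\alpha)g(\alpha)\mathsf H_{\kappa,N}(\alpha).$$ For $\nu\in\mathbb N_0^d$, $|\nu|\le N$, the Hahn polynomials $\mathsf H_\nu(\alpha;\kappa,N)$, $\alpha\in\mathbb Z_N^{d+1}$, are defined by the generating function $$|y|^N\,\frac{P_\nu^\kappa(y'/|y|)}{p_\nu^\kappa}=\sum_{|\alpha|=N}\frac{N!}{\alpha!}\mathsf H_\nu(\alpha;\kappa,N)y^\alpha,\qquad y=(y',y_{d+1})\in\mathbb R^{d+1}.$$ For $n\le N$, $\{\mathsf H_\nu(\cdot;\kappa,N):|\nu|=n\}$ is an orthogonal basis of the space of degree-$n$ orthogonal polynomials for $\langle\cdot,\cdot\rangle_{\mathsf H_{\kappa,N}}$, and so is $\{\mathsf H_\nu(\tau\{\cdot\};\tau\kappa,N):|\nu|=n\}$. Let $\mathsf B_\nu(\kappa,N)=\langle\mathsf H_\nu(\cdot;\kappa,N),\mathsf H_\nu(\cdot;\kappa,N)\rangle_{\mathsf H_{\kappa,N}}$. The coefficients $\mathsf h^\tau_{\nu,\mu}(\kappa)$ are defined by $\mathsf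 H_\nu(\tau\alpha;\tau\kappa,N)=\sum_{|\mu|=n}\mathsf h^\tau_{\nu,\mu}(\kappa)\mathsf H_\mu(\alpha;\kappa,N)$ and $\widehat{\mathsf h}^{\,\tau}_{\nu,\mu}(\kappa)=\sqrt{\mathsf B_\mu(\kappa,N)/\mathsf B_\nu(\tau\kappa,N)}\,\mathsf h^\tau_{\nu,\mu}(\kappa)$. *)

theory Defs
  imports "HOL-Analysis.Analysis" "HOL-Computational_Algebra.Polynomial"
    "HOL-Combinatorics.Permutations"
begin

text \<open>
  Vectors are functions on \<^typ>\<open>nat\<close> of which only the entries with index in
  \<open>{1..d}\<close> or \<open>{1..d+1}\<close> are read; the dimension \<open>d\<close> is an explicit argument. The permutation
  action on \<open>\<real>\<^sup>d\<^sup>+\<^sup>1\<close> and on multi-indices is \<open>y \<circ> \<tau>\<close>, where \<open>\<tau> permutes {1..d+1}\<close>.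
\<close>

definition multi_indices :: "nat \<Rightarrow> nat \<Rightarrow> (nat \<Rightarrow> nat) set" where
  "multi_indices d n = {\<nu>. (\<forall>i. i \<notin> {1..d} \<longrightarrow> \<nu> i = 0) \<and> (\<Sum>i=1..d. \<nu> i) = n}"


subsection \<open>Classical Jacobi polynomials\<close>

text \<open>
  This is \<open>(\<alpha>+1)\<^sub>n/n! \<^bold>\<cdot> \<^sub>2F\<^sub>1(-n, n+\<alpha>+\<beta>+1; \<alpha>+1; (1-t)/2)\<close> with the quotient
  \<open>(\<alpha>+1)\<^sub>n/(\<alpha>+1)\<^sub>l\<close> cancelled to \<open>(\<alpha>+l+1)\<^sub>n\<^sub>-\<^sub>l\<close>; the linear polynomial is \<open>(t-1)/2\<close>.
\<close>

definition jacobi_poly :: "nat \<Rightarrow> real \<Rightarrow> real \<Rightarrow> real poly" where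
  "jacobi_poly n \<alpha> \<beta> =
     (\<Sum>l\<le>n. smult (pochhammer (real n + \<alpha> + \<beta> + 1) l * pochhammer (\<alpha> + real l + 1) (n - l)
                     / (fact l * fact (n - l)))
                   ([:-1/2, 1/2:] ^ l))"

lemma degree_jacobi_poly: "degree (jacobi_poly n \<alpha> \<beta>) \<le> n"
  unfolding jacobi_poly_def
proof (intro degree_sum_le)
  fix l assume "l \<in> {..n}"
  have "degree ([:-1/2, 1/2:] ^ l :: real poly) \<le> degree ([:-1/2, 1/2:] :: real poly) * l"
    by (rule degree_power_le)
  also have "\<dots> \<le> n" using \<open>l \<in> {..n}\<close> by simp
  finally show "degree (smult c ([:-1/2, 1/2:] ^ l :: real poly)) \<le> n" for c
    using degree_smult_le le_trans by blast
qed simp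

lemma poly_jacobi_poly_1: "poly (jacobi_poly n \<alpha> \<beta>) 1 = pochhammer (\<alpha> + 1) n / fact n"
proof -
  have "poly (jacobi_poly n \<alpha> \<beta>) 1 =
      (\<Sum>l\<le>n. if l = 0 then pochhammer (\<alpha> + 1) n / fact n else 0)"
    unfolding jacobi_poly_def poly_sum by (intro sum.cong) (auto simp: poly_power)
  then show ?thesis by simp
qed


subsection \<open>Jacobi polynomials on the simplex\<close>

definition std_simplex :: "nat \<Rightarrow> (nat \<Rightarrow> real) set" where
  "std_simplex d = {x \<in> {1..d} \<rightarrow>\<^sub>E UNIV. (\<forall>i\<in>{1..d}. 0 \<le> x i) \<and> (\<Sum>i=1..d. x i) \<le> 1}"

text \<open>Where a coordinate vanishes, \<^term>\<open>0 powr 0 = 0\<close> differs from the usual convention, but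
  only on a null set.\<close>

definition simplex_weight :: "nat \<Rightarrow> (nat \<Rightarrow> real) \<Rightarrow> (nat \<Rightarrow> real) \<Rightarrow> real" where
  "simplex_weight d \<kappa> x =
     (\<Prod>i=1..d. x i powr \<kappa> i) * (1 - (\<Sum>i=1..d. x i)) powr \<kappa> (d + 1)"

definition simplex_inner ::
    "nat \<Rightarrow> (nat \<Rightarrow> real) \<Rightarrow> ((nat \<Rightarrow> real) \<Rightarrow> real) \<Rightarrow> ((nat \<Rightarrow> real) \<Rightarrow> real) \<Rightarrow> real" where
  "simplex_inner d \<kappa> f g =
     Gamma ((\<Sum>i=1..d+1. \<kappa> i) + real d + 1) / (\<Prod>i=1..d+1. Gamma (\<kappa> i + 1)) *
     set_lebesgue_integral (\<Pi>\<^sub>M i\<in>{1..d}. lborel) (std_simplex d)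
       (\<lambda>x. f x * g x * simplex_weight d \<kappa> x)"

definition jacobi_param :: "nat \<Rightarrow> (nat \<Rightarrow> real) \<Rightarrow> (nat \<Rightarrow> nat) \<Rightarrow> nat \<Rightarrow> real" where
  "jacobi_param d \<kappa> \<nu> j =
     (\<Sum>i=j+1..d+1. \<kappa> i) + 2 * real (\<Sum>i=j+1..d. \<nu> i) + real d - real j"

text \<open>
  For \<open>degree p \<le> n\<close> this is the polynomial \<open>u\<^sup>n p(s/u)\<close> in \<open>s\<close> and \<open>u\<close>, also at \<open>u = 0\<close>, where
  the expression \<open>u ^ n * poly p (s / u)\<close> has the wrong value because \<open>s / 0 = 0\<close>.
\<close>

definition poly_homog :: "nat \<Rightarrow> real poly \<Rightarrow> real \<Rightarrow> real \<Rightarrow> real" where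
  "poly_homog n p s u = (\<Sum>k\<le>n. coeff p k * s ^ k * u ^ (n - k))"

lemma poly_homog_eq:
  assumes "degree p \<le> n" "u \<noteq> 0"
  shows "poly_homog n p s u = u ^ n * poly p (s / u)"
proof -
  have "poly p (s / u) = (\<Sum>k\<le>n. coeff p k * (s / u) ^ k)"
    unfolding poly_altdef using assms(1)
    by (intro sum.mono_neutral_left) (auto simp: coeff_eq_0)
  then show ?thesis
    using assms(2)
    by (auto simp: poly_homog_def sum_distrib_left power_divide power_diff intro!: sum.cong)
qed

text \<open>The \<open>j\<close>-th factor is \<open>u ^ \<nu> j * poly (jacobi_poly \<dots>) (2 * x j / u - 1)\<close> with
  \<open>u = 1 - x 1 - \<dots> - x (j-1)\<close>, read as a polynomial in \<open>x\<close>; see \<open>simplex_jacobi_eq\<close>.\<close>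

definition simplex_jacobi ::
    "nat \<Rightarrow> (nat \<Rightarrow> real) \<Rightarrow> (nat \<Rightarrow> nat) \<Rightarrow> (nat \<Rightarrow> real) \<Rightarrow> real" where
  "simplex_jacobi d \<kappa> \<nu> x =
     (\<Prod>j=1..d. let u = 1 - (\<Sum>i=1..<j. x i) in
        poly_homog (\<nu> j) (jacobi_poly (\<nu> j) (jacobi_param d \<kappa> \<nu> j) (\<kappa> j)) (2 * x j - u) u)"

lemma simplex_jacobi_eq:
  assumes "\<And>j. j \<in> {1..d} \<Longrightarrow> 1 - (\<Sum>i=1..<j. x i) \<noteq> 0"
  shows "simplex_jacobi d \<kappa> \<nu> x =
    (\<Prod>j=1..d. (1 - (\<Sum>i=1..<j. x i)) ^ \<nu> j *
       poly (jacobi_poly (\<nu> j) (jacobi_param d \<kappa> \<nu> j) (\<kappa> j))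
         (2 * x j / (1 - (\<Sum>i=1..<j. x i)) - 1))"
  unfolding simplex_jacobi_def Let_def
proof (rule prod.cong)
  fix j assume "j \<in> {1..d}"
  then have u: "1 - (\<Sum>i=1..<j. x i) \<noteq> 0" by (rule assms)
  show "poly_homog (\<nu> j) (jacobi_poly (\<nu> j) (jacobi_param d \<kappa> \<nu> j) (\<kappa> j))
      (2 * x j - (1 - (\<Sum>i=1..<j. x i))) (1 - (\<Sum>i=1..<j. x i)) =
    (1 - (\<Sum>i=1..<j. x i)) ^ \<nu> j *
       poly (jacobi_poly (\<nu> j) (jacobi_param d \<kappa> \<nu> j) (\<kappa> j))
         (2 * x j / (1 - (\<Sum>i=1..<j. x i)) - 1)"
    using u by (subst poly_homog_eq[OF degree_jacobi_poly u]) (simp add: diff_divide_distrib)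
qed simp

definition simplex_jacobi_at1 :: "nat \<Rightarrow> (nat \<Rightarrow> real) \<Rightarrow> (nat \<Rightarrow> nat) \<Rightarrow> real" where
  "simplex_jacobi_at1 d \<kappa> \<nu> =
     (\<Prod>j=1..d. poly (jacobi_poly (\<nu> j) (jacobi_param d \<kappa> \<nu> j) (\<kappa> j)) 1)"

lemma simplex_jacobi_at1_eq:
  "simplex_jacobi_at1 d \<kappa> \<nu> =
     (\<Prod>j=1..d. pochhammer (jacobi_param d \<kappa> \<nu> j + 1) (\<nu> j) / fact (\<nu> j))"
  by (simp add: simplex_jacobi_at1_def poly_jacobi_poly_1)

definition simplex_norm :: "nat \<Rightarrow> (nat \<Rightarrow> real) \<Rightarrow> (nat \<Rightarrow> nat) \<Rightarrow> real" where
  "simplex_norm d \<kappa> \<nu> = simplex_inner d \<kappa> (simplex_jacobi d \<kappa> \<nu>) (simplex_jacobi d \<kappa> \<nu>)"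

definition simplex_perm :: "nat \<Rightarrow> (nat \<Rightarrow> nat) \<Rightarrow> (nat \<Rightarrow> real) \<Rightarrow> (nat \<Rightarrow> real)" where
  "simplex_perm d \<tau> x =
     (\<lambda>i\<in>{1..d}. if \<tau> i = d + 1 then 1 - (\<Sum>k=1..d. x k) else x (\<tau> i))"

definition simplex_conn ::
    "nat \<Rightarrow> (nat \<Rightarrow> real) \<Rightarrow> (nat \<Rightarrow> nat) \<Rightarrow> (nat \<Rightarrow> nat) \<Rightarrow> (nat \<Rightarrow> nat) \<Rightarrow> real" where
  "simplex_conn d \<kappa> \<tau> \<nu> =
     (let n = (\<Sum>i=1..d. \<nu> i) in
      THE c. (\<forall>\<mu>. \<mu> \<notin> multi_indices d n \<longrightarrow> c \<mu> = 0) \<and>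
        (\<forall>x\<in>std_simplex d. simplex_jacobi d (\<kappa> \<circ> \<tau>) \<nu> (simplex_perm d \<tau> x) =
           (\<Sum>\<mu>\<in>multi_indices d n. c \<mu> * simplex_jacobi d \<kappa> \<mu> x)))"

definition simplex_conn_normalized ::
    "nat \<Rightarrow> (nat \<Rightarrow> real) \<Rightarrow> (nat \<Rightarrow> nat) \<Rightarrow> (nat \<Rightarrow> nat) \<Rightarrow> (nat \<Rightarrow> nat) \<Rightarrow> real" where
  "simplex_conn_normalized d \<kappa> \<tau> \<nu> \<mu> =
     sqrt (simplex_norm d \<kappa> \<mu> / simplex_norm d (\<kappa> \<circ> \<tau>) \<nu>) * simplex_conn d \<kappa> \<tau> \<nu> \<mu>"


subsection \<open>Hahn polynomials\<close>

definition hahn_weight :: "nat \<Rightarrow> (nat \<Rightarrow> real) \<Rightarrow> (nat \<Rightarrow> nat) \<Rightarrow> real" where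
  "hahn_weight d \<kappa> \<alpha> = (\<Prod>i=1..d+1. pochhammer (\<kappa> i + 1) (\<alpha> i)) / (\<Prod>i=1..d+1. fact (\<alpha> i))"

definition hahn_inner ::
    "nat \<Rightarrow> (nat \<Rightarrow> real) \<Rightarrow> nat \<Rightarrow> ((nat \<Rightarrow> nat) \<Rightarrow> real) \<Rightarrow> ((nat \<Rightarrow> nat) \<Rightarrow> real) \<Rightarrow> real" where
  "hahn_inner d \<kappa> N f g =
     fact N / pochhammer ((\<Sum>i=1..d+1. \<kappa> i) + real d + 1) N *
     (\<Sum>\<alpha>\<in>multi_indices (d + 1) N. f \<alpha> * g \<alpha> * hahn_weight d \<kappa> \<alpha>)"

text \<open>The generating function. It is a polynomial identity in \<open>y\<close> when \<open>|\<nu>| \<le> N\<close>; the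
  hyperplane \<open>|y| = 0\<close>, where the left-hand side as written is undefined, is left out.\<close>

definition hahn :: "nat \<Rightarrow> (nat \<Rightarrow> real) \<Rightarrow> nat \<Rightarrow> (nat \<Rightarrow> nat) \<Rightarrow> (nat \<Rightarrow> nat) \<Rightarrow> real" where
  "hahn d \<kappa> N \<nu> =
     (THE H. (\<forall>\<alpha>. \<alpha> \<notin> multi_indices (d + 1) N \<longrightarrow> H \<alpha> = 0) \<and>
        (\<forall>y :: nat \<Rightarrow> real. let s = (\<Sum>i=1..d+1. y i) in s \<noteq> 0 \<longrightarrow>
           s ^ N * (simplex_jacobi d \<kappa> \<nu> (\<lambda>i. y i / s) / simplex_jacobi_at1 d \<kappa> \<nu>) =
           (\<Sum>\<alpha>\<in>multi_indices (d + 1) N.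
              fact N / (\<Prod>i=1..d+1. fact (\<alpha> i)) * H \<alpha> * (\<Prod>i=1..d+1. y i ^ \<alpha> i))))"

definition hahn_norm :: "nat \<Rightarrow> (nat \<Rightarrow> real) \<Rightarrow> nat \<Rightarrow> (nat \<Rightarrow> nat) \<Rightarrow> real" where
  "hahn_norm d \<kappa> N \<nu> = hahn_inner d \<kappa> N (hahn d \<kappa> N \<nu>) (hahn d \<kappa> N \<nu>)"

definition hahn_conn ::
    "nat \<Rightarrow> (nat \<Rightarrow> real) \<Rightarrow> nat \<Rightarrow> (nat \<Rightarrow> nat) \<Rightarrow> (nat \<Rightarrow> nat) \<Rightarrow> (nat \<Rightarrow> nat) \<Rightarrow> real" where
  "hahn_conn d \<kappa> N \<tau> \<nu> =
     (let n = (\<Sum>i=1..d. \<nu> i) in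
      THE h. (\<forall>\<mu>. \<mu> \<notin> multi_indices d n \<longrightarrow> h \<mu> = 0) \<and>
        (\<forall>\<alpha>\<in>multi_indices (d + 1) N. hahn d (\<kappa> \<circ> \<tau>) N \<nu> (\<alpha> \<circ> \<tau>) =
           (\<Sum>\<mu>\<in>multi_indices d n. h \<mu> * hahn d \<kappa> N \<mu> \<alpha>)))"

definition hahn_conn_normalized ::
    "nat \<Rightarrow> (nat \<Rightarrow> real) \<Rightarrow> nat \<Rightarrow> (nat \<Rightarrow> nat) \<Rightarrow> (nat \<Rightarrow> nat) \<Rightarrow> (nat \<Rightarrow> nat) \<Rightarrow> real" where
  "hahn_conn_normalized d \<kappa> N \<tau> \<nu> \<mu> =
     sqrt (hahn_norm d \<kappa> N \<mu> / hahn_norm d (\<kappa> \<circ> \<tau>) N \<nu>) * hahn_conn d \<kappa> N \<tau> \<nu> \<mu>"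

end

theory Submission
  imports Defs
begin

text \<open>
  The generating function is a linear injection from functions on lattice points \<open>\<alpha>\<close> to homogeneous
  polynomials of degree \<open>N\<close>. It commutes with permutations of the \<open>d + 1\<close> variables and sends \<open>H\<^sub>\<nu>\<close> to
  \<open>|y|\<^sup>N P\<^sub>\<nu>(y'/|y|) / p\<^sub>\<nu>\<close>. Hence a connection formula for the Hahn polynomials is a connection formula for
  the Jacobi polynomials on the simplex, with coefficients rescaled by the values \<open>p\<^sub>\<mu>\<close> and \<open>p\<^sub>\<nu>\<close>
  (\<open>hahn_conn_eq\<close>). For the normalized coefficients it remains to see that the squared norms satisfy
  \<open>B\<^sub>\<nu> = K A\<^sub>\<nu> / p\<^sub>\<nu>\<^sup>2\<close> with a factor \<open>K\<close> that depends on \<open>N\<close>, \<open>n\<close> and \<open>|\<kappa>|\<close> only, all of which are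
  unchanged by a permutation (\<open>hahn_norm_eq\<close>).

  All coefficients are defined by unique description, so existence and uniqueness of the expansions
  must be shown. Let \<open>u\<^sub>j = 1 - x\<^sub>1 - \<dots> - x\<^sub>j\<^sub>-\<^sub>1\<close>. In the stick-breaking coordinates \<open>t\<^sub>j = u\<^sub>j\<^sub>+\<^sub>1 / u\<^sub>j\<close> the weight
  of the simplex is a product of beta weights, and \<open>P\<^sub>\<nu>\<close> is a product of one-variable polynomials
  (\<open>simplex_jacobi_stick\<close>). So orthogonality and nonvanishing norms follow from the classical Jacobi
  polynomials (\<open>simplex_jacobi_orthogonal\<close>, \<open>simplex_norm_nonzero\<close>). The \<open>P\<^sub>\<nu>\<close> are triangular with
  respect to monomials in the \<open>u\<^sub>j\<close> and therefore span all polynomials (\<open>jacobi_span_stick_monomial\<close>).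
  A permuted Jacobi polynomial stays orthogonal to all polynomials of lower degree, because the Dirichlet
  moments are symmetric, so it expands in the \<open>P\<^sub>\<mu>\<close> of its own degree
  (\<open>simplex_jacobi_permuted_expansion\<close>).

  The relation between the norms comes from the moment formula
  \<open>E[y\<^sup>\<alpha>\<^sup>+\<^sup>\<beta>] = (\<kappa>+1)\<^sub>\<alpha> (\<kappa>+\<alpha>+1)\<^sub>\<beta> / (|\<kappa>|+d+1)\<^sub>|\<^sub>\<alpha>\<^sub>+\<^sub>\<beta>\<^sub>|\<close>. By it, the mean of \<open>P\<^sub>\<nu> y\<^sup>\<beta>\<close> is a multiple of the Hahn
  inner product of \<open>H\<^sub>\<nu>\<close> with the function \<open>\<alpha> \<mapsto> (\<kappa>+\<alpha>+1)\<^sub>\<beta>\<close> (\<open>simplex_mean_jacobi_monomial\<close>). On the other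
  hand, if \<open>P\<^sub>\<nu> = \<Sum> q\<^sub>\<beta> y\<^sup>\<beta>\<close> with \<open>|\<beta>| = n\<close>, then the multinomial theorem gives \<open>H\<^sub>\<nu>\<close> as a multiple of the
  combination, with the same \<open>q\<^sub>\<beta>\<close>, of products of falling factorials of the \<open>\<alpha>\<^sub>i\<close>. Falling and rising
  products have the same top-degree part, and \<open>H\<^sub>\<nu>\<close> is orthogonal to lower degrees, so both inner products
  agree (\<open>hahn_inner_falling\<close>).
\<close>

section \<open>Jacobi polynomials on the unit interval\<close>

text \<open>
  For positive \<open>b\<close> and \<open>c\<close> this is the integral of \<open>p(t) t\<^sup>b\<^sup>-\<^sup>1 (1 - t)\<^sup>c\<^sup>-\<^sup>1\<close> over the unit interval,
  written through its moments: orthogonality then becomes an identity between finite sums.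
\<close>

definition beta_functional :: "real \<Rightarrow> real \<Rightarrow> real poly \<Rightarrow> real" where
  "beta_functional b c p = (\<Sum>k\<le>degree p. coeff p k * Beta (b + real k) c)"

lemma beta_functional_bound:
  assumes "degree p \<le> D"
  shows "beta_functional b c p = (\<Sum>k\<le>D. coeff p k * Beta (b + real k) c)"
  unfolding beta_functional_def using assms
  by (intro sum.mono_neutral_left) (auto simp: coeff_eq_0)

lemma beta_functional_0 [simp]: "beta_functional b c 0 = 0"
  by (simp add: beta_functional_def)

lemma beta_functional_add:
  "beta_functional b c (p + q) = beta_functional b c p + beta_functional b c q"
proof -
  define D where "D = max (degree p) (degree q)"
  have "degree (p + q) \<le> D" "degree p \<le> D" "degree q \<le> D"
    by (auto simp: D_def degree_add_le)
  then show ?thesis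
    by (simp add: beta_functional_bound[of _ D] algebra_simps sum.distrib)
qed

lemma beta_functional_smult: "beta_functional b c (smult a p) = a * beta_functional b c p"
  by (subst beta_functional_bound[of _ "degree p"])
     (auto simp: beta_functional_def sum_distrib_left algebra_simps degree_smult_le)

lemma beta_functional_sum:
  "beta_functional b c (\<Sum>i\<in>A. p i) = (\<Sum>i\<in>A. beta_functional b c (p i))"
  by (induction A rule: infinite_finite_induct) (auto simp: beta_functional_add)

lemma beta_functional_monom_mult:
  "beta_functional b c (monom 1 m * p) = beta_functional (b + real m) c p"
proof -
  have deg: "degree (monom 1 m * p) \<le> m + degree p"
    by (metis degree_mult_le degree_monom_eq le_trans add_mono order_refl zero_neq_one)
  have "beta_functional b c (monom 1 m * p)
      = (\<Sum>k\<le>m + degree p. (if m \<le> k then coeff p (k - m) else 0) * Beta (b + real k) c)"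
    by (subst beta_functional_bound[OF deg]) (auto simp: coeff_monom_mult intro!: sum.cong)
  also have "\<dots> = (\<Sum>k\<in>{m..m + degree p}. coeff p (k - m) * Beta (b + real k) c)"
    by (intro sum.mono_neutral_cong_right) auto
  also have "\<dots> = (\<Sum>k\<le>degree p. coeff p k * Beta (b + real m + real k) c)"
    by (rule sum.reindex_bij_witness[where i = "\<lambda>k. k + m" and j = "\<lambda>k. k - m"])
       (auto simp: algebra_simps)
  finally show ?thesis by (simp add: beta_functional_def)
qed

text \<open>
  The Jacobi polynomial with argument \<open>1 - 2t\<close>, see \<open>poly_jacobi_unit\<close>. In the variable \<open>t\<close> the
  orthogonality weight is \<open>t\<^sup>a (1 - t)\<^sup>b\<close> on the unit interval.
\<close>

definition jacobi_unit :: "nat \<Rightarrow> real \<Rightarrow> real \<Rightarrow> real poly" where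
  "jacobi_unit n a b =
     (\<Sum>l\<le>n. monom ((-1) ^ l * (pochhammer (real n + a + b + 1) l
         * pochhammer (a + real l + 1) (n - l) / (fact l * fact (n - l)))) l)"

lemma coeff_jacobi_unit:
  "coeff (jacobi_unit n a b) l = (if l \<le> n then (-1) ^ l * (pochhammer (real n + a + b + 1) l
         * pochhammer (a + real l + 1) (n - l) / (fact l * fact (n - l))) else 0)"
  by (simp add: jacobi_unit_def coeff_sum)

lemma degree_jacobi_unit: "degree (jacobi_unit n a b) \<le> n"
  by (rule degree_le) (simp add: coeff_jacobi_unit)

lemma jacobi_unit_lead_nonzero:
  assumes "a > -1" "b > -1"
  shows "coeff (jacobi_unit n a b) n \<noteq> 0"
proof (cases "n = 0")
  case False
  then have "real n + a + b + 1 > 0" using assms by linarith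
  then show ?thesis by (simp add: coeff_jacobi_unit pochhammer_eq_0_iff)
qed (simp add: coeff_jacobi_unit)

text \<open>
  The sum is, up to sign, the \<open>n\<close>-th finite difference of \<open>q\<close> at 0, which kills polynomials of degree
  below \<open>n\<close>. The induction removes the constant coefficient and absorbs the remaining factor \<open>l\<close> into
  the binomial coefficient.
\<close>

lemma alternating_binomial_sum_poly:
  fixes q :: "real poly"
  assumes "degree q < n"
  shows "(\<Sum>l\<le>n. (-1) ^ l * real (n choose l) * poly q (real l)) = 0"
  using assms
proof (induction q arbitrary: n rule: measure_induct_rule[of degree])
  case (less q)
  obtain m where n: "n = Suc m" using less.prems by (cases n) auto
  obtain a r where q: "q = pCons a r" by (cases q)
  have const: "(\<Sum>l\<le>n. (-1) ^ l * real (n choose l)) = 0"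
    using choose_alternating_sum[of n, where 'a = real] n by simp
  define r1 where "r1 = pcompose r [:1, 1:]"
  have "(\<Sum>l\<le>n. (-1) ^ l * real (n choose l) * poly q (real l))
      = a * (\<Sum>l\<le>n. (-1) ^ l * real (n choose l))
        + (\<Sum>l\<le>n. (-1) ^ l * (real l * real (n choose l)) * poly r (real l))"
    by (simp add: q algebra_simps sum.distrib sum_distrib_left)
  also have "(\<Sum>l\<le>n. (-1) ^ l * (real l * real (n choose l)) * poly r (real l))
      = (\<Sum>l\<le>m. (-1) ^ Suc l * (real (Suc l) * real (n choose Suc l)) * poly r (real (Suc l)))"
    unfolding n by (subst sum.atMost_Suc_shift) simp
  also have "\<dots> = (\<Sum>l\<le>m. - real n * ((-1) ^ l * real (m choose l) * poly r1 (real l)))"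
  proof (rule sum.cong)
    fix l
    have "real (Suc l) * real (n choose Suc l) = real n * real (m choose l)"
      unfolding n by (metis Suc_times_binomial of_nat_mult)
    then show "(-1) ^ Suc l * (real (Suc l) * real (n choose Suc l)) * poly r (real (Suc l))
        = - real n * ((-1) ^ l * real (m choose l) * poly r1 (real l))"
      by (simp add: r1_def poly_pcompose mult.assoc)
  qed simp
  also have "\<dots> = - real n * (\<Sum>l\<le>m. (-1) ^ l * real (m choose l) * poly r1 (real l))"
    by (simp only: sum_distrib_left)
  also have "(\<Sum>l\<le>m. (-1) ^ l * real (m choose l) * poly r1 (real l)) = 0"
  proof (cases "r = 0")
    case False
    have "degree r1 = degree r" by (simp add: r1_def degree_pcompose)
    with False less show ?thesis by (simp add: q n)
  qed (simp add: r1_def)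
  finally show ?case using const by simp
qed

text \<open>
  The partial fraction expansion of \<open>n! / (c (c+1) \<cdots> (c+n))\<close>, by Pascal's rule.
\<close>

lemma alternating_binomial_sum_inverse:
  fixes c :: real
  assumes "c > 0"
  shows "(\<Sum>l\<le>n. (-1) ^ l * real (n choose l) / (c + real l)) = fact n / pochhammer c (Suc n)"
  using assms
proof (induction n arbitrary: c)
  case 0
  then show ?case by (simp add: field_simps)
next
  case (Suc n)
  have "(\<Sum>l\<le>Suc n. (-1) ^ l * real (Suc n choose l) / (c + real l))
      = 1 / c + (\<Sum>l\<le>n. (-1) ^ Suc l * real (Suc n choose Suc l) / (c + real (Suc l)))"
    by (subst sum.atMost_Suc_shift) simp
  also have "\<dots> = 1 / c + (\<Sum>l\<le>n. (-1) ^ Suc l * real (n choose Suc l) / (c + real (Suc l)))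
      - (\<Sum>l\<le>n. (-1) ^ l * real (n choose l) / (c + 1 + real l))"
    by (simp add: sum.distrib[symmetric] sum_subtractf[symmetric] add_divide_distrib
        diff_divide_distrib algebra_simps sum_negf)
  also have "1 / c + (\<Sum>l\<le>n. (-1) ^ Suc l * real (n choose Suc l) / (c + real (Suc l)))
      = (\<Sum>l\<le>Suc n. (-1) ^ l * real (n choose l) / (c + real l))"
    unfolding sum.atMost_Suc_shift[where n = n] by simp
  also have "\<dots> = (\<Sum>l\<le>n. (-1) ^ l * real (n choose l) / (c + real l))" by simp
  also have "\<dots> = fact n / pochhammer c (Suc n)" using Suc by simp
  also have "(\<Sum>l\<le>n. (-1) ^ l * real (n choose l) / (c + 1 + real l))
      = fact n / pochhammer (c + 1) (Suc n)" using Suc by simp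
  also have "fact n / pochhammer c (Suc n) - fact n / pochhammer (c + 1) (Suc n)
      = fact (Suc n) / pochhammer c (Suc (Suc n))"
  proof -
    define w where "w = c + 1 + real n"
    have w: "w > 0" "fact (Suc n) = (w - c) * fact n"
      using Suc.prems by (simp_all add: w_def algebra_simps)
    have p: "pochhammer (c + 1) n > 0" by (rule pochhammer_pos) (use Suc in simp)
    have 1: "pochhammer c (Suc n) = c * pochhammer (c + 1) n" by (rule pochhammer_rec)
    have 2: "pochhammer (c + 1) (Suc n) = pochhammer (c + 1) n * w"
      unfolding w_def by (rule pochhammer_Suc)
    have 3: "pochhammer c (Suc (Suc n)) = c * (pochhammer (c + 1) n * w)"
      using pochhammer_rec[of c "Suc n"] unfolding 2 .
    show ?thesis using p w(1) Suc.prems unfolding 1 2 3 w(2) by (simp add: field_simps)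
  qed
  finally show ?case .
qed

definition pochhammer_poly :: "real \<Rightarrow> nat \<Rightarrow> real poly" where
  "pochhammer_poly x k = (\<Prod>i<k. [:x + real i, 1:])"

lemma poly_pochhammer_poly: "poly (pochhammer_poly x k) l = pochhammer (x + l) k"
  by (simp add: pochhammer_poly_def poly_prod pochhammer_prod algebra_simps atLeast0LessThan)

lemma degree_pochhammer_poly: "degree (pochhammer_poly x k) \<le> k"
proof -
  have "degree (pochhammer_poly x k) \<le> (\<Sum>i<k. degree [:x + real i, 1:])"
    unfolding pochhammer_poly_def by (rule order_trans[OF degree_prod_sum_le]) (auto simp: o_def)
  then show ?thesis by simp
qed

lemma Beta_shift:
  assumes "x > 0" "y > 0"
  shows "Beta (x + real k) y = Beta x y * pochhammer x k / pochhammer (x + y) k"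
proof -
  have "x \<notin> \<int>\<^sub>\<le>\<^sub>0" "x + y \<notin> \<int>\<^sub>\<le>\<^sub>0" using assms nonpos_Ints_nonpos by fastforce+
  moreover have "Gamma x > 0" "Gamma (x + y) > 0" "Gamma (x + y + real k) > 0" using assms by auto
  ultimately show ?thesis by (simp add: Beta_def pochhammer_Gamma field_simps)
qed

text \<open>
  The Pochhammer symbols of the coefficients and of the moments combine to a polynomial in \<open>l\<close> times a
  ratio of Pochhammer symbols. For \<open>k < n\<close> this ratio is itself a polynomial in \<open>l\<close>; for \<open>k = n\<close> it has
  one simple pole.
\<close>

lemma beta_functional_jacobi_monom:
  assumes a: "a > -1" and b: "b > -1" and n: "n \<ge> 1"
  shows "beta_functional (a + 1) (b + 1) (monom 1 k * jacobi_unit n a b)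
    = Beta (a + 1) (b + 1) * pochhammer (a + 1) n / fact n *
      (\<Sum>l\<le>n. (-1) ^ l * real (n choose l) * pochhammer (a + 1 + real l) k
         * (pochhammer (a + b + 1 + real n) l / pochhammer (a + b + 2) (k + l)))"
proof -
  have "beta_functional (a + 1) (b + 1) (monom 1 k * jacobi_unit n a b)
      = (\<Sum>l\<le>n. coeff (jacobi_unit n a b) l * Beta (a + 1 + real (k + l)) (b + 1))"
    by (simp add: beta_functional_monom_mult beta_functional_bound[OF degree_jacobi_unit] add.assoc)
  also have "\<dots> = (\<Sum>l\<le>n. Beta (a + 1) (b + 1) * pochhammer (a + 1) n / fact n *
      ((-1) ^ l * real (n choose l) * pochhammer (a + 1 + real l) k
         * (pochhammer (a + b + 1 + real n) l / pochhammer (a + b + 2) (k + l))))"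
  proof (rule sum.cong)
    fix l assume "l \<in> {..n}"
    then have l: "l \<le> n" by simp
    have e1: "pochhammer (a + 1) n = pochhammer (a + 1) l * pochhammer (a + real l + 1) (n - l)"
      using pochhammer_product[OF l, of "a + 1"] by (simp add: algebra_simps)
    have e2: "pochhammer (a + 1) (k + l) = pochhammer (a + 1) l * pochhammer (a + 1 + real l) k"
      using pochhammer_product'[of "a + 1" l k] by (simp add: algebra_simps)
    have e3: "real (n choose l) = fact n / (fact l * fact (n - l))"
      using binomial_fact[OF l, where 'a = real] by simp
    have B: "Beta (a + 1 + real (k + l)) (b + 1) = Beta (a + 1) (b + 1) * pochhammer (a + 1) (k + l)
        / pochhammer (a + b + 2) (k + l)"
      using Beta_shift[of "a + 1" "b + 1" "k + l"] a b by (simp add: algebra_simps)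
    show "coeff (jacobi_unit n a b) l * Beta (a + 1 + real (k + l)) (b + 1) =
       Beta (a + 1) (b + 1) * pochhammer (a + 1) n / fact n *
      ((-1) ^ l * real (n choose l) * pochhammer (a + 1 + real l) k
         * (pochhammer (a + b + 1 + real n) l / pochhammer (a + b + 2) (k + l)))"
      using l unfolding B e1 e2 e3 coeff_jacobi_unit by (simp add: add.commute add.left_commute)
  qed simp
  finally show ?thesis by (simp only: sum_distrib_left)
qed

text \<open>
  The summand is \<open>(-1)\<^sup>l\<close> times a binomial coefficient times a polynomial in \<open>l\<close> of degree
  \<open>k + (n - 1 - k) = n - 1\<close>, so the sum is a vanishing \<open>n\<close>-th difference.
\<close>

lemma beta_functional_jacobi_lower:
  assumes a: "a > -1" and b: "b > -1" and k: "k < n"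
  shows "beta_functional (a + 1) (b + 1) (monom 1 k * jacobi_unit n a b) = 0"
proof -
  define A where "A = a + b + 1"
  have A: "A > -1" using a b by (simp add: A_def)
  define q where "q = pochhammer_poly (a + 1) k * pochhammer_poly (A + 1 + real k) (n - 1 - k)"
  have deg: "degree q < n"
  proof -
    have "degree q \<le> k + (n - 1 - k)"
      unfolding q_def by (intro order_trans[OF degree_mult_le] add_mono degree_pochhammer_poly)
    then show ?thesis using k by simp
  qed
  have "(\<Sum>l\<le>n. (-1) ^ l * real (n choose l) * pochhammer (a + 1 + real l) k
         * (pochhammer (A + real n) l / pochhammer (A + 1) (k + l)))
      = (\<Sum>l\<le>n. (-1) ^ l * real (n choose l) * poly q (real l) / pochhammer (A + 1) (n - 1))"
  proof (rule sum.cong)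
    fix l
    have "pochhammer (A + 1) (n - 1 + l) = pochhammer (A + 1) (n - 1) * pochhammer (A + real n) l"
      using pochhammer_product'[of "A + 1" "n - 1" l] k by (simp add: of_nat_diff)
    moreover have "pochhammer (A + 1) (n - 1 + l)
        = pochhammer (A + 1) (k + l) * pochhammer (A + 1 + real k + real l) (n - 1 - k)"
      using pochhammer_product[of "k + l" "n - 1 + l" "A + 1"] k by (simp add: add.assoc)
    moreover have "pochhammer (A + 1) (n - 1) > 0" "pochhammer (A + 1) (k + l) > 0"
      using A by (auto intro!: pochhammer_pos)
    ultimately have "pochhammer (A + real n) l / pochhammer (A + 1) (k + l)
        = pochhammer (A + 1 + real k + real l) (n - 1 - k) / pochhammer (A + 1) (n - 1)"
      by (simp add: field_simps)
    then show "(-1) ^ l * real (n choose l) * pochhammer (a + 1 + real l) k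
         * (pochhammer (A + real n) l / pochhammer (A + 1) (k + l))
      = (-1) ^ l * real (n choose l) * poly q (real l) / pochhammer (A + 1) (n - 1)"
      by (simp add: q_def poly_pochhammer_poly)
  qed simp
  also have "\<dots> = 0"
    using alternating_binomial_sum_poly[OF deg] by (simp add: sum_divide_distrib[symmetric])
  finally show ?thesis
    using beta_functional_jacobi_monom[OF a b, of n k] k by (simp add: A_def add.assoc)
qed

text \<open>
  Here the summand is a polynomial \<open>r(l)\<close> divided by \<open>c + l\<close>. Dividing off the pole leaves a quotient of
  degree below \<open>n\<close>, which contributes nothing, and the remainder \<open>r(-c) / (c + l)\<close>, whose alternating sum
  is explicit. That \<open>r(-c)\<close> is nonzero amounts to \<open>b > -1\<close>.
\<close>

lemma beta_functional_jacobi_top: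
  assumes a: "a > -1" and b: "b > -1"
  shows "beta_functional (a + 1) (b + 1) (monom 1 n * jacobi_unit n a b) \<noteq> 0"
proof (cases "n = 0")
  case True
  have "Beta (a + 1) (b + 1) > 0" using a b by (simp add: Beta_def)
  then show ?thesis using True by (simp add: beta_functional_def jacobi_unit_def)
next
  case False
  define c where "c = a + b + 1 + real n"
  have c: "c > 0" using False a b by (simp add: c_def) 
  define r where "r = pochhammer_poly (a + 1) n"
  \<comment> \<open>Division by the linear factor that causes the pole.\<close>
  define q where "q = synthetic_div r (-c)"
  have r: "poly r x = (c + x) * poly q x + poly r (-c)" for x
  proof -
    have "poly r x = poly ([:- (-c), 1:] * q + [:poly r (-c):]) x"
      unfolding q_def by (simp only: synthetic_div_correct')
    then show ?thesis by (simp add: algebra_simps)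
  qed
  have deg: "degree q < n"
    using degree_pochhammer_poly[of "a + 1" n] False
    by (simp add: q_def degree_synthetic_div r_def)
  have S: "(\<Sum>l\<le>n. (-1) ^ l * real (n choose l) * (poly r (real l) / (c + real l)))
      = poly r (-c) * (fact n / pochhammer c (Suc n))"
  proof -
    have "(\<Sum>l\<le>n. (-1) ^ l * real (n choose l) * (poly r (real l) / (c + real l)))
        = (\<Sum>l\<le>n. (-1) ^ l * real (n choose l) * poly q (real l)
           + poly r (-c) * ((-1) ^ l * real (n choose l) / (c + real l)))"
    proof (rule sum.cong)
      fix l
      have "c + real l \<noteq> 0" using c by linarith
      then show "(-1) ^ l * real (n choose l) * (poly r (real l) / (c + real l))
          = (-1) ^ l * real (n choose l) * poly q (real l)
           + poly r (-c) * ((-1) ^ l * real (n choose l) / (c + real l))"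
        by (subst r) (simp add: field_simps)
    qed simp
    then show ?thesis
      by (simp only: sum.distrib sum_distrib_left[symmetric] alternating_binomial_sum_poly[OF deg]
          alternating_binomial_sum_inverse[OF c] add_0_left)
  qed
  have "(\<Sum>l\<le>n. (-1) ^ l * real (n choose l) * pochhammer (a + 1 + real l) n
         * (pochhammer c l / pochhammer (a + b + 2) (n + l)))
      = (\<Sum>l\<le>n. (-1) ^ l * real (n choose l) * (poly r (real l) / (c + real l))
          / pochhammer (a + b + 2) (n - 1))"
  proof (rule sum.cong)
    fix l
    have "pochhammer (a + b + 2) (n + l)
        = pochhammer (a + b + 2) (n - 1) * pochhammer (a + b + 2 + real (n - 1)) (Suc l)"
      using pochhammer_product'[of "a + b + 2" "n - 1" "Suc l"] False by simp
    also have "a + b + 2 + real (n - 1) = c" using False by (simp add: c_def of_nat_diff)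
    also have "pochhammer c (Suc l) = pochhammer c l * (c + real l)" by (rule pochhammer_Suc)
    finally have e: "pochhammer (a + b + 2) (n + l)
        = pochhammer (a + b + 2) (n - 1) * (pochhammer c l * (c + real l))" .
    have "pochhammer c l > 0" using c by (rule pochhammer_pos)
    then show "(-1) ^ l * real (n choose l) * pochhammer (a + 1 + real l) n
         * (pochhammer c l / pochhammer (a + b + 2) (n + l))
       = (-1) ^ l * real (n choose l) * (poly r (real l) / (c + real l))
          / pochhammer (a + b + 2) (n - 1)"
      unfolding e by (simp add: r_def poly_pochhammer_poly)
  qed simp
  also have "\<dots> = poly r (-c) * (fact n / pochhammer c (Suc n)) / pochhammer (a + b + 2) (n - 1)"
    by (simp only: S[symmetric] sum_divide_distrib)
  also have "\<dots> \<noteq> 0"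
  proof -
    have "poly r (-c) \<noteq> 0"
    proof
      assume "poly r (-c) = 0"
      then obtain k where "k < n" "a + 1 - c = - real k"
        by (auto simp: r_def poly_pochhammer_poly pochhammer_eq_0_iff)
      then have "b = real k - real n" "real k + 1 \<le> real n" by (auto simp: c_def)
      then show False using b by linarith
    qed
    moreover have "pochhammer c (Suc n) > 0" using c by (rule pochhammer_pos)
    moreover have "pochhammer (a + b + 2) (n - 1) > 0" using a b by (intro pochhammer_pos) linarith
    ultimately show ?thesis by simp
  qed
  finally have "(\<Sum>l\<le>n. (-1) ^ l * real (n choose l) * pochhammer (a + 1 + real l) n
         * (pochhammer c l / pochhammer (a + b + 2) (n + l))) \<noteq> 0" .
  moreover have "Beta (a + 1) (b + 1) > 0"
    using a b by (simp add: Beta_def)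
  moreover have "pochhammer (a + 1) n > 0" using a by (intro pochhammer_pos) simp
  ultimately show ?thesis
    using False by (subst beta_functional_jacobi_monom[OF a b]) (auto simp: c_def)
qed

lemma beta_functional_mult:
  assumes "degree p \<le> m"
  shows "beta_functional b c (p * q) = (\<Sum>k\<le>m. coeff p k * beta_functional b c (monom 1 k * q))"
proof -
  have "p = (\<Sum>k\<le>m. smult (coeff p k) (monom 1 k))"
    using assms by (subst poly_as_sum_of_monoms'[OF assms, symmetric]) (simp add: smult_monom)
  then have "p * q = (\<Sum>k\<le>m. smult (coeff p k) (monom 1 k * q))"
    by (metis (no_types, lifting) sum.cong sum_distrib_right mult_smult_left)
  then show ?thesis by (simp add: beta_functional_sum beta_functional_smult)
qed

lemma jacobi_orthogonal:
  assumes "a > -1" "b > -1" "m \<noteq> n"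
  shows "beta_functional (a + 1) (b + 1) (jacobi_unit m a b * jacobi_unit n a b) = 0"
proof -
  have *: "beta_functional (a + 1) (b + 1) (jacobi_unit m a b * jacobi_unit n a b) = 0"
    if "m < n" for m n
    using that assms(1,2)
    by (simp add: beta_functional_mult[OF degree_jacobi_unit] beta_functional_jacobi_lower)
  show ?thesis using assms(3) *[of m n] *[of n m] by (metis linorder_neqE_nat mult.commute)
qed

lemma jacobi_norm_nonzero:
  assumes "a > -1" "b > -1"
  shows "beta_functional (a + 1) (b + 1) (jacobi_unit n a b * jacobi_unit n a b) \<noteq> 0"
proof -
  have "beta_functional (a + 1) (b + 1) (jacobi_unit n a b * jacobi_unit n a b)
      = (\<Sum>k\<le>n. if k = n then coeff (jacobi_unit n a b) n
          * beta_functional (a + 1) (b + 1) (monom 1 n * jacobi_unit n a b) else 0)"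
    unfolding beta_functional_mult[OF degree_jacobi_unit]
    using assms by (intro sum.cong) (auto simp: beta_functional_jacobi_lower)
  then show ?thesis
    using assms by (simp add: jacobi_unit_lead_nonzero beta_functional_jacobi_top)
qed

section \<open>Integrals over the simplex\<close>

text \<open>
  These are the lengths that remain after the first \<open>j - 1\<close> pieces have been broken off a stick of length
  1. The ratios of consecutive remainders are the stick-breaking coordinates; in them the weight of the
  simplex is a product of one-variable beta weights.
\<close>

definition remainder :: "(nat \<Rightarrow> real) \<Rightarrow> nat \<Rightarrow> real" where
  "remainder x j = 1 - (\<Sum>i=1..<j. x i)"

lemma remainder_1 [simp]: "remainder x (Suc 0) = 1"
  by (simp add: remainder_def)

lemma remainder_Suc: "1 \<le> j \<Longrightarrow> remainder x (Suc j) = remainder x j - x j"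
  by (simp add: remainder_def)

lemma remainder_last: "remainder x (Suc d) = 1 - (\<Sum>i=1..d. x i)"
  by (simp add: remainder_def atLeastLessThanSuc_atLeastAtMost)

lemma remainder_mono:
  assumes "x \<in> std_simplex d" "j \<le> k" "k \<le> Suc d"
  shows "remainder x k \<le> remainder x j"
proof -
  have "(\<Sum>i=1..<j. x i) \<le> (\<Sum>i=1..<k. x i)"
    using assms by (intro sum_mono2) (auto simp: std_simplex_def)
  then show ?thesis by (simp add: remainder_def)
qed

lemma remainder_nonneg:
  assumes "x \<in> std_simplex d" "k \<le> Suc d"
  shows "0 \<le> remainder x k"
proof -
  have "0 \<le> remainder x (Suc d)" using assms by (simp add: remainder_last std_simplex_def)
  then show ?thesis using remainder_mono[OF assms(1,2) order_refl] by linarith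
qed

lemma Beta_pos: "x > 0 \<Longrightarrow> y > 0 \<Longrightarrow> Beta x y > (0::real)"
  by (simp add: Beta_def)

lemma nn_integral_beta_scaled:
  assumes "u \<ge> 0" "a > -1" "c > -1"
  shows "(\<integral>\<^sup>+t. ennreal (indicator {0..u} t * (t powr a * (u - t) powr c)) \<partial>lborel)
    = ennreal (Beta (a + 1) (c + 1) * u powr (a + c + 1))"
proof (cases "u = 0")
  case True
  then have "(\<lambda>t. ennreal (indicator {0..u} t * (t powr a * (u - t) powr c))) = (\<lambda>_. 0)"
    by (auto simp: indicator_def)
  with True show ?thesis by simp
next
  case False
  then have u: "u > 0" using assms by simp
  have B: "Beta (a + 1) (c + 1) \<ge> 0" using assms by (simp add: Beta_def)
  have "((\<lambda>t. t powr a * (1 - t) powr c) has_integral Beta (a + 1) (c + 1)) {0..1}"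
    using has_integral_Beta_real[of "a + 1" "c + 1"] assms by simp
  from nn_integral_has_integral_lebesgue[OF _ this]
  have unit: "(\<integral>\<^sup>+t. ennreal (indicator {0..1} t * (t powr a * (1 - t) powr c)) \<partial>lborel)
      = ennreal (Beta (a + 1) (c + 1))" by simp
  have "(\<integral>\<^sup>+t. ennreal (indicator {0..u} t * (t powr a * (u - t) powr c)) \<partial>lborel)
      = u * (\<integral>\<^sup>+t. ennreal (indicator {0..u} (u * t) * ((u * t) powr a * (u - u * t) powr c)) \<partial>lborel)"
    using u by (subst nn_integral_real_affine[where t = 0 and c = u]) auto
  also have "(\<integral>\<^sup>+t. ennreal (indicator {0..u} (u * t) * ((u * t) powr a * (u - u * t) powr c)) \<partial>lborel)
      = (\<integral>\<^sup>+t. ennreal (u powr (a + c)) * ennreal (indicator {0..1} t * (t powr a * (1 - t) powr c)) \<partial>lborel)"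
  proof (rule nn_integral_cong)
    fix t :: real
    have i: "(indicator {0..u} (u * t) :: real) = indicator {0..1} t"
      using u by (auto simp: indicator_def zero_le_mult_iff)
    have "u - u * t = u * (1 - t)" by (simp add: algebra_simps)
    then have "indicator {0..1} t * ((u * t) powr a * (u - u * t) powr c)
        = u powr (a + c) * (indicator {0..1} t * (t powr a * (1 - t) powr c))"
      using u by (auto simp: indicator_def powr_mult powr_add)
    then show "ennreal (indicator {0..u} (u * t) * ((u * t) powr a * (u - u * t) powr c))
      = ennreal (u powr (a + c)) * ennreal (indicator {0..1} t * (t powr a * (1 - t) powr c))"
      unfolding i by (simp only: ennreal_mult'[symmetric] powr_ge_zero)
  qed
  also have "\<dots> = ennreal (u powr (a + c)) * ennreal (Beta (a + 1) (c + 1))"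
    by (subst nn_integral_cmult) (simp_all add: unit)
  also have "ennreal u * \<dots> = ennreal (u * (u powr (a + c) * Beta (a + 1) (c + 1)))"
    using u B by (simp add: ennreal_mult)
  also have "u * (u powr (a + c) * Beta (a + 1) (c + 1)) = Beta (a + 1) (c + 1) * u powr (a + c + 1)"
    using u by (simp add: powr_add)
  finally show ?thesis .
qed

lemma std_simplex_sets [measurable]: "std_simplex d \<in> sets (\<Pi>\<^sub>M i\<in>{1..d}. lborel)"
proof -
  have "std_simplex d = {x \<in> space (\<Pi>\<^sub>M i\<in>{1..d}. lborel :: real measure).
      (\<forall>i\<in>{1..d}. 0 \<le> x i) \<and> (\<Sum>i=1..d. x i) \<le> 1}"
    by (simp add: std_simplex_def space_PiM)
  also have "\<dots> \<in> sets (\<Pi>\<^sub>M i\<in>{1..d}. lborel)"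
    by measurable
  finally show ?thesis .
qed

text \<open>
  Arbitrary real powers of the remainders are allowed because integrating out the last coordinate
  shifts the exponent of the preceding remainder by a real number. This one family contains the
  weighted monomials in the coordinates as well as those in the stick-breaking ratios.
\<close>

definition stick_integrand ::
    "nat \<Rightarrow> (nat \<Rightarrow> real) \<Rightarrow> (nat \<Rightarrow> real) \<Rightarrow> (nat \<Rightarrow> real) \<Rightarrow> real" where
  "stick_integrand d \<kappa> \<gamma> x = (\<Prod>j=1..d. x j powr \<kappa> j * remainder x (Suc j) powr \<gamma> j)"

text \<open>
  The second parameter of the beta integral over the \<open>j\<close>-th stick-breaking coordinate, after the
  coordinates \<open>j + 1, \<dots>, d\<close> have been integrated out.
\<close>

definition stick_shape :: "nat \<Rightarrow> (nat \<Rightarrow> real) \<Rightarrow> (nat \<Rightarrow> real) \<Rightarrow> nat \<Rightarrow> real" where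
  "stick_shape d \<kappa> \<gamma> j = 1 + (\<Sum>i=j..d. \<gamma> i) + (\<Sum>i=Suc j..d. \<kappa> i + 1)"

lemma stick_integrand_measurable [measurable]:
  "stick_integrand d \<kappa> \<gamma> \<in> borel_measurable (\<Pi>\<^sub>M i\<in>{1..d}. lborel)"
  unfolding stick_integrand_def remainder_def
  by (intro borel_measurable_prod borel_measurable_times powr_real_measurable
      borel_measurable_const borel_measurable_diff borel_measurable_sum) measurable

lemma stick_integrand_nonneg: "0 \<le> stick_integrand d \<kappa> \<gamma> x"
  unfolding stick_integrand_def by (intro prod_nonneg) auto

text \<open>
  Integrating out the last coordinate over \<open>[0, u]\<close>, where \<open>u\<close> is the last remainder of the shorter vector,
  gives a beta value times a power of \<open>u\<close>. This leaves an integral of the same form in one dimension less.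
\<close>

lemma nn_integral_stick:
  assumes "\<And>j. j \<in> {1..d} \<Longrightarrow> \<kappa> j > -1" "\<And>j. j \<in> {1..d} \<Longrightarrow> stick_shape d \<kappa> \<gamma> j > 0"
  shows "(\<integral>\<^sup>+x. ennreal (indicator (std_simplex d) x * stick_integrand d \<kappa> \<gamma> x) \<partial>(\<Pi>\<^sub>M i\<in>{1..d}. lborel))
    = ennreal (\<Prod>j=1..d. Beta (\<kappa> j + 1) (stick_shape d \<kappa> \<gamma> j))"
  using assms
proof (induction d arbitrary: \<gamma>)
  case 0
  interpret product_sigma_finite "\<lambda>_. lborel :: real measure" ..
  show ?case
    by (simp add: PiM_empty nn_integral_count_space_finite max_def stick_integrand_def std_simplex_def)
next
  case (Suc d)
  interpret product_sigma_finite "\<lambda>_. lborel :: real measure" ..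
  let ?M = "\<lambda>d. \<Pi>\<^sub>M i\<in>{1..d}. (lborel :: real measure)"
  have ins: "{1..Suc d} = insert (Suc d) {1..d}" by auto
  define a where "a = \<kappa> (Suc d)"
  define c where "c = \<gamma> (Suc d)"
  have a: "a > -1" using Suc.prems(1)[of "Suc d"] by (simp add: a_def)
  have c: "c > -1" using Suc.prems(2)[of "Suc d"] by (simp add: stick_shape_def c_def)
  define B where "B = Beta (a + 1) (c + 1)"
  have B: "B \<ge> 0" using a c by (simp add: B_def Beta_def)
  define \<gamma>' where "\<gamma>' = \<gamma>(d := \<gamma> d + (a + c + 1))"
  have shape: "stick_shape d \<kappa> \<gamma>' j = stick_shape (Suc d) \<kappa> \<gamma> j" if "j \<in> {1..d}" for j
  proof -
    obtain e where d: "d = Suc e" using \<open>j \<in> {1..d}\<close> by (cases d) auto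
    have "(\<Sum>i=j..d. \<gamma>' i) = (\<Sum>i=j..e. \<gamma> i) + \<gamma> d + (a + c + 1)"
      using that by (simp add: d sum.nat_ivl_Suc' \<gamma>'_def)
    moreover have "(\<Sum>i=j..Suc d. \<gamma> i) = (\<Sum>i=j..e. \<gamma> i) + \<gamma> d + c"
      using that by (simp add: d sum.nat_ivl_Suc' c_def)
    moreover have "(\<Sum>i=Suc j..Suc d. \<kappa> i + 1) = (\<Sum>i=Suc j..d. \<kappa> i + 1) + (a + 1)"
      using that by (simp add: a_def)
    ultimately show ?thesis by (simp add: stick_shape_def)
  qed
  have inner: "(\<integral>\<^sup>+y. ennreal (indicator (std_simplex (Suc d)) (x(Suc d := y))
        * stick_integrand (Suc d) \<kappa> \<gamma> (x(Suc d := y))) \<partial>lborel)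
      = ennreal B * ennreal (indicator (std_simplex d) x * stick_integrand d \<kappa> \<gamma>' x)"
    if x: "x \<in> space (?M d)" for x
  proof -
    define u where "u = remainder x (Suc d)"
    have xE: "x \<in> extensional {1..d}" using x by (simp add: space_PiM PiE_def)
    have ind: "(indicator (std_simplex (Suc d)) (x(Suc d := y)) :: real)
        = indicator (std_simplex d) x * indicator {0..u} y" for y
    proof -
      have "(\<Sum>i=1..d. (x(Suc d := y)) i) = (\<Sum>i=1..d. x i)" by (intro sum.cong) auto
      moreover have "x(Suc d := y) \<in> {1..Suc d} \<rightarrow>\<^sub>E UNIV" "x \<in> {1..d} \<rightarrow>\<^sub>E UNIV"
        using xE by (auto simp: PiE_def extensional_def)
      moreover have "(\<forall>i\<in>{1..Suc d}. 0 \<le> (x(Suc d := y)) i) \<longleftrightarrow> (\<forall>i\<in>{1..d}. 0 \<le> x i) \<and> 0 \<le> y"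
        by (auto simp: ins)
      ultimately show ?thesis
        by (auto simp: indicator_def std_simplex_def u_def remainder_last)
    qed
    have rem: "remainder (x(Suc d := y)) j = remainder x j" if "j \<le> Suc d" for y j
      unfolding remainder_def using that by (intro arg_cong2[where f = minus] sum.cong) auto
    have sint: "stick_integrand (Suc d) \<kappa> \<gamma> (x(Suc d := y))
        = stick_integrand d \<kappa> \<gamma> x * (y powr a * (u - y) powr c)" for y
    proof -
      have "(\<Prod>j=1..d. (x(Suc d := y)) j powr \<kappa> j * remainder (x(Suc d := y)) (Suc j) powr \<gamma> j)
          = stick_integrand d \<kappa> \<gamma> x"
        unfolding stick_integrand_def by (intro prod.cong) (auto simp: rem)
      moreover have "remainder (x(Suc d := y)) (Suc (Suc d)) = u - y"
        by (simp add: remainder_Suc rem u_def)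
      ultimately show ?thesis by (simp add: stick_integrand_def a_def c_def)
    qed
    show ?thesis
    proof (cases "x \<in> std_simplex d")
      case False
      then show ?thesis by (simp add: ind)
    next
      case True
      then have u: "u \<ge> 0" unfolding u_def by (rule remainder_nonneg) simp
      have "(\<integral>\<^sup>+y. ennreal (indicator (std_simplex (Suc d)) (x(Suc d := y))
          * stick_integrand (Suc d) \<kappa> \<gamma> (x(Suc d := y))) \<partial>lborel)
        = (\<integral>\<^sup>+y. ennreal (stick_integrand d \<kappa> \<gamma> x)
            * ennreal (indicator {0..u} y * (y powr a * (u - y) powr c)) \<partial>lborel)"
        unfolding ind sint using True stick_integrand_nonneg
        by (intro nn_integral_cong) (simp add: ennreal_mult'[symmetric] mult_ac)
      also have "\<dots> = ennreal (stick_integrand d \<kappa> \<gamma> x) * ennreal (B * u powr (a + c + 1))"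
        by (subst nn_integral_cmult) (use nn_integral_beta_scaled[OF u a c] in \<open>simp_all add: B_def\<close>)
      also have "\<dots> = ennreal B * ennreal (stick_integrand d \<kappa> \<gamma> x * u powr (a + c + 1))"
        using B stick_integrand_nonneg by (simp add: ennreal_mult'[symmetric] mult_ac)
      also have "stick_integrand d \<kappa> \<gamma> x * u powr (a + c + 1) = stick_integrand d \<kappa> \<gamma>' x"
      proof (cases d)
        case 0
        then show ?thesis by (simp add: stick_integrand_def u_def)
      next
        case (Suc e)
        have "(\<Prod>j=1..e. x j powr \<kappa> j * remainder x (Suc j) powr \<gamma>' j)
            = (\<Prod>j=1..e. x j powr \<kappa> j * remainder x (Suc j) powr \<gamma> j)"
          by (intro prod.cong) (auto simp: \<gamma>'_def Suc)
        then show ?thesis by (simp add: stick_integrand_def Suc u_def \<gamma>'_def powr_add)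
      qed
      also have "stick_integrand d \<kappa> \<gamma>' x
          = indicator (std_simplex d) x * stick_integrand d \<kappa> \<gamma>' x"
        using True by simp
      finally show ?thesis .
    qed
  qed
  have meas: "(\<lambda>x. ennreal (indicator (std_simplex (Suc d)) x * stick_integrand (Suc d) \<kappa> \<gamma> x))
      \<in> borel_measurable (?M (Suc d))"
    by measurable
  have "(\<integral>\<^sup>+x. ennreal (indicator (std_simplex (Suc d)) x * stick_integrand (Suc d) \<kappa> \<gamma> x) \<partial>(?M (Suc d)))
      = (\<integral>\<^sup>+x. (\<integral>\<^sup>+y. ennreal (indicator (std_simplex (Suc d)) (x(Suc d := y))
        * stick_integrand (Suc d) \<kappa> \<gamma> (x(Suc d := y))) \<partial>lborel) \<partial>(?M d))"
    using product_nn_integral_insert[of "{1..d}" "Suc d"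
        "\<lambda>x. ennreal (indicator (std_simplex (Suc d)) x * stick_integrand (Suc d) \<kappa> \<gamma> x)"] meas
    unfolding ins by simp
  also have "\<dots> = (\<integral>\<^sup>+x. ennreal B * ennreal (indicator (std_simplex d) x * stick_integrand d \<kappa> \<gamma>' x) \<partial>(?M d))"
    by (intro nn_integral_cong inner)
  also have "\<dots> = ennreal B * (\<integral>\<^sup>+x. ennreal (indicator (std_simplex d) x * stick_integrand d \<kappa> \<gamma>' x) \<partial>(?M d))"
    by (rule nn_integral_cmult) measurable
  also have "(\<integral>\<^sup>+x. ennreal (indicator (std_simplex d) x * stick_integrand d \<kappa> \<gamma>' x) \<partial>(?M d))
      = ennreal (\<Prod>j=1..d. Beta (\<kappa> j + 1) (stick_shape d \<kappa> \<gamma>' j))"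
    using Suc.prems by (intro Suc.IH) (simp_all add: shape)
  also have "ennreal B * \<dots> = ennreal ((\<Prod>j=1..d. Beta (\<kappa> j + 1) (stick_shape d \<kappa> \<gamma>' j)) * B)"
    using B by (simp add: ennreal_mult'[symmetric] mult.commute)
  also have "(\<Prod>j=1..d. Beta (\<kappa> j + 1) (stick_shape d \<kappa> \<gamma>' j)) * B
      = (\<Prod>j=1..Suc d. Beta (\<kappa> j + 1) (stick_shape (Suc d) \<kappa> \<gamma> j))"
  proof -
    have "Beta (\<kappa> (Suc d) + 1) (stick_shape (Suc d) \<kappa> \<gamma> (Suc d)) = B"
      by (simp add: B_def a_def c_def stick_shape_def add.commute)
    then show ?thesis by (simp add: shape)
  qed
  finally show ?case .
qed

text \<open>
  The inner product on the simplex depends on the product of its arguments only; \<open>simplex_mean\<close> is this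
  dependence, and is the expectation under the Dirichlet distribution with parameters \<open>\<kappa>\<^sub>i + 1\<close>.
\<close>

definition simplex_integrable :: "nat \<Rightarrow> (nat \<Rightarrow> real) \<Rightarrow> ((nat \<Rightarrow> real) \<Rightarrow> real) \<Rightarrow> bool" where
  "simplex_integrable d \<kappa> f \<longleftrightarrow>
     set_integrable (\<Pi>\<^sub>M i\<in>{1..d}. lborel) (std_simplex d) (\<lambda>x. f x * simplex_weight d \<kappa> x)"

definition simplex_mean :: "nat \<Rightarrow> (nat \<Rightarrow> real) \<Rightarrow> ((nat \<Rightarrow> real) \<Rightarrow> real) \<Rightarrow> real" where
  "simplex_mean d \<kappa> f =
     Gamma ((\<Sum>i=1..d+1. \<kappa> i) + real d + 1) / (\<Prod>i=1..d+1. Gamma (\<kappa> i + 1)) *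
     set_lebesgue_integral (\<Pi>\<^sub>M i\<in>{1..d}. lborel) (std_simplex d)
       (\<lambda>x. f x * simplex_weight d \<kappa> x)"

lemma simplex_inner_eq_mean: "simplex_inner d \<kappa> f g = simplex_mean d \<kappa> (\<lambda>x. f x * g x)"
  by (simp add: simplex_inner_def simplex_mean_def)

text \<open>
  On the face where the last barycentric coordinate vanishes the weight is 0 (also for exponent 0, by the
  convention \<open>0 powr 0 = 0\<close>), so that values there are irrelevant. Off this face all remainders are
  positive and the stick-breaking ratios make sense.
\<close>

lemma simplex_mean_cong:
  assumes "\<And>x. x \<in> std_simplex d \<Longrightarrow> remainder x (Suc d) > 0 \<Longrightarrow> f x = g x"
  shows "simplex_mean d \<kappa> f = simplex_mean d \<kappa> g"
    and "simplex_integrable d \<kappa> f \<longleftrightarrow> simplex_integrable d \<kappa> g"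
proof -
  have "f x * simplex_weight d \<kappa> x = g x * simplex_weight d \<kappa> x" if x: "x \<in> std_simplex d" for x
  proof (cases "remainder x (Suc d) = 0")
    case True
    then have "simplex_weight d \<kappa> x = 0" by (simp add: simplex_weight_def remainder_last)
    then show ?thesis by simp
  next
    case False
    then have "remainder x (Suc d) > 0" using remainder_nonneg[OF x order_refl] by simp
    then show ?thesis using assms[OF x] by simp
  qed
  then have "(\<lambda>x. indicator (std_simplex d) x *\<^sub>R (f x * simplex_weight d \<kappa> x))
      = (\<lambda>x. indicator (std_simplex d) x *\<^sub>R (g x * simplex_weight d \<kappa> x))"
    by (auto simp: indicator_def)
  then show "simplex_mean d \<kappa> f = simplex_mean d \<kappa> g"
    and "simplex_integrable d \<kappa> f \<longleftrightarrow> simplex_integrable d \<kappa> g"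
    unfolding simplex_mean_def simplex_integrable_def set_lebesgue_integral_def set_integrable_def
    by simp_all
qed

lemma
  assumes "\<And>i. i \<in> A \<Longrightarrow> simplex_integrable d \<kappa> (f i)"
  shows simplex_integrable_sum: "simplex_integrable d \<kappa> (\<lambda>x. \<Sum>i\<in>A. q i * f i x)"
    and simplex_mean_sum: "simplex_mean d \<kappa> (\<lambda>x. \<Sum>i\<in>A. q i * f i x)
      = (\<Sum>i\<in>A. q i * simplex_mean d \<kappa> (f i))"
proof -
  let ?F = "\<lambda>i x. indicator (std_simplex d) x *\<^sub>R (f i x * simplex_weight d \<kappa> x)"
  have eq: "(\<lambda>x. indicator (std_simplex d) x *\<^sub>R ((\<Sum>i\<in>A. q i * f i x) * simplex_weight d \<kappa> x))
      = (\<lambda>x. \<Sum>i\<in>A. q i * ?F i x)"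
    by (auto simp: sum_distrib_left sum_distrib_right mult_ac)
  have int: "integrable (\<Pi>\<^sub>M i\<in>{1..d}. lborel) (?F i)" if "i \<in> A" for i
    using assms[OF that] by (simp add: simplex_integrable_def set_integrable_def)
  then have int': "integrable (\<Pi>\<^sub>M i\<in>{1..d}. lborel) (\<lambda>x. q i * (?F i x))" if "i \<in> A" for i
    using that by (intro integrable_mult_right) auto
  show "simplex_integrable d \<kappa> (\<lambda>x. \<Sum>i\<in>A. q i * f i x)"
    unfolding simplex_integrable_def set_integrable_def eq by (intro Bochner_Integration.integrable_sum int')
  have "(LINT x|(\<Pi>\<^sub>M i\<in>{1..d}. lborel). (\<Sum>i\<in>A. q i * ?F i x))
      = (\<Sum>i\<in>A. (LINT x|(\<Pi>\<^sub>M i\<in>{1..d}. lborel). q i * ?F i x))"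
    using int' by (rule Bochner_Integration.integral_sum)
  also have "\<dots> = (\<Sum>i\<in>A. q i * (LINT x|(\<Pi>\<^sub>M i\<in>{1..d}. lborel). ?F i x))"
    by (intro sum.cong integral_mult_right_zero refl)
  finally show "simplex_mean d \<kappa> (\<lambda>x. \<Sum>i\<in>A. q i * f i x) = (\<Sum>i\<in>A. q i * simplex_mean d \<kappa> (f i))"
    unfolding simplex_mean_def set_lebesgue_integral_def eq
    by (simp add: sum_distrib_left sum_divide_distrib mult_ac)
qed

lemma simplex_mean_stick:
  assumes "\<And>j. j \<in> {1..d} \<Longrightarrow> \<kappa>' j > -1" "\<And>j. j \<in> {1..d} \<Longrightarrow> stick_shape d \<kappa>' \<gamma> j > 0"
    and eq: "\<And>x. x \<in> std_simplex d \<Longrightarrow> f x * simplex_weight d \<kappa> x = stick_integrand d \<kappa>' \<gamma> x"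
  shows "simplex_integrable d \<kappa> f"
    and "simplex_mean d \<kappa> f = Gamma ((\<Sum>i=1..d+1. \<kappa> i) + real d + 1) / (\<Prod>i=1..d+1. Gamma (\<kappa> i + 1))
       * (\<Prod>j=1..d. Beta (\<kappa>' j + 1) (stick_shape d \<kappa>' \<gamma> j))"
proof -
  let ?g = "\<lambda>x. indicator (std_simplex d) x * stick_integrand d \<kappa>' \<gamma> x"
  have fg: "(\<lambda>x. indicator (std_simplex d) x *\<^sub>R (f x * simplex_weight d \<kappa> x)) = ?g"
    using eq by (auto simp: indicator_def)
  have "(\<Prod>j=1..d. Beta (\<kappa>' j + 1) (stick_shape d \<kappa>' \<gamma> j)) \<ge> 0"
    by (intro prod_nonneg ballI less_imp_le Beta_pos) (use assms in force)+
  moreover have "?g \<in> borel_measurable (\<Pi>\<^sub>M i\<in>{1..d}. lborel)" by measurable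
  moreover have "0 \<le> ?g x" for x using stick_integrand_nonneg by (simp add: indicator_def)
  ultimately have "integrable (\<Pi>\<^sub>M i\<in>{1..d}. lborel) ?g \<and>
      integral\<^sup>L (\<Pi>\<^sub>M i\<in>{1..d}. lborel) ?g = (\<Prod>j=1..d. Beta (\<kappa>' j + 1) (stick_shape d \<kappa>' \<gamma> j))"
    using nn_integral_stick[OF assms(1,2)] by (subst nn_integral_eq_integrable[symmetric]) auto
  then show "simplex_integrable d \<kappa> f"
    and "simplex_mean d \<kappa> f = Gamma ((\<Sum>i=1..d+1. \<kappa> i) + real d + 1) / (\<Prod>i=1..d+1. Gamma (\<kappa> i + 1))
       * (\<Prod>j=1..d. Beta (\<kappa>' j + 1) (stick_shape d \<kappa>' \<gamma> j))"
    unfolding simplex_integrable_def simplex_mean_def set_integrable_def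
        set_lebesgue_integral_def fg by simp_all
qed

text \<open>
  The first beta parameter of the stick-breaking coordinate with index \<open>j - 1\<close>; for \<open>j = 1\<close> it is the
  total weight \<open>|\<kappa>| + d + 1\<close>.
\<close>

definition tail_weight :: "nat \<Rightarrow> (nat \<Rightarrow> real) \<Rightarrow> nat \<Rightarrow> real" where
  "tail_weight d \<kappa> j = (\<Sum>i=j..Suc d. \<kappa> i + 1)"

lemma tail_weight_pos:
  assumes "\<forall>i\<in>{1..d+1}. -1 < \<kappa> i" "j \<in> {1..Suc d}"
  shows "tail_weight d \<kappa> j > 0"
proof -
  have "\<kappa> i + 1 > 0" if "i \<in> {j..Suc d}" for i using assms that
    by (metis add.commute add_strict_left_mono add.right_inverse atLeastAtMost_iff le_trans Suc_eq_plus1)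
  then show ?thesis unfolding tail_weight_def using assms(2) by (intro sum_pos) auto
qed

lemma total_weight_pos:
  assumes "\<forall>i\<in>{1..d+1}. -1 < \<kappa> i"
  shows "(\<Sum>i=1..d+1. \<kappa> i) + real d + 1 > 0"
  using tail_weight_pos[OF assms, of 1] by (simp add: tail_weight_def sum.distrib)

text \<open>
  Summation by parts for exponents: it turns powers of the ratios into powers of the remainders.
\<close>

lemma prod_stick_telescope:
  assumes "\<And>j. j \<in> {1..Suc d} \<Longrightarrow> (r j :: real) > 0" "r 1 = 1"
  shows "(\<Prod>j=1..d. (r (Suc j) / r j) powr k j) =
    (\<Prod>j=1..d. r (Suc j) powr (k j - k (Suc j))) * r (Suc d) powr k (Suc d)"
  using assms
proof (induction d)
  case (Suc d)
  have r: "r (Suc d) > 0" "r (Suc (Suc d)) > 0" using Suc.prems(1) by auto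
  have "(\<Prod>j=1..Suc d. (r (Suc j) / r j) powr k j)
     = (\<Prod>j=1..d. r (Suc j) powr (k j - k (Suc j))) * r (Suc d) powr k (Suc d)
        * (r (Suc (Suc d)) / r (Suc d)) powr k (Suc d)"
    using Suc by simp
  also have "(r (Suc (Suc d)) / r (Suc d)) powr k (Suc d)
      = r (Suc (Suc d)) powr k (Suc d) / r (Suc d) powr k (Suc d)"
    using r by (simp add: powr_divide)
  finally show ?case using r by (simp add: powr_diff field_simps)
qed simp

text \<open>
  The stick-breaking coordinates are independent beta variables: their joint moments are products.
\<close>

lemma simplex_mean_stick_moment:
  fixes k :: "nat \<Rightarrow> nat"
  assumes d: "1 \<le> d" and \<kappa>: "\<forall>i\<in>{1..d+1}. -1 < \<kappa> i"
  defines "f \<equiv> \<lambda>x. \<Prod>j=1..d. (remainder x (Suc j) / remainder x j) ^ k j"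
  shows "simplex_integrable d \<kappa> f"
    and "simplex_mean d \<kappa> f = Gamma ((\<Sum>i=1..d+1. \<kappa> i) + real d + 1) / (\<Prod>i=1..d+1. Gamma (\<kappa> i + 1))
       * (\<Prod>j=1..d. Beta (tail_weight d \<kappa> (Suc j) + real (k j)) (\<kappa> j + 1))"
proof -
  \<comment> \<open>The extra last exponent makes the telescoping produce the factor of the weight that belongs to the last barycentric coordinate.\<close>
  define k' where "k' j = (if j \<le> d then real (k j) else - \<kappa> (Suc d))" for j
  define \<gamma> where "\<gamma> j = k' j - k' (Suc j)" for j
  have shape: "stick_shape d \<kappa> \<gamma> j = tail_weight d \<kappa> (Suc j) + real (k j)" if "j \<in> {1..d}" for j
  proof -
    have "(\<Sum>i=j..d. \<gamma> i) = k' j - k' (Suc d)"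
      using sum_Suc_diff[of j d "\<lambda>i. - k' i"] that by (simp add: \<gamma>_def)
    also have "\<dots> = real (k j) + \<kappa> (Suc d)" using that by (simp add: k'_def)
    finally show ?thesis using that by (simp add: stick_shape_def tail_weight_def)
  qed
  have eq: "f x * simplex_weight d \<kappa> x = stick_integrand d \<kappa> \<gamma> x" if x: "x \<in> std_simplex d" for x
  proof (cases "remainder x (Suc d) = 0")
    case True
    then have "simplex_weight d \<kappa> x = 0" by (simp add: simplex_weight_def remainder_last)
    moreover have "stick_integrand d \<kappa> \<gamma> x = 0"
      unfolding stick_integrand_def using True d by (intro prod_zero) (auto intro!: bexI[of _ d])
    ultimately show ?thesis by simp
  next
    case False
    then have "remainder x (Suc d) > 0" using remainder_nonneg[OF x order_refl] by simp
    then have r: "remainder x j > 0" if "j \<in> {1..Suc d}" for j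
      using remainder_mono[OF x, of j "Suc d"] that by auto
    have "(\<Prod>j=1..d. (remainder x (Suc j) / remainder x j) ^ k j)
        = (\<Prod>j=1..d. (remainder x (Suc j) / remainder x j) powr k' j)"
      using r by (intro prod.cong) (auto simp: k'_def powr_realpow)
    also have "\<dots> = (\<Prod>j=1..d. remainder x (Suc j) powr \<gamma> j) * remainder x (Suc d) powr k' (Suc d)"
      using prod_stick_telescope[of d "remainder x" k'] r by (simp add: \<gamma>_def)
    also have "remainder x (Suc d) powr k' (Suc d) = inverse (remainder x (Suc d) powr \<kappa> (Suc d))"
      by (simp add: k'_def powr_minus)
    finally have "f x = (\<Prod>j=1..d. remainder x (Suc j) powr \<gamma> j)
        * inverse (remainder x (Suc d) powr \<kappa> (Suc d))" by (simp only: f_def)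
    moreover have "simplex_weight d \<kappa> x
        = (\<Prod>j=1..d. x j powr \<kappa> j) * remainder x (Suc d) powr \<kappa> (Suc d)"
      by (simp add: simplex_weight_def remainder_last)
    moreover have "remainder x (Suc d) powr \<kappa> (Suc d) \<noteq> 0" using r[of "Suc d"] by simp
    ultimately show ?thesis by (simp add: stick_integrand_def prod.distrib)
  qed
  have pos: "stick_shape d \<kappa> \<gamma> j > 0" if "j \<in> {1..d}" for j
    using tail_weight_pos[OF \<kappa>, of "Suc j"] that by (simp add: shape)
  note stick = simplex_mean_stick[of d \<kappa> \<gamma> f \<kappa>, OF _ pos eq]
  show "simplex_integrable d \<kappa> f" using stick(1) \<kappa> by simp
  show "simplex_mean d \<kappa> f = Gamma ((\<Sum>i=1..d+1. \<kappa> i) + real d + 1) / (\<Prod>i=1..d+1. Gamma (\<kappa> i + 1))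
       * (\<Prod>j=1..d. Beta (tail_weight d \<kappa> (Suc j) + real (k j)) (\<kappa> j + 1))"
    using stick(2) \<kappa> by (simp add: shape Beta_commute[of "\<kappa> _ + 1"])
qed

text \<open>
  This is the value of the Dirichlet integral: the Gamma factors of consecutive tail weights cancel.
\<close>

lemma prod_Beta_tail:
  assumes "\<forall>i\<in>{1..d+1}. -1 < \<kappa> i"
  shows "(\<Prod>j=1..d. Beta (\<kappa> j + 1) (tail_weight d \<kappa> (Suc j)))
    = (\<Prod>i=1..d+1. Gamma (\<kappa> i + 1)) / Gamma (tail_weight d \<kappa> 1)"
proof -
  define G where "G j = Gamma (tail_weight d \<kappa> j)" for j
  have G: "G j > 0" if "j \<in> {1..Suc d}" for j
    using tail_weight_pos[OF assms that] by (simp add: G_def)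
  have tele: "(\<Prod>j=1..m. G (Suc j) / G j) = G (Suc m) / G 1" if "m \<le> d" for m
    using that
  proof (induction m)
    case 0
    then show ?case using G[of 1] by simp
  next
    case (Suc m)
    then show ?case using G[of "Suc m"] by simp
  qed
  have "(\<Prod>j=1..d. Beta (\<kappa> j + 1) (tail_weight d \<kappa> (Suc j)))
      = (\<Prod>j=1..d. Gamma (\<kappa> j + 1) * (G (Suc j) / G j))"
  proof (rule prod.cong)
    fix j assume "j \<in> {1..d}"
    then have "tail_weight d \<kappa> j = \<kappa> j + 1 + tail_weight d \<kappa> (Suc j)"
      unfolding tail_weight_def by (subst sum.atLeast_Suc_atMost) auto
    then show "Beta (\<kappa> j + 1) (tail_weight d \<kappa> (Suc j)) = Gamma (\<kappa> j + 1) * (G (Suc j) / G j)"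
      by (simp add: Beta_def G_def)
  qed simp
  also have "\<dots> = (\<Prod>j=1..d. Gamma (\<kappa> j + 1)) * (G (Suc d) / G 1)"
    by (simp only: prod.distrib tele[OF order_refl])
  finally show ?thesis by (simp add: G_def tail_weight_def)
qed

definition barycentric :: "nat \<Rightarrow> (nat \<Rightarrow> real) \<Rightarrow> nat \<Rightarrow> real" where
  "barycentric d x = x(Suc d := 1 - (\<Sum>i=1..d. x i))"

definition monomial :: "nat \<Rightarrow> (nat \<Rightarrow> nat) \<Rightarrow> (nat \<Rightarrow> real) \<Rightarrow> real" where
  "monomial m \<beta> y = (\<Prod>i=1..m. y i ^ \<beta> i)"

text \<open>
  The moments of the Dirichlet distribution. They are symmetric under simultaneous permutation of
  \<open>\<kappa>\<close> and \<open>\<beta>\<close>, which is not visible in stick-breaking coordinates, and they carry the weights of the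
  Hahn inner product.
\<close>

lemma simplex_mean_monomial:
  fixes \<beta> :: "nat \<Rightarrow> nat"
  assumes d: "1 \<le> d" and \<kappa>: "\<forall>i\<in>{1..d+1}. -1 < \<kappa> i"
  defines "f \<equiv> \<lambda>x. monomial (Suc d) \<beta> (barycentric d x)"
  shows "simplex_integrable d \<kappa> f"
    and "simplex_mean d \<kappa> f = (\<Prod>i=1..d+1. pochhammer (\<kappa> i + 1) (\<beta> i))
       / pochhammer ((\<Sum>i=1..d+1. \<kappa> i) + real d + 1) (\<Sum>i=1..d+1. \<beta> i)"
proof -
  define \<kappa>' where "\<kappa>' i = \<kappa> i + real (\<beta> i)" for i
  \<comment> \<open>Among the remainders only the last one, which is the last barycentric coordinate, carries a power.\<close>
  define \<gamma> where "\<gamma> j = (if j = d then \<kappa>' (Suc d) else 0)" for j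
  have \<kappa>': "\<forall>i\<in>{1..d+1}. -1 < \<kappa>' i" using \<kappa> by (force simp: \<kappa>'_def)
  have shape: "stick_shape d \<kappa>' \<gamma> j = tail_weight d \<kappa>' (Suc j)" if "j \<in> {1..d}" for j
    using that by (simp add: stick_shape_def tail_weight_def \<gamma>_def)
  have pos: "stick_shape d \<kappa>' \<gamma> j > 0" if "j \<in> {1..d}" for j
    using tail_weight_pos[OF \<kappa>', of "Suc j"] that by (simp add: shape)
  have f: "f x = (\<Prod>i=1..d. x i ^ \<beta> i) * remainder x (Suc d) ^ \<beta> (Suc d)" for x
  proof -
    have "(\<Prod>i=1..d. (barycentric d x) i ^ \<beta> i) = (\<Prod>i=1..d. x i ^ \<beta> i)"
      by (intro prod.cong) (auto simp: barycentric_def)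
    then show ?thesis by (simp add: f_def monomial_def barycentric_def remainder_last)
  qed
  have powr_shift: "a powr b * a ^ n = a powr (b + real n)" if "a \<ge> 0" for a b :: real and n
    using that by (cases "a = 0") (auto simp: powr_add powr_realpow)
  have eq: "f x * simplex_weight d \<kappa> x = stick_integrand d \<kappa>' \<gamma> x" if x: "x \<in> std_simplex d" for x
  proof -
    have "f x * simplex_weight d \<kappa> x = (\<Prod>i=1..d. x i powr \<kappa> i * x i ^ \<beta> i)
        * (remainder x (Suc d) powr \<kappa> (Suc d) * remainder x (Suc d) ^ \<beta> (Suc d))"
      by (simp add: f simplex_weight_def prod.distrib remainder_last)
    also have "\<dots> = (\<Prod>i=1..d. x i powr \<kappa>' i) * remainder x (Suc d) powr \<kappa>' (Suc d)"
      using x remainder_nonneg[OF x order_refl]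
      by (auto simp: powr_shift \<kappa>'_def std_simplex_def intro!: prod.cong)
    also have "\<dots> = stick_integrand d \<kappa>' \<gamma> x"
    proof (cases "remainder x (Suc d) = 0")
      case True
      moreover have "stick_integrand d \<kappa>' \<gamma> x = 0"
        unfolding stick_integrand_def using True d by (intro prod_zero) (auto intro!: bexI[of _ d])
      ultimately show ?thesis by simp
    next
      case False
      then have "remainder x (Suc d) > 0" using remainder_nonneg[OF x order_refl] by simp
      then have r: "remainder x j > 0" if "j \<in> {1..Suc d}" for j
        using remainder_mono[OF x, of j "Suc d"] that by auto
      have "(\<Prod>j=1..d. remainder x (Suc j) powr \<gamma> j)
          = (\<Prod>j=1..d. if j = d then remainder x (Suc d) powr \<kappa>' (Suc d) else 1)"
      proof (rule prod.cong)
        fix j assume "j \<in> {1..d}"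
        then have "remainder x (Suc j) \<noteq> 0" using r[of "Suc j"] by auto
        then show "remainder x (Suc j) powr \<gamma> j
            = (if j = d then remainder x (Suc d) powr \<kappa>' (Suc d) else 1)"
          by (simp add: \<gamma>_def)
      qed simp
      then show ?thesis using d by (simp add: stick_integrand_def prod.distrib)
    qed
    finally show ?thesis .
  qed
  note stick = simplex_mean_stick[of d \<kappa>' \<gamma> f \<kappa>, OF _ pos eq]
  show "simplex_integrable d \<kappa> f" using stick(1) \<kappa>' by simp
  define S where "S = (\<Sum>i=1..d+1. \<kappa> i) + real d + 1"
  have S: "S = tail_weight d \<kappa> 1" by (simp add: S_def tail_weight_def sum.distrib)
  have Spos: "S > 0" unfolding S by (rule tail_weight_pos[OF \<kappa>]) simp
  have S': "tail_weight d \<kappa>' 1 = S + real (\<Sum>i=1..d+1. \<beta> i)"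
    by (simp add: S_def tail_weight_def \<kappa>'_def sum.distrib)
  have poch: "Gamma (z + real n) = Gamma z * pochhammer z n" if "z > 0" for z n
  proof -
    have "z \<notin> \<int>\<^sub>\<le>\<^sub>0" using that nonpos_Ints_nonpos by fastforce
    moreover have "Gamma z \<noteq> 0" using Gamma_real_pos[OF that] by linarith
    ultimately show ?thesis by (simp add: pochhammer_Gamma)
  qed
  have "simplex_mean d \<kappa> f = Gamma S / (\<Prod>i=1..d+1. Gamma (\<kappa> i + 1))
       * ((\<Prod>i=1..d+1. Gamma (\<kappa>' i + 1)) / Gamma (tail_weight d \<kappa>' 1))"
    using stick(2) \<kappa>' prod_Beta_tail[OF \<kappa>'] by (simp add: shape S_def)
  also have "(\<Prod>i=1..d+1. Gamma (\<kappa>' i + 1))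
      = (\<Prod>i=1..d+1. Gamma (\<kappa> i + 1)) * (\<Prod>i=1..d+1. pochhammer (\<kappa> i + 1) (\<beta> i))"
  proof -
    have "Gamma (\<kappa>' i + 1) = Gamma (\<kappa> i + 1) * pochhammer (\<kappa> i + 1) (\<beta> i)" if "i \<in> {1..d+1}" for i
    proof -
      have "-1 < \<kappa> i" using \<kappa> that by blast
      then show ?thesis using poch[of "\<kappa> i + 1" "\<beta> i"] by (simp add: \<kappa>'_def add_ac)
    qed
    then show ?thesis by (simp add: prod.distrib[symmetric])
  qed
  also have "Gamma (tail_weight d \<kappa>' 1) = Gamma S * pochhammer S (\<Sum>i=1..d+1. \<beta> i)"
    unfolding S' by (rule poch[OF Spos])
  also have "Gamma S / (\<Prod>i=1..d+1. Gamma (\<kappa> i + 1))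
       * ((\<Prod>i=1..d+1. Gamma (\<kappa> i + 1)) * (\<Prod>i=1..d+1. pochhammer (\<kappa> i + 1) (\<beta> i))
          / (Gamma S * pochhammer S (\<Sum>i=1..d+1. \<beta> i)))
     = (\<Prod>i=1..d+1. pochhammer (\<kappa> i + 1) (\<beta> i)) / pochhammer S (\<Sum>i=1..d+1. \<beta> i)"
  proof -
    have "Gamma (\<kappa> i + 1) \<noteq> 0" if "i \<in> {1..d+1}" for i
    proof -
      have "-1 < \<kappa> i" using \<kappa> that by blast
      then have "Gamma (\<kappa> i + 1) > 0" by (intro Gamma_real_pos) simp
      then show ?thesis by linarith
    qed
    then have "(\<Prod>i=1..d+1. Gamma (\<kappa> i + 1)) \<noteq> 0" by (subst prod_zero_iff) auto
    moreover have "Gamma S \<noteq> 0" using Gamma_real_pos[OF Spos] by simp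
    ultimately show ?thesis by (simp del: prod.cl_ivl_Suc)
  qed
  finally show "simplex_mean d \<kappa> f = (\<Prod>i=1..d+1. pochhammer (\<kappa> i + 1) (\<beta> i))
       / pochhammer ((\<Sum>i=1..d+1. \<kappa> i) + real d + 1) (\<Sum>i=1..d+1. \<beta> i)"
    by (simp only: S_def)
qed

section \<open>Homogeneous polynomials\<close>

lemma finite_multi_indices [simp]: "finite (multi_indices m n)"
proof -
  have "multi_indices m n \<subseteq> {\<beta>. \<forall>i. (i \<in> {1..m} \<longrightarrow> \<beta> i \<in> {..n}) \<and> (i \<notin> {1..m} \<longrightarrow> \<beta> i = 0)}"
    by (auto simp: multi_indices_def intro: member_le_sum[of _ "{1..m}", simplified])
  then show ?thesis by (rule finite_subset) (intro finite_set_of_finite_funs; simp)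
qed

text \<open>
  On the hyperplane where the \<open>m\<close> variables sum to 1, homogeneous polynomials of degree \<open>n\<close> in \<open>m\<close>
  variables represent all polynomials of degree at most \<open>n\<close> in \<open>m - 1\<close> variables. In this form the
  symmetric group acts by permuting the variables.
\<close>

definition homogeneous :: "nat \<Rightarrow> nat \<Rightarrow> ((nat \<Rightarrow> real) \<Rightarrow> real) \<Rightarrow> bool" where
  "homogeneous m n F \<longleftrightarrow> (\<exists>q. \<forall>y. F y = (\<Sum>\<beta>\<in>multi_indices m n. q \<beta> * monomial m \<beta> y))"

lemma homogeneous_monomial:
  assumes "(\<Sum>i=1..m. \<beta> i) = n"
  shows "homogeneous m n (monomial m \<beta>)"
proof -
  define \<beta>' where "\<beta>' i = (if i \<in> {1..m} then \<beta> i else 0)" for i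
  have "\<beta>' \<in> multi_indices m n" using assms by (auto simp: multi_indices_def \<beta>'_def)
  moreover have "monomial m \<beta> y = monomial m \<beta>' y" for y
    unfolding monomial_def by (intro prod.cong) (auto simp: \<beta>'_def)
  ultimately have "monomial m \<beta> y
      = (\<Sum>\<alpha>\<in>multi_indices m n. (if \<alpha> = \<beta>' then 1 else 0) * monomial m \<alpha> y)" for y
    by (simp add: if_distrib[where f = "\<lambda>c. c * _"] cong: if_cong)
  then show ?thesis unfolding homogeneous_def by (intro exI allI)
qed

lemma homogeneous_sum:
  assumes "\<And>i. i \<in> A \<Longrightarrow> homogeneous m n (F i)"
  shows "homogeneous m n (\<lambda>y. \<Sum>i\<in>A. c i * F i y)"
proof -
  have "\<forall>i\<in>A. \<exists>q. \<forall>y. F i y = (\<Sum>\<beta>\<in>multi_indices m n. q \<beta> * monomial m \<beta> y)"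
    using assms by (auto simp: homogeneous_def)
  then obtain q where q: "F i y = (\<Sum>\<beta>\<in>multi_indices m n. q i \<beta> * monomial m \<beta> y)"
    if "i \<in> A" for i y by metis
  have "(\<Sum>i\<in>A. c i * F i y)
      = (\<Sum>\<beta>\<in>multi_indices m n. (\<Sum>i\<in>A. c i * q i \<beta>) * monomial m \<beta> y)" for y
    by (simp add: q sum_distrib_left sum_distrib_right mult.assoc sum.swap[of _ A])
  then show ?thesis unfolding homogeneous_def by (intro exI allI)
qed

lemma homogeneous_mult:
  assumes "homogeneous m n F" "homogeneous m k G"
  shows "homogeneous m (n + k) (\<lambda>y. F y * G y)"
proof -
  obtain q where q: "\<And>y. F y = (\<Sum>\<beta>\<in>multi_indices m n. q \<beta> * monomial m \<beta> y)"
    using assms(1) unfolding homogeneous_def by blast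
  obtain p where p: "\<And>y. G y = (\<Sum>\<gamma>\<in>multi_indices m k. p \<gamma> * monomial m \<gamma> y)"
    using assms(2) unfolding homogeneous_def by blast
  define A where "A = multi_indices m n \<times> multi_indices m k"
  have eq: "(\<lambda>y. F y * G y) = (\<lambda>y. \<Sum>z\<in>A.
      (q (fst z) * p (snd z)) * monomial m (\<lambda>i. fst z i + snd z i) y)"
  proof
    fix y
    show "F y * G y = (\<Sum>z\<in>A. (q (fst z) * p (snd z)) * monomial m (\<lambda>i. fst z i + snd z i) y)"
      unfolding q p A_def sum_product sum.cartesian_product
      by (intro sum.cong) (auto simp: monomial_def power_add prod.distrib)
  qed
  show ?thesis unfolding eq
    by (intro homogeneous_sum homogeneous_monomial) (auto simp: A_def multi_indices_def sum.distrib)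
qed

lemma homogeneous_1: "homogeneous m 0 (\<lambda>_. 1)"
proof -
  have "monomial m (\<lambda>_. 0) = (\<lambda>_. 1)" by (simp add: monomial_def fun_eq_iff)
  then show ?thesis using homogeneous_monomial[of "\<lambda>_. 0" m 0] by simp
qed

lemma homogeneous_power:
  assumes "homogeneous m n F"
  shows "homogeneous m (k * n) (\<lambda>y. F y ^ k)"
  by (induction k) (auto simp: homogeneous_1 intro: homogeneous_mult[OF assms])

lemma homogeneous_prod:
  assumes "finite A" "\<And>j. j \<in> A \<Longrightarrow> homogeneous m (n j) (F j)"
  shows "homogeneous m (\<Sum>j\<in>A. n j) (\<lambda>y. \<Prod>j\<in>A. F j y)"
  using assms by (induction A rule: finite_induct) (auto simp: homogeneous_1 homogeneous_mult)

lemma homogeneous_coord: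
  assumes "i \<in> {1..m}"
  shows "homogeneous m 1 (\<lambda>y. y i)"
proof -
  have "monomial m (\<lambda>j. if j = i then 1 else 0) = (\<lambda>y. y i)"
    using assms by (auto simp: monomial_def fun_eq_iff if_distrib[where f = "power _"] cong: if_cong)
  then show ?thesis
    using homogeneous_monomial[where m = m and n = 1 and \<beta> = "\<lambda>j. if j = i then 1 else 0"] assms
    by simp
qed

lemma homogeneous_cong:
  assumes "homogeneous m n F" "\<And>i. i \<in> {1..m} \<Longrightarrow> y i = z i"
  shows "F y = F z"
proof -
  have "monomial m \<beta> y = monomial m \<beta> z" for \<beta>
    unfolding monomial_def using assms(2) by (intro prod.cong) auto
  moreover obtain q where "\<And>y. F y = (\<Sum>\<beta>\<in>multi_indices m n. q \<beta> * monomial m \<beta> y)"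
    using assms(1) unfolding homogeneous_def by blast
  ultimately show ?thesis by simp
qed

lemma homogeneous_scale:
  assumes "homogeneous m n F"
  shows "F (\<lambda>i. c * y i) = c ^ n * F y"
proof -
  have "monomial m \<beta> (\<lambda>i. c * y i) = c ^ n * monomial m \<beta> y" if "\<beta> \<in> multi_indices m n" for \<beta>
    using that by (simp add: monomial_def power_mult_distrib prod.distrib multi_indices_def
        flip: power_sum)
  moreover obtain q where "\<And>y. F y = (\<Sum>\<beta>\<in>multi_indices m n. q \<beta> * monomial m \<beta> y)"
    using assms unfolding homogeneous_def by blast
  ultimately show ?thesis by (simp add: sum_distrib_left mult.left_commute)
qed

lemma monomial_permute:
  assumes "\<tau> permutes {1..m}"
  shows "monomial m \<beta> (y \<circ> \<tau>) = monomial m (\<beta> \<circ> inv \<tau>) y"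
proof -
  have "monomial m (\<beta> \<circ> inv \<tau>) y = (\<Prod>i=1..m. ((\<lambda>i. y i ^ \<beta> (inv \<tau> i)) \<circ> \<tau>) i)"
    unfolding monomial_def using prod.permute[OF assms] by (simp add: o_def)
  then show ?thesis by (simp add: monomial_def permutes_inverses[OF assms])
qed

lemma homogeneous_permute:
  assumes "homogeneous m n F" "\<tau> permutes {1..m}"
  shows "homogeneous m n (\<lambda>y. F (y \<circ> \<tau>))"
proof -
  obtain q where q: "\<And>y. F y = (\<Sum>\<beta>\<in>multi_indices m n. q \<beta> * monomial m \<beta> y)"
    using assms(1) unfolding homogeneous_def by blast
  have "(\<Sum>i=1..m. (\<beta> \<circ> inv \<tau>) i) = (\<Sum>i=1..m. \<beta> i)" for \<beta> :: "nat \<Rightarrow> nat"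
    using sum.permute[OF permutes_inv[OF assms(2)], of \<beta>] by simp
  then show ?thesis
    unfolding q monomial_permute[OF assms(2)]
    by (intro homogeneous_sum homogeneous_monomial) (auto simp: multi_indices_def)
qed

text \<open>
  Fixing all variables but one gives a univariate polynomial that vanishes on the positive half-line, so
  all its coefficients vanish. These are sums of the same kind in fewer variables.
\<close>

lemma homogeneous_coeff_eq_0:
  assumes "finite I" "finite A" "inj_on (\<lambda>\<alpha>. restrict \<alpha> I) A"
    and "\<And>y. (\<And>i. y i > 0) \<Longrightarrow> (\<Sum>\<alpha>\<in>A. C \<alpha> * (\<Prod>i\<in>I. y i ^ \<alpha> i)) = (0 :: real)"
    and "\<alpha> \<in> A"
  shows "C \<alpha> = 0"
  using assms
proof (induction I arbitrary: A C \<alpha> rule: finite_induct)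
  case empty
  then have "A = {\<alpha>}" by (auto simp: inj_on_def)
  then show ?case using empty.prems(3)[of "\<lambda>_. 1"] by simp
next
  case (insert k I)
  define B where "B m = {\<alpha>\<in>A. \<alpha> k = m}" for m
  define D where "D = (\<Sum>\<alpha>\<in>A. \<alpha> k)"
  have D: "\<alpha> k \<le> D" if "\<alpha> \<in> A" for \<alpha>
    unfolding D_def using that insert.prems(1) by (intro member_le_sum) auto
  have fB: "finite (B m)" for m using insert.prems(1) by (simp add: B_def)
  have inj: "inj_on (\<lambda>\<alpha>. restrict \<alpha> I) (B m)" for m
  proof (rule inj_onI)
    fix \<alpha> \<beta> assume ab: "\<alpha> \<in> B m" "\<beta> \<in> B m" and eq: "restrict \<alpha> I = restrict \<beta> I"
    have "\<alpha> i = \<beta> i" if "i \<in> I" for i using eq that by (metis restrict_apply')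
    then have "restrict \<alpha> (insert k I) = restrict \<beta> (insert k I)"
      using ab by (auto simp: B_def fun_eq_iff)
    then show "\<alpha> = \<beta>" by (rule inj_onD[OF insert.prems(2)]) (use ab in \<open>simp_all add: B_def\<close>)
  qed
  have zero: "(\<Sum>\<alpha>\<in>B m. C \<alpha> * (\<Prod>i\<in>I. y i ^ \<alpha> i)) = 0" if y: "\<And>i. y i > 0" for y m
  proof -
    \<comment> \<open>The coefficients of the sum as a polynomial in the variable with index \<open>k\<close>, the others being fixed at \<open>y\<close>.\<close>
    define b where "b m = (\<Sum>\<alpha>\<in>B m. C \<alpha> * (\<Prod>i\<in>I. y i ^ \<alpha> i))" for m
    define p where "p = (\<Sum>m\<le>D. monom (b m) m)"
    have "poly p z = 0" if z: "z > 0" for z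
    proof -
      have "poly p z = (\<Sum>m\<le>D. \<Sum>\<alpha>\<in>B m. C \<alpha> * (\<Prod>i\<in>I. y i ^ \<alpha> i) * z ^ m)"
        by (simp add: p_def poly_sum poly_monom b_def sum_distrib_right)
      also have "\<dots> = (\<Sum>m\<le>D. \<Sum>\<alpha>\<in>B m. C \<alpha> * (\<Prod>i\<in>insert k I. (y(k := z)) i ^ \<alpha> i))"
      proof (intro sum.cong refl)
        fix m \<alpha> assume "\<alpha> \<in> B m"
        moreover have "(\<Prod>i\<in>I. (y(k := z)) i ^ \<alpha> i) = (\<Prod>i\<in>I. y i ^ \<alpha> i)"
          using insert.hyps by (intro prod.cong) auto
        ultimately show "C \<alpha> * (\<Prod>i\<in>I. y i ^ \<alpha> i) * z ^ m
            = C \<alpha> * (\<Prod>i\<in>insert k I. (y(k := z)) i ^ \<alpha> i)"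
          using insert.hyps by (simp add: B_def)
      qed
      also have "\<dots> = (\<Sum>\<alpha>\<in>A. C \<alpha> * (\<Prod>i\<in>insert k I. (y(k := z)) i ^ \<alpha> i))"
      proof -
        have "(\<lambda>\<alpha>. \<alpha> k) \<in> A \<rightarrow> {..D}" using D by auto
        then show ?thesis
          unfolding B_def using insert.prems(1) by (intro sum.group) auto
      qed
      also have "\<dots> = 0" using y z by (intro insert.prems(3)) auto
      finally show ?thesis .
    qed
    then have "{0<..} \<subseteq> {z. poly p z = 0}" by auto
    moreover have "infinite {0::real<..}" by (simp add: infinite_Ioi)
    ultimately have "p = 0" using poly_roots_finite[of p] finite_subset by blast
    show ?thesis
    proof (cases "m \<le> D")
      case True
      have "coeff p m = (\<Sum>j\<le>D. if j = m then b j else 0)"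
        unfolding p_def coeff_sum by (intro sum.cong) auto
      with True \<open>p = 0\<close> show ?thesis by (simp add: b_def)
    next
      case False
      then have "B m = {}" using D by (force simp: B_def)
      then show ?thesis by simp
    qed
  qed
  have "\<alpha> \<in> B (\<alpha> k)" using insert.prems(4) by (simp add: B_def)
  then show ?case using insert.IH[OF fB inj zero] by blast
qed

lemma monomial_coeff_unique:
  assumes eq: "\<And>y. (\<And>i. y i > 0) \<Longrightarrow>
      (\<Sum>\<alpha>\<in>multi_indices m n. p \<alpha> * monomial m \<alpha> y) = (\<Sum>\<alpha>\<in>multi_indices m n. q \<alpha> * monomial m \<alpha> y)"
    and \<alpha>: "\<alpha> \<in> multi_indices m n"
  shows "p \<alpha> = q \<alpha>"
proof -
  have inj: "inj_on (\<lambda>\<alpha>. restrict \<alpha> {1..m}) (multi_indices m n)"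
  proof (rule inj_onI)
    fix \<alpha> \<beta> assume ab: "\<alpha> \<in> multi_indices m n" "\<beta> \<in> multi_indices m n"
      and eq: "restrict \<alpha> {1..m} = restrict \<beta> {1..m}"
    show "\<alpha> = \<beta>"
    proof
      fix i
      show "\<alpha> i = \<beta> i"
        using ab fun_cong[OF eq, of i] by (cases "i \<in> {1..m}") (auto simp: multi_indices_def)
    qed
  qed
  have "p \<alpha> - q \<alpha> = 0"
  proof (rule homogeneous_coeff_eq_0[OF _ _ inj _ \<alpha>, where C = "\<lambda>\<alpha>. p \<alpha> - q \<alpha>"])
    fix y :: "nat \<Rightarrow> real" assume "\<And>i. y i > 0"
    then show "(\<Sum>\<alpha>\<in>multi_indices m n. (p \<alpha> - q \<alpha>) * (\<Prod>i\<in>{1..m}. y i ^ \<alpha> i)) = 0"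
      using eq[of y] by (simp add: monomial_def left_diff_distrib sum_subtractf)
  qed auto
  then show ?thesis by simp
qed

lemma barycentric_sum: "(\<Sum>i=1..Suc d. barycentric d x i) = 1"
proof -
  have "(\<Sum>i=1..d. barycentric d x i) = (\<Sum>i=1..d. x i)"
    by (intro sum.cong) (auto simp: barycentric_def)
  then show ?thesis by (simp add: barycentric_def)
qed

text \<open>
  The permutation rule replaces a change of variables on the simplex: for monomials it is the symmetry
  of the Dirichlet moments, and homogeneous polynomials follow by linearity.
\<close>

lemma
  assumes d: "1 \<le> d" and \<kappa>: "\<forall>i\<in>{1..d+1}. -1 < \<kappa> i" and F: "homogeneous (Suc d) n F"
  shows homogeneous_integrable: "simplex_integrable d \<kappa> (\<lambda>x. F (barycentric d x))"
    and simplex_mean_homogeneous_permute: "\<tau> permutes {1..d+1} \<Longrightarrow>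
      simplex_mean d \<kappa> (\<lambda>x. F (barycentric d x \<circ> \<tau>)) = simplex_mean d (\<kappa> \<circ> \<tau>) (\<lambda>x. F (barycentric d x))"
proof -
  obtain q where q: "\<And>y. F y = (\<Sum>\<beta>\<in>multi_indices (Suc d) n. q \<beta> * monomial (Suc d) \<beta> y)"
    using F unfolding homogeneous_def by blast
  show "simplex_integrable d \<kappa> (\<lambda>x. F (barycentric d x))"
    unfolding q by (intro simplex_integrable_sum simplex_mean_monomial d \<kappa>)
  assume \<tau>: "\<tau> permutes {1..d+1}"
  then have \<tau>': "\<tau> permutes {1..Suc d}" by simp
  have \<kappa>\<tau>: "\<forall>i\<in>{1..d+1}. -1 < (\<kappa> \<circ> \<tau>) i"
    using \<kappa> permutes_in_image[OF \<tau>] by simp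
  have "simplex_mean d \<kappa> (\<lambda>x. monomial (Suc d) (\<beta> \<circ> inv \<tau>) (barycentric d x))
      = simplex_mean d (\<kappa> \<circ> \<tau>) (\<lambda>x. monomial (Suc d) \<beta> (barycentric d x))" for \<beta>
  proof -
    have "(\<Prod>i=1..d+1. pochhammer (\<kappa> i + 1) ((\<beta> \<circ> inv \<tau>) i))
        = (\<Prod>i=1..d+1. pochhammer ((\<kappa> \<circ> \<tau>) i + 1) (\<beta> i))"
      by (subst prod.permute[OF \<tau>]) (simp add: o_def permutes_inverses[OF \<tau>])
    moreover have "(\<Sum>i=1..d+1. \<kappa> i) = (\<Sum>i=1..d+1. (\<kappa> \<circ> \<tau>) i)"
      by (subst sum.permute[OF \<tau>]) (simp add: o_def)
    moreover have "(\<Sum>i=1..d+1. (\<beta> \<circ> inv \<tau>) i) = (\<Sum>i=1..d+1. \<beta> i)"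
      using sum.permute[OF permutes_inv[OF \<tau>], of \<beta>] by simp
    ultimately show ?thesis
      unfolding simplex_mean_monomial(2)[OF d \<kappa>] simplex_mean_monomial(2)[OF d \<kappa>\<tau>] by simp
  qed
  then show "simplex_mean d \<kappa> (\<lambda>x. F (barycentric d x \<circ> \<tau>))
      = simplex_mean d (\<kappa> \<circ> \<tau>) (\<lambda>x. F (barycentric d x))"
    unfolding q monomial_permute[OF \<tau>']
    by (simp add: simplex_mean_sum simplex_mean_monomial(1)[OF d \<kappa>] simplex_mean_monomial(1)[OF d \<kappa>\<tau>])
qed

section \<open>Jacobi polynomials on the simplex in homogeneous coordinates\<close>

lemma poly_jacobi_unit: "poly (jacobi_unit n a b) s = poly (jacobi_poly n a b) (1 - 2 * s)"
proof -
  have "poly [:-1/2, 1/2:] (1 - 2 * s) = - s" by (simp add: field_simps)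
  then show ?thesis
    by (simp add: jacobi_unit_def jacobi_poly_def poly_sum poly_monom poly_power power_minus[of s] mult_ac
        del: poly_pCons)
qed

text \<open>
  Comparison of the leading coefficients under the substitution \<open>t \<mapsto> 1 - 2t\<close>. This is what the
  homogenised polynomials retain at \<open>u = 0\<close>.
\<close>

lemma coeff_jacobi_poly_top:
  "coeff (jacobi_poly n a b) n * 2 ^ n = (-1) ^ n * coeff (jacobi_unit n a b) n"
proof -
  have top: "coeff ([:- (1/2), 1/2:] ^ l :: real poly) n = (if l = n then (1/2) ^ n else 0)"
    if "l \<le> n" for l
  proof (cases "l = n")
    case True
    have "degree ([:- (1/2), 1/2:] ^ n :: real poly) = n" by (simp add: degree_power_eq)
    then show ?thesis using True lead_coeff_power[of "[:- (1/2), 1/2:] :: real poly" n] by simp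
  next
    case False
    have "degree ([:- (1/2), 1/2:] ^ l :: real poly) = l" by (simp add: degree_power_eq)
    then show ?thesis using False that by (simp add: coeff_eq_0)
  qed
  have "coeff (jacobi_poly n a b) n = (\<Sum>l\<le>n. if l = n then
      pochhammer (real n + a + b + 1) n / fact n * (1/2) ^ n else 0)"
    unfolding jacobi_poly_def coeff_sum by (intro sum.cong) (auto simp: top)
  then show ?thesis by (simp add: coeff_jacobi_unit power_one_over)
qed

lemma poly_homog_jacobi:
  "poly_homog n (jacobi_poly n a b) (2 * x - u) u = poly_homog n (jacobi_unit n a b) (u - x) u"
proof (cases "u = 0")
  case True
  have "poly_homog n p s 0 = coeff p n * s ^ n" for p :: "real poly" and s
  proof -
    have "poly_homog n p s 0 = (\<Sum>k\<le>n. if k = n then coeff p n * s ^ n else 0)"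
      unfolding poly_homog_def by (intro sum.cong) auto
    then show ?thesis by simp
  qed
  then show ?thesis using True coeff_jacobi_poly_top[of n a b]
    by (simp add: power_mult_distrib power_minus[of x] mult_ac)
next
  case False
  have "(2 * x - u) / u = 1 - 2 * ((u - x) / u)" using False by (simp add: field_simps)
  then show ?thesis
    using False by (simp add: poly_homog_eq degree_jacobi_poly degree_jacobi_unit poly_jacobi_unit)
qed

definition tail_sum :: "nat \<Rightarrow> (nat \<Rightarrow> real) \<Rightarrow> nat \<Rightarrow> real" where
  "tail_sum d y j = (\<Sum>i=j..Suc d. y i)"

text \<open>
  The Jacobi polynomial on the simplex, homogenised in the barycentric coordinates. The \<open>j\<close>-th factor
  depends on two consecutive tail sums only, and on the simplex the tail sums are the remainders.
\<close>

definition simplex_jacobi_hom ::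
    "nat \<Rightarrow> (nat \<Rightarrow> real) \<Rightarrow> (nat \<Rightarrow> nat) \<Rightarrow> (nat \<Rightarrow> real) \<Rightarrow> real" where
  "simplex_jacobi_hom d \<kappa> \<nu> y = (\<Prod>j=1..d. poly_homog (\<nu> j)
     (jacobi_unit (\<nu> j) (jacobi_param d \<kappa> \<nu> j) (\<kappa> j)) (tail_sum d y (Suc j)) (tail_sum d y j))"

lemma tail_sum_barycentric:
  assumes "j \<in> {1..Suc d}"
  shows "tail_sum d (barycentric d x) j = remainder x j"
proof -
  have "{1..Suc d} = {1..<j} \<union> {j..Suc d}" using assms by auto
  then have "(\<Sum>i=1..Suc d. barycentric d x i)
      = (\<Sum>i=1..<j. barycentric d x i) + (\<Sum>i=j..Suc d. barycentric d x i)"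
    by (simp only:) (rule sum.union_disjoint; auto)
  moreover have "(\<Sum>i=1..<j. barycentric d x i) = (\<Sum>i=1..<j. x i)"
    using assms by (intro sum.cong) (auto simp: barycentric_def)
  ultimately show ?thesis using barycentric_sum[of d x] by (simp add: tail_sum_def remainder_def)
qed

lemma simplex_jacobi_homogeneous_coords:
  "simplex_jacobi d \<kappa> \<nu> x = simplex_jacobi_hom d \<kappa> \<nu> (barycentric d x)"
  unfolding simplex_jacobi_def simplex_jacobi_hom_def Let_def remainder_def[symmetric]
  by (intro prod.cong) (auto simp: tail_sum_barycentric poly_homog_jacobi remainder_Suc)

lemma homogeneous_tail_sum:
  assumes "1 \<le> j"
  shows "homogeneous (Suc d) 1 (\<lambda>y. tail_sum d y j)"
  using homogeneous_sum[of "{j..Suc d}" "Suc d" 1 "\<lambda>i y. y i" "\<lambda>_. 1"] homogeneous_coord[of _ "Suc d"] assms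
  by (simp add: tail_sum_def)

lemma homogeneous_simplex_jacobi_hom:
  "homogeneous (Suc d) (\<Sum>j=1..d. \<nu> j) (simplex_jacobi_hom d \<kappa> \<nu>)"
proof -
  have "homogeneous (Suc d) n (\<lambda>y. poly_homog n p (tail_sum d y (Suc j)) (tail_sum d y j))"
    if "1 \<le> j" for n p j
    unfolding poly_homog_def mult.assoc
  proof (rule homogeneous_sum)
    fix k assume "k \<in> {..n}"
    then show "homogeneous (Suc d) n (\<lambda>y. tail_sum d y (Suc j) ^ k * tail_sum d y j ^ (n - k))"
      using homogeneous_mult[OF homogeneous_power[OF homogeneous_tail_sum[of "Suc j" d], of k]
          homogeneous_power[OF homogeneous_tail_sum[OF that, of d], of "n - k"]] by simp
  qed
  then show ?thesis unfolding simplex_jacobi_hom_def by (intro homogeneous_prod) auto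
qed

lemma simplex_jacobi_scale:
  assumes s: "s = (\<Sum>i=1..d+1. y i)" "s \<noteq> 0"
  shows "s ^ (\<Sum>j=1..d. \<nu> j) * simplex_jacobi d \<kappa> \<nu> (\<lambda>i. y i / s) = simplex_jacobi_hom d \<kappa> \<nu> y"
proof -
  let ?H = "simplex_jacobi_hom d \<kappa> \<nu>"
  have "(\<Sum>i=1..d. y i) + y (Suc d) = s" using s by simp
  then have "barycentric d (\<lambda>i. y i / s) (Suc d) = y (Suc d) / s"
    using s(2) by (simp add: barycentric_def sum_divide_distrib[symmetric] field_simps)
  then have "barycentric d (\<lambda>i. y i / s) i = y i / s" for i
    by (cases "i = Suc d") (simp_all add: barycentric_def)
  then have "simplex_jacobi d \<kappa> \<nu> (\<lambda>i. y i / s) = ?H (\<lambda>i. y i / s)"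
    unfolding simplex_jacobi_homogeneous_coords by presburger
  moreover have "(\<lambda>i. s * (y i / s)) = y" using s(2) by auto
  ultimately show ?thesis
    using homogeneous_scale[OF homogeneous_simplex_jacobi_hom, of d \<kappa> \<nu> s "\<lambda>i. y i / s"] by simp
qed

section \<open>Orthogonality\<close>

text \<open>
  A product of functions of independent variables has the product of the means as its mean.
\<close>

lemma simplex_mean_stick_product:
  fixes p :: "nat \<Rightarrow> real poly"
  assumes d: "1 \<le> d" and \<kappa>: "\<forall>i\<in>{1..d+1}. -1 < \<kappa> i"
  defines "f \<equiv> \<lambda>x. \<Prod>j=1..d. poly (p j) (remainder x (Suc j) / remainder x j)"
  shows "simplex_mean d \<kappa> f
    = Gamma ((\<Sum>i=1..d+1. \<kappa> i) + real d + 1) / (\<Prod>i=1..d+1. Gamma (\<kappa> i + 1))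
       * (\<Prod>j=1..d. beta_functional (tail_weight d \<kappa> (Suc j)) (\<kappa> j + 1) (p j))"
proof -
  define K where "K = PiE {1..d} (\<lambda>j. {..degree (p j)})"
  define t where "t x j = remainder x (Suc j) / remainder x j" for x j
  define G where "G = Gamma ((\<Sum>i=1..d+1. \<kappa> i) + real d + 1) / (\<Prod>i=1..d+1. Gamma (\<kappa> i + 1))"
  have f: "f = (\<lambda>x. \<Sum>k\<in>K. (\<Prod>j=1..d. coeff (p j) (k j)) * (\<Prod>j=1..d. t x j ^ k j))"
  proof
    fix x
    have "f x = (\<Prod>j=1..d. \<Sum>k\<le>degree (p j). coeff (p j) k * t x j ^ k)"
      by (simp add: f_def t_def poly_altdef)
    also have "\<dots> = (\<Sum>k\<in>K. \<Prod>j=1..d. coeff (p j) (k j) * t x j ^ k j)"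
      unfolding K_def by (rule prod_sum_PiE) auto
    finally show "f x = (\<Sum>k\<in>K. (\<Prod>j=1..d. coeff (p j) (k j)) * (\<Prod>j=1..d. t x j ^ k j))"
      by (simp only: prod.distrib)
  qed
  have "simplex_mean d \<kappa> f = (\<Sum>k\<in>K. (\<Prod>j=1..d. coeff (p j) (k j))
      * (G * (\<Prod>j=1..d. Beta (tail_weight d \<kappa> (Suc j) + real (k j)) (\<kappa> j + 1))))"
    unfolding f t_def G_def using simplex_mean_stick_moment[OF d \<kappa>]
    by (subst simplex_mean_sum) auto
  also have "\<dots> = G * (\<Sum>k\<in>K. \<Prod>j=1..d. coeff (p j) (k j)
      * Beta (tail_weight d \<kappa> (Suc j) + real (k j)) (\<kappa> j + 1))"
    by (simp add: sum_distrib_left prod.distrib mult_ac)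
  also have "(\<Sum>k\<in>K. \<Prod>j=1..d. coeff (p j) (k j)
      * Beta (tail_weight d \<kappa> (Suc j) + real (k j)) (\<kappa> j + 1))
      = (\<Prod>j=1..d. beta_functional (tail_weight d \<kappa> (Suc j)) (\<kappa> j + 1) (p j))"
    unfolding K_def beta_functional_def by (rule prod_sum_PiE[symmetric]) auto
  finally show ?thesis by (simp only: G_def)
qed

lemma prod_power_stick:
  assumes "r 1 = (1::real)" "\<And>j. j \<in> {1..Suc d} \<Longrightarrow> r j \<noteq> 0"
  shows "(\<Prod>j=1..d. r j ^ \<nu> j) = (\<Prod>j=1..d. (r (Suc j) / r j) ^ (\<Sum>i=Suc j..d. \<nu> i))"
  using assms
proof (induction d)
  case (Suc d)
  have tele: "(\<Prod>j=1..m. r (Suc j) / r j) = r (Suc m)" if "m \<le> d" for m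
    using that Suc.prems by (induction m) auto
  have "(\<Prod>j=1..d. (r (Suc j) / r j) ^ (\<Sum>i=Suc j..Suc d. \<nu> i))
      = (\<Prod>j=1..d. (r (Suc j) / r j) ^ (\<Sum>i=Suc j..d. \<nu> i) * (r (Suc j) / r j) ^ \<nu> (Suc d))"
    by (intro prod.cong) (auto simp: power_add)
  also have "\<dots> = (\<Prod>j=1..d. r j ^ \<nu> j) * (\<Prod>j=1..d. r (Suc j) / r j) ^ \<nu> (Suc d)"
    using Suc by (simp add: prod.distrib prod_power_distrib)
  also have "(\<Prod>j=1..d. r (Suc j) / r j) = r (Suc d)" by (rule tele) simp
  finally show ?case by simp
qed simp

text \<open>
  In stick-breaking coordinates a Jacobi polynomial on the simplex is a product of one-variable
  polynomials. The homogenising powers of the remainders contribute the monomial factors, which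
  account for the term \<open>2|\<nu>\<^sup>j\<^sup>+\<^sup>1|\<close> in the parameter \<open>a\<^sub>j\<close> once two polynomials are multiplied.
\<close>

lemma simplex_jacobi_stick:
  assumes x: "x \<in> std_simplex d" "remainder x (Suc d) > 0"
  shows "simplex_jacobi d \<kappa> \<nu> x = (\<Prod>j=1..d. poly (monom 1 (\<Sum>i=Suc j..d. \<nu> i)
      * jacobi_unit (\<nu> j) (jacobi_param d \<kappa> \<nu> j) (\<kappa> j)) (remainder x (Suc j) / remainder x j))"
proof -
  have r: "remainder x j \<noteq> 0" if "j \<in> {1..Suc d}" for j
    using remainder_mono[OF x(1), of j "Suc d"] that x(2) by auto
  have "simplex_jacobi d \<kappa> \<nu> x = (\<Prod>j=1..d. remainder x j ^ \<nu> j *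
      poly (jacobi_unit (\<nu> j) (jacobi_param d \<kappa> \<nu> j) (\<kappa> j)) (remainder x (Suc j) / remainder x j))"
    unfolding simplex_jacobi_homogeneous_coords simplex_jacobi_hom_def
    using r by (intro prod.cong) (auto simp: tail_sum_barycentric poly_homog_eq degree_jacobi_unit)
  then show ?thesis
    using prod_power_stick[of "remainder x" d \<nu>] r by (simp add: prod.distrib poly_monom)
qed

lemma jacobi_param_tail:
  assumes "j \<in> {1..d}"
  shows "jacobi_param d \<kappa> \<nu> j + 1
    = tail_weight d \<kappa> (Suc j) + real (\<Sum>i=Suc j..d. \<nu> i) + real (\<Sum>i=Suc j..d. \<nu> i)"
  using assms by (simp add: jacobi_param_def tail_weight_def sum.distrib of_nat_diff)

lemma jacobi_param_gt:
  assumes "\<forall>i\<in>{1..d+1}. -1 < \<kappa> i" "j \<in> {1..d}"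
  shows "jacobi_param d \<kappa> \<nu> j > -1"
proof -
  have "jacobi_param d \<kappa> \<nu> j + 1 > 0"
    unfolding jacobi_param_tail[OF assms(2)] using assms(2)
    by (intro add_pos_nonneg tail_weight_pos[OF assms(1)] of_nat_0_le_iff) auto
  then show ?thesis by simp
qed

lemma simplex_inner_jacobi:
  assumes d: "1 \<le> d" and \<kappa>: "\<forall>i\<in>{1..d+1}. -1 < \<kappa> i"
  shows "simplex_inner d \<kappa> (simplex_jacobi d \<kappa> \<nu>) (simplex_jacobi d \<kappa> \<mu>)
    = Gamma ((\<Sum>i=1..d+1. \<kappa> i) + real d + 1) / (\<Prod>i=1..d+1. Gamma (\<kappa> i + 1))
       * (\<Prod>j=1..d. beta_functional (tail_weight d \<kappa> (Suc j)
            + real (\<Sum>i=Suc j..d. \<nu> i) + real (\<Sum>i=Suc j..d. \<mu> i)) (\<kappa> j + 1)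
          (jacobi_unit (\<nu> j) (jacobi_param d \<kappa> \<nu> j) (\<kappa> j)
         * jacobi_unit (\<mu> j) (jacobi_param d \<kappa> \<mu> j) (\<kappa> j)))"
proof -
  let ?p = "\<lambda>j. monom 1 (\<Sum>i=Suc j..d. \<nu> i) * (monom 1 (\<Sum>i=Suc j..d. \<mu> i)
       * (jacobi_unit (\<nu> j) (jacobi_param d \<kappa> \<nu> j) (\<kappa> j)
         * jacobi_unit (\<mu> j) (jacobi_param d \<kappa> \<mu> j) (\<kappa> j)))"
  have "simplex_inner d \<kappa> (simplex_jacobi d \<kappa> \<nu>) (simplex_jacobi d \<kappa> \<mu>)
    = simplex_mean d \<kappa> (\<lambda>x. \<Prod>j=1..d. poly (?p j) (remainder x (Suc j) / remainder x j))"
    unfolding simplex_inner_eq_mean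
    by (intro simplex_mean_cong) (simp add: simplex_jacobi_stick prod.distrib mult_ac)
  then show ?thesis
    unfolding simplex_mean_stick_product[OF d \<kappa>, of ?p] by (simp only: beta_functional_monom_mult)
qed

text \<open>
  At the largest index \<open>j\<close> where \<open>\<nu>\<close> and \<open>\<mu>\<close> differ, both polynomials have the same parameter \<open>a\<^sub>j\<close>, and
  the monomial factors turn the beta weight into the Jacobi weight for that parameter. The \<open>j\<close>-th factor
  of the inner product is then that of two classical Jacobi polynomials of distinct degrees, and vanishes.
\<close>

lemma simplex_jacobi_orthogonal:
  assumes d: "1 \<le> d" and \<kappa>: "\<forall>i\<in>{1..d+1}. -1 < \<kappa> i"
    and diff: "j0 \<in> {1..d}" "\<nu> j0 \<noteq> \<mu> j0"
  shows "simplex_inner d \<kappa> (simplex_jacobi d \<kappa> \<nu>) (simplex_jacobi d \<kappa> \<mu>) = 0"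
proof -
  define j where "j = Max {j\<in>{1..d}. \<nu> j \<noteq> \<mu> j}"
  have "j \<in> {j\<in>{1..d}. \<nu> j \<noteq> \<mu> j}" unfolding j_def using diff by (intro Max_in) auto
  then have j: "j \<in> {1..d}" "\<nu> j \<noteq> \<mu> j" by auto
  have "\<nu> i = \<mu> i" if "i \<in> {Suc j..d}" for i
  proof (rule ccontr)
    assume "\<nu> i \<noteq> \<mu> i"
    then have "i \<le> j" unfolding j_def using that by (intro Max_ge) auto
    then show False using that by simp
  qed
  then have eq: "(\<Sum>i=Suc j..d. \<mu> i) = (\<Sum>i=Suc j..d. \<nu> i)" by simp
  then have par: "jacobi_param d \<kappa> \<mu> j = jacobi_param d \<kappa> \<nu> j" by (simp add: jacobi_param_def)
  have "\<kappa> j > -1" using \<kappa> j(1) by simp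
  then have "beta_functional (jacobi_param d \<kappa> \<nu> j + 1) (\<kappa> j + 1)
          (jacobi_unit (\<nu> j) (jacobi_param d \<kappa> \<nu> j) (\<kappa> j)
         * jacobi_unit (\<mu> j) (jacobi_param d \<kappa> \<mu> j) (\<kappa> j)) = 0"
    unfolding par using j by (intro jacobi_orthogonal jacobi_param_gt \<kappa>) auto
  then have "\<exists>j\<in>{1..d}. beta_functional (tail_weight d \<kappa> (Suc j)
            + real (\<Sum>i=Suc j..d. \<nu> i) + real (\<Sum>i=Suc j..d. \<mu> i)) (\<kappa> j + 1)
          (jacobi_unit (\<nu> j) (jacobi_param d \<kappa> \<nu> j) (\<kappa> j)
         * jacobi_unit (\<mu> j) (jacobi_param d \<kappa> \<mu> j) (\<kappa> j)) = 0"
    using j(1) by (intro bexI[of _ j]) (simp_all only: jacobi_param_tail eq)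
  then show ?thesis unfolding simplex_inner_jacobi[OF d \<kappa>] by (subst prod_zero) auto
qed

lemma simplex_norm_nonzero:
  assumes d: "1 \<le> d" and \<kappa>: "\<forall>i\<in>{1..d+1}. -1 < \<kappa> i"
  shows "simplex_norm d \<kappa> \<nu> \<noteq> 0"
proof -
  have pos: "\<kappa> i + 1 > 0" if "i \<in> {1..d+1}" for i
  proof -
    have "-1 < \<kappa> i" using \<kappa> that by blast
    then show ?thesis by simp
  qed
  have "Gamma ((\<Sum>i=1..d+1. \<kappa> i) + real d + 1) > 0"
    by (intro Gamma_real_pos total_weight_pos[OF \<kappa>])
  then have "Gamma ((\<Sum>i=1..d+1. \<kappa> i) + real d + 1) \<noteq> 0" by linarith
  moreover have "(\<Prod>i=1..d+1. Gamma (\<kappa> i + 1)) > 0"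
    using pos by (intro prod_pos Gamma_real_pos) auto
  then have "(\<Prod>i=1..d+1. Gamma (\<kappa> i + 1)) \<noteq> 0" by linarith
  moreover have "beta_functional (tail_weight d \<kappa> (Suc j)
            + real (\<Sum>i=Suc j..d. \<nu> i) + real (\<Sum>i=Suc j..d. \<nu> i)) (\<kappa> j + 1)
          (jacobi_unit (\<nu> j) (jacobi_param d \<kappa> \<nu> j) (\<kappa> j)
         * jacobi_unit (\<nu> j) (jacobi_param d \<kappa> \<nu> j) (\<kappa> j)) \<noteq> 0" if "j \<in> {1..d}" for j
    using jacobi_norm_nonzero[OF jacobi_param_gt[OF \<kappa> that, of \<nu>], of "\<kappa> j" "\<nu> j"] pos[of j] that
    by (simp only: jacobi_param_tail[OF that]) simp
  then have "(\<Prod>j=1..d. beta_functional (tail_weight d \<kappa> (Suc j)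
            + real (\<Sum>i=Suc j..d. \<nu> i) + real (\<Sum>i=Suc j..d. \<nu> i)) (\<kappa> j + 1)
          (jacobi_unit (\<nu> j) (jacobi_param d \<kappa> \<nu> j) (\<kappa> j)
         * jacobi_unit (\<nu> j) (jacobi_param d \<kappa> \<nu> j) (\<kappa> j))) \<noteq> 0"
    by (subst prod_zero_iff) blast+
  ultimately show ?thesis
    unfolding simplex_norm_def simplex_inner_jacobi[OF d \<kappa>]
    by (simp only: mult_eq_0_iff divide_eq_0_iff simp_thms)
qed

lemma simplex_jacobi_product_integrable:
  assumes d: "1 \<le> d" and \<kappa>: "\<forall>i\<in>{1..d+1}. -1 < \<kappa> i"
  shows "simplex_integrable d \<kappa> (\<lambda>x. simplex_jacobi d \<kappa> \<nu> x * simplex_jacobi d \<kappa> \<mu> x)"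
  unfolding simplex_jacobi_homogeneous_coords
  by (rule homogeneous_integrable[OF d \<kappa> homogeneous_mult,
        OF homogeneous_simplex_jacobi_hom homogeneous_simplex_jacobi_hom])

text \<open>
  Fourier coefficients with respect to the orthogonal Jacobi polynomials; since the norms are nonzero,
  they determine the coefficients of an expansion.
\<close>

lemma simplex_jacobi_coefficient:
  assumes d: "1 \<le> d" and \<kappa>: "\<forall>i\<in>{1..d+1}. -1 < \<kappa> i"
    and A: "\<And>\<mu>. \<mu> \<in> A \<Longrightarrow> \<mu> \<in> multi_indices d (\<Sum>i=1..d. \<mu> i)" "finite A" "\<rho> \<in> A"
    and f: "\<And>x. x \<in> std_simplex d \<Longrightarrow> f x = (\<Sum>\<mu>\<in>A. c \<mu> * simplex_jacobi d \<kappa> \<mu> x)"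
  shows "simplex_mean d \<kappa> (\<lambda>x. f x * simplex_jacobi d \<kappa> \<rho> x) = c \<rho> * simplex_norm d \<kappa> \<rho>"
proof -
  have "simplex_mean d \<kappa> (\<lambda>x. f x * simplex_jacobi d \<kappa> \<rho> x)
      = simplex_mean d \<kappa> (\<lambda>x. \<Sum>\<mu>\<in>A. c \<mu> * (simplex_jacobi d \<kappa> \<mu> x * simplex_jacobi d \<kappa> \<rho> x))"
    by (intro simplex_mean_cong) (simp add: f sum_distrib_right mult.assoc)
  also have "\<dots> = (\<Sum>\<mu>\<in>A. c \<mu> * simplex_inner d \<kappa> (simplex_jacobi d \<kappa> \<mu>) (simplex_jacobi d \<kappa> \<rho>))"
    unfolding simplex_inner_eq_mean
    by (intro simplex_mean_sum simplex_jacobi_product_integrable d \<kappa>)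
  also have "\<dots> = (\<Sum>\<mu>\<in>A. if \<mu> = \<rho> then c \<rho> * simplex_norm d \<kappa> \<rho> else 0)"
  proof (rule sum.cong)
    fix \<mu> assume \<mu>: "\<mu> \<in> A"
    show "c \<mu> * simplex_inner d \<kappa> (simplex_jacobi d \<kappa> \<mu>) (simplex_jacobi d \<kappa> \<rho>)
        = (if \<mu> = \<rho> then c \<rho> * simplex_norm d \<kappa> \<rho> else 0)"
    proof (cases "\<mu> = \<rho>")
      case False
      then obtain j where j: "\<mu> j \<noteq> \<rho> j" by auto
      have "j \<in> {1..d}"
      proof (rule ccontr)
        assume "j \<notin> {1..d}"
        then have "\<mu> j = 0" "\<rho> j = 0"
          using A(1)[OF \<mu>] A(1)[OF A(3)] unfolding multi_indices_def by blast+
        then show False using j by simp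
      qed
      then show ?thesis
        using False j simplex_jacobi_orthogonal[OF d \<kappa>, of j \<mu> \<rho>] by simp
    qed (simp add: simplex_norm_def)
  qed simp
  finally show ?thesis using A by simp
qed

section \<open>The Jacobi polynomials span all polynomials\<close>

definition multi_indices_upto :: "nat \<Rightarrow> nat \<Rightarrow> (nat \<Rightarrow> nat) set" where
  "multi_indices_upto d n = (\<Union>k\<le>n. multi_indices d k)"

lemma finite_multi_indices_upto [simp]: "finite (multi_indices_upto d n)"
  by (simp add: multi_indices_upto_def)

lemma multi_indices_upto_iff:
  "\<mu> \<in> multi_indices_upto d n \<longleftrightarrow> \<mu> \<in> multi_indices d (\<Sum>i=1..d. \<mu> i) \<and> (\<Sum>i=1..d. \<mu> i) \<le> n"
  by (auto simp: multi_indices_upto_def multi_indices_def)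

definition jacobi_span :: "nat \<Rightarrow> (nat \<Rightarrow> real) \<Rightarrow> nat \<Rightarrow> ((nat \<Rightarrow> real) \<Rightarrow> real) \<Rightarrow> bool" where
  "jacobi_span d \<kappa> n f \<longleftrightarrow>
     (\<exists>a. \<forall>x. f x = (\<Sum>\<mu>\<in>multi_indices_upto d n. a \<mu> * simplex_jacobi d \<kappa> \<mu> x))"

lemma jacobi_span_sum:
  assumes "\<And>i. i \<in> A \<Longrightarrow> jacobi_span d \<kappa> n (f i)"
  shows "jacobi_span d \<kappa> n (\<lambda>x. \<Sum>i\<in>A. c i * f i x)"
proof -
  have "\<forall>i\<in>A. \<exists>a. \<forall>x. f i x = (\<Sum>\<mu>\<in>multi_indices_upto d n. a \<mu> * simplex_jacobi d \<kappa> \<mu> x)"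
    using assms by (auto simp: jacobi_span_def)
  then obtain a where a: "f i x = (\<Sum>\<mu>\<in>multi_indices_upto d n. a i \<mu> * simplex_jacobi d \<kappa> \<mu> x)"
    if "i \<in> A" for i x by metis
  have "(\<Sum>i\<in>A. c i * f i x)
      = (\<Sum>\<mu>\<in>multi_indices_upto d n. (\<Sum>i\<in>A. c i * a i \<mu>) * simplex_jacobi d \<kappa> \<mu> x)" for x
    by (simp add: a sum_distrib_left sum_distrib_right mult.assoc sum.swap[of _ A])
  then show ?thesis unfolding jacobi_span_def by (intro exI allI)
qed

lemma jacobi_span_lincomb:
  assumes "jacobi_span d \<kappa> n f" "jacobi_span d \<kappa> n g"
  shows "jacobi_span d \<kappa> n (\<lambda>x. a * f x + b * g x)"
  using jacobi_span_sum[of UNIV d \<kappa> n "\<lambda>i::bool. if i then f else g" "\<lambda>i. if i then a else b"] assms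
  by (simp add: UNIV_bool add.commute)

lemma jacobi_span_basis:
  assumes "\<mu> \<in> multi_indices_upto d n"
  shows "jacobi_span d \<kappa> n (simplex_jacobi d \<kappa> \<mu>)"
proof -
  have "simplex_jacobi d \<kappa> \<mu> x = (\<Sum>\<rho>\<in>multi_indices_upto d n.
      (if \<rho> = \<mu> then 1 else 0) * simplex_jacobi d \<kappa> \<rho> x)" for x
    using assms by (simp add: if_distrib[where f = "\<lambda>c. c * _"] cong: if_cong)
  then show ?thesis unfolding jacobi_span_def by (intro exI allI)
qed

lemma prod_shift_neutral:
  fixes f :: "nat \<Rightarrow> 'a::comm_monoid_mult"
  assumes "f 1 = 1" "f (Suc d) = 1"
  shows "(\<Prod>j=1..d. f j) = (\<Prod>j=1..d. f (Suc j))"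
proof -
  have "(\<Prod>j=1..d. f (Suc j)) = f 1 * (\<Prod>j=Suc 1..Suc d. f j)"
    unfolding prod.shift_bounds_cl_Suc_ivl assms by simp
  also have "\<dots> = (\<Prod>j=1..Suc d. f j)" by (rule prod.atLeast_Suc_atMost[symmetric]) simp
  finally show ?thesis using assms by simp
qed

lemma sum_shift_neutral:
  fixes f :: "nat \<Rightarrow> 'a::comm_monoid_add"
  assumes "f 1 = 0" "f (Suc d) = 0"
  shows "(\<Sum>j=1..d. f j) = (\<Sum>j=1..d. f (Suc j))"
proof -
  have "(\<Sum>j=1..d. f (Suc j)) = f 1 + (\<Sum>j=Suc 1..Suc d. f j)"
    unfolding sum.shift_bounds_cl_Suc_ivl assms by simp
  also have "\<dots> = (\<Sum>j=1..Suc d. f j)" by (rule sum.atLeast_Suc_atMost[symmetric]) simp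
  finally show ?thesis using assms by simp
qed

definition stick_monomial :: "nat \<Rightarrow> (nat \<Rightarrow> nat) \<Rightarrow> (nat \<Rightarrow> real) \<Rightarrow> real" where
  "stick_monomial d g x = (\<Prod>j=1..d. remainder x (Suc j) ^ g j)"

text \<open>
  The Jacobi polynomial with index \<open>g\<close> is triangular with respect to the monomials in the remainders.
  Its \<open>j\<close>-th factor is a form of degree \<open>g\<^sub>j\<close> in the consecutive remainders \<open>u\<^sub>j\<close> and \<open>u\<^sub>j\<^sub>+\<^sub>1\<close>. Choosing
  \<open>u\<^sub>j\<^sub>+\<^sub>1\<close> throughout gives the leading monomial, with nonzero coefficient; every other choice replaces
  some \<open>u\<^sub>j\<^sub>+\<^sub>1\<close> by \<open>u\<^sub>j\<close> and so lowers \<open>\<Sum>\<^sub>j j g\<^sub>j\<close>, the quantity of the induction, without raising the degree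
  (which drops when \<open>u\<^sub>1 = 1\<close> occurs).
\<close>

lemma jacobi_span_stick_monomial:
  assumes \<kappa>: "\<forall>i\<in>{1..d+1}. -1 < \<kappa> i" and "(\<Sum>j=1..d. g j) \<le> n"
  shows "jacobi_span d \<kappa> n (stick_monomial d g)"
  using assms(2)
proof (induction "\<Sum>j=1..d. j * g j" arbitrary: g rule: less_induct)
  case less
  define \<mu> where "\<mu> j = (if j \<in> {1..d} then g j else 0)" for j
  have \<mu>sum: "(\<Sum>j=1..d. \<mu> j) = (\<Sum>j=1..d. g j)" "(\<Sum>j=1..d. j * \<mu> j) = (\<Sum>j=1..d. j * g j)"
    by (auto simp: \<mu>_def intro!: sum.cong)
  have \<mu>: "\<mu> \<in> multi_indices_upto d n"
    using less.prems \<mu>sum by (auto simp: multi_indices_upto_iff multi_indices_def \<mu>_def)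
  define U where "U j = jacobi_unit (\<mu> j) (jacobi_param d \<kappa> \<mu> j) (\<kappa> j)" for j
  define K where "K = PiE {1..d} (\<lambda>j. {..\<mu> j})"
  define c where "c k = (\<Prod>j=1..d. coeff (U j) (k j))" for k
  define ext where "ext k j = (if j \<in> {1..d} then k j else 0)" for k :: "nat \<Rightarrow> nat" and j
  define D where "D k j = \<mu> j - ext k j" for k j
  \<comment> \<open>The exponent of the remainder with index \<open>j + 1\<close>: the factors \<open>j\<close> and \<open>j + 1\<close> contribute to it.\<close>
  define e where "e k j = ext k j + D k (Suc j)" for k j
  have D0: "D k (Suc d) = 0" for k by (simp add: D_def \<mu>_def)
  have ext_le: "ext k j \<le> \<mu> j" if "k \<in> K" for k j
    using that by (auto simp: ext_def K_def PiE_def)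
  have expand: "simplex_jacobi d \<kappa> \<mu> x = (\<Sum>k\<in>K. c k * stick_monomial d (e k) x)" for x
  proof -
    have "simplex_jacobi d \<kappa> \<mu> x = (\<Prod>j=1..d. \<Sum>k\<le>\<mu> j.
        coeff (U j) k * (remainder x (Suc j) ^ k * remainder x j ^ (\<mu> j - k)))"
      unfolding simplex_jacobi_homogeneous_coords simplex_jacobi_hom_def poly_homog_def U_def
      by (intro prod.cong sum.cong) (auto simp: tail_sum_barycentric)
    also have "\<dots> = (\<Sum>k\<in>K. \<Prod>j=1..d.
        coeff (U j) (k j) * (remainder x (Suc j) ^ k j * remainder x j ^ (\<mu> j - k j)))"
      unfolding K_def by (rule prod_sum_PiE) auto
    also have "\<dots> = (\<Sum>k\<in>K. c k * stick_monomial d (e k) x)"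
    proof (rule sum.cong)
      fix k
      have "(\<Prod>j=1..d. remainder x j ^ (\<mu> j - k j)) = (\<Prod>j=1..d. remainder x j ^ D k j)"
        by (intro prod.cong) (auto simp: D_def ext_def)
      also have "\<dots> = (\<Prod>j=1..d. remainder x (Suc j) ^ D k (Suc j))"
        by (rule prod_shift_neutral) (simp_all add: D0)
      finally have 1: "(\<Prod>j=1..d. remainder x j ^ (\<mu> j - k j)) = (\<Prod>j=1..d. remainder x (Suc j) ^ D k (Suc j))" .
      have 2: "(\<Prod>j=1..d. remainder x (Suc j) ^ k j) = (\<Prod>j=1..d. remainder x (Suc j) ^ ext k j)"
        by (intro prod.cong) (auto simp: ext_def)
      show "(\<Prod>j=1..d. coeff (U j) (k j) * (remainder x (Suc j) ^ k j * remainder x j ^ (\<mu> j - k j)))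
          = c k * stick_monomial d (e k) x"
        unfolding prod.distrib 1 2 by (simp add: c_def stick_monomial_def e_def power_add prod.distrib)
    qed simp
    finally show ?thesis .
  qed
  define k0 where "k0 = restrict \<mu> {1..d}"
  have k0: "k0 \<in> K" by (simp add: k0_def K_def)
  have "stick_monomial d (e k0) x = stick_monomial d g x" for x
    unfolding stick_monomial_def
    by (intro prod.cong) (auto simp: e_def D_def ext_def k0_def \<mu>_def)
  then have lead: "simplex_jacobi d \<kappa> \<mu> x
      = c k0 * stick_monomial d g x + (\<Sum>k\<in>K - {k0}. c k * stick_monomial d (e k) x)" for x
    unfolding expand using k0 by (subst sum.remove[of K k0]) (auto simp: K_def intro!: finite_PiE)
  have "coeff (U j) (k0 j) \<noteq> 0" if "j \<in> {1..d}" for j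
    using that \<kappa> jacobi_param_gt[OF \<kappa> that, of \<mu>] by (simp add: U_def k0_def jacobi_unit_lead_nonzero)
  then have c0: "c k0 \<noteq> 0" unfolding c_def by (subst prod_zero_iff) auto
  have rest: "jacobi_span d \<kappa> n (stick_monomial d (e k))" if k: "k \<in> K - {k0}" for k
  proof (rule less.hyps)
    have kK: "k \<in> K" and "k \<noteq> k0" using k by auto
    have eqD: "ext k j + D k j = \<mu> j" for j using ext_le[OF kK, of j] by (simp add: D_def)
    obtain i where i: "k i \<noteq> k0 i" using \<open>k \<noteq> k0\<close> by auto
    have "i \<in> {1..d}"
    proof (rule ccontr)
      assume i': "i \<notin> {1..d}"
      have "k i = undefined" using kK i' unfolding K_def by (rule PiE_arb)
      moreover have "k0 i = undefined" unfolding k0_def using i' by (rule restrict_apply[THEN trans, OF if_not_P])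
      ultimately show False using i by simp
    qed
    then have "D k i > 0" using i ext_le[OF kK, of i] by (simp add: D_def ext_def k0_def)
    then have Dpos: "(\<Sum>j=1..d. D k j) > 0" using \<open>i \<in> {1..d}\<close> by (intro sum_pos2[of _ i]) auto
    have shift: "(\<Sum>j=1..d. (j - 1) * D k j) = (\<Sum>j=1..d. j * D k (Suc j))"
      using sum_shift_neutral[of "\<lambda>j. (j - 1) * D k j" d] by (simp add: D0)
    have "(\<Sum>j=1..d. j * D k j) = (\<Sum>j=1..d. (j - 1) * D k j) + (\<Sum>j=1..d. D k j)"
      unfolding sum.distrib[symmetric]
    proof (rule sum.cong)
      fix j assume "j \<in> {1..d}"
      then show "j * D k j = (j - 1) * D k j + D k j" by (cases j) auto
    qed simp
    moreover have "(\<Sum>j=1..d. j * g j) = (\<Sum>j=1..d. j * ext k j) + (\<Sum>j=1..d. j * D k j)"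
      unfolding \<mu>sum(2)[symmetric] sum.distrib[symmetric] eqD[symmetric] by (simp add: algebra_simps)
    moreover have "(\<Sum>j=1..d. j * e k j) = (\<Sum>j=1..d. j * ext k j) + (\<Sum>j=1..d. j * D k (Suc j))"
      unfolding sum.distrib[symmetric] by (simp add: e_def algebra_simps)
    ultimately show "(\<Sum>j=1..d. j * e k j) < (\<Sum>j=1..d. j * g j)" using Dpos shift by linarith
    have "(\<Sum>j=1..d. D k (Suc j)) \<le> (\<Sum>j=1..Suc d. D k j)"
      using sum.atLeast_Suc_atMost[of 1 "Suc d" "D k"]
      by (simp add: sum.shift_bounds_cl_Suc_ivl[symmetric] del: sum.cl_ivl_Suc)
    then have "(\<Sum>j=1..d. D k (Suc j)) \<le> (\<Sum>j=1..d. D k j)" by (simp add: D0)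
    moreover have "(\<Sum>j=1..d. e k j) = (\<Sum>j=1..d. ext k j) + (\<Sum>j=1..d. D k (Suc j))"
      by (simp add: e_def sum.distrib)
    moreover have "(\<Sum>j=1..d. ext k j) + (\<Sum>j=1..d. D k j) = (\<Sum>j=1..d. g j)"
      unfolding sum.distrib[symmetric] eqD by (rule \<mu>sum(1))
    ultimately show "(\<Sum>j=1..d. e k j) \<le> n" using less.prems by linarith
  qed
  have "jacobi_span d \<kappa> n (\<lambda>x. 1 / c k0 * simplex_jacobi d \<kappa> \<mu> x
      + (- 1 / c k0) * (\<Sum>k\<in>K - {k0}. c k * stick_monomial d (e k) x))"
    by (intro jacobi_span_lincomb jacobi_span_basis jacobi_span_sum rest \<mu>)
  moreover have "(\<lambda>x. 1 / c k0 * simplex_jacobi d \<kappa> \<mu> x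
      + (- 1 / c k0) * (\<Sum>k\<in>K - {k0}. c k * stick_monomial d (e k) x)) = stick_monomial d g"
    unfolding lead using c0 by (simp add: fun_eq_iff field_simps)
  ultimately show ?case by simp
qed

text \<open>
  The linear combinations of monomials of degree at most \<open>n\<close> in the remainders. Being closed under
  multiplication by coordinates, up to a shift of \<open>n\<close>, they contain all polynomials of degree at most \<open>n\<close>.
\<close>

inductive stick_span :: "nat \<Rightarrow> nat \<Rightarrow> ((nat \<Rightarrow> real) \<Rightarrow> real) \<Rightarrow> bool" for d n where
  zero: "stick_span d n (\<lambda>_. 0)"
| add: "stick_span d n f \<Longrightarrow> (\<Sum>j=1..d. g j) \<le> n
    \<Longrightarrow> stick_span d n (\<lambda>x. f x + c * stick_monomial d g x)"

lemma stick_span_lincomb: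
  assumes "stick_span d n h" "stick_span d n f"
  shows "stick_span d n (\<lambda>x. f x + a * h x)"
  using assms(1)
proof induction
  case zero
  then show ?case using assms(2) by simp
next
  case (add h g c)
  then show ?case using stick_span.add[OF add.IH add.hyps(2), of "a * c"] by (simp add: algebra_simps)
qed

lemma stick_span_remainder_mult:
  assumes "stick_span d n f" "i \<in> {1..Suc d}"
  shows "stick_span d (Suc n) (\<lambda>x. f x * remainder x i)"
  using assms(1)
proof induction
  case zero
  then show ?case by (simp add: stick_span.zero)
next
  case (add f g c)
  have "\<exists>g'. (\<Sum>j=1..d. g' j) \<le> Suc n \<and> (\<forall>x. stick_monomial d g x * remainder x i = stick_monomial d g' x)"
  proof (cases "i = 1")
    case True
    then show ?thesis using add.hyps(2) by (intro exI[of _ g]) auto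
  next
    case False
    then obtain k where k: "i = Suc k" "k \<in> {1..d}" using assms(2) by (cases i) auto
    define g' where "g' = g(k := Suc (g k))"
    have "(\<Sum>j=1..d. g' j) = Suc (\<Sum>j=1..d. g j)"
      using k(2) by (simp add: sum.remove[of _ k] g'_def)
    moreover have "stick_monomial d g x * remainder x i = stick_monomial d g' x" for x
      unfolding stick_monomial_def using k by (simp add: prod.remove[of _ k] g'_def mult_ac)
    ultimately show ?thesis using add.hyps(2) by (intro exI[of _ g']) auto
  qed
  then obtain g' where "(\<Sum>j=1..d. g' j) \<le> Suc n"
    and "\<And>x. stick_monomial d g x * remainder x i = stick_monomial d g' x" by blast
  then show ?case using stick_span.add[OF add.IH, of g' c] by (simp add: distrib_right mult.assoc)
qed

lemma stick_span_coord_mult: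
  assumes f: "stick_span d n f" and i: "i \<in> {1..Suc d}"
  shows "stick_span d (Suc n) (\<lambda>x. f x * barycentric d x i)"
proof (cases "i = Suc d")
  case True
  then have "barycentric d x i = remainder x i" for x
    by (simp add: barycentric_def remainder_last)
  then show ?thesis using stick_span_remainder_mult[OF f i] by simp
next
  case False
  then have lc: "barycentric d x i = remainder x i - remainder x (Suc i)" for x
    using i by (simp add: barycentric_def remainder_Suc)
  have "(\<lambda>x. f x * barycentric d x i)
      = (\<lambda>x. f x * remainder x i + (-1) * (f x * remainder x (Suc i)))"
    by (simp add: fun_eq_iff lc algebra_simps)
  moreover have "stick_span d (Suc n) (\<lambda>x. f x * remainder x i + (-1) * (f x * remainder x (Suc i)))"
    using False i by (intro stick_span_lincomb stick_span_remainder_mult f) auto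
  ultimately show ?thesis by (simp only:)
qed

lemma stick_span_monomial: "stick_span d (\<Sum>i=1..Suc d. \<beta> i) (\<lambda>x. monomial (Suc d) \<beta> (barycentric d x))"
proof -
  have "stick_span d (\<Sum>i=1..m. \<beta> i) (\<lambda>x. \<Prod>i=1..m. barycentric d x i ^ \<beta> i)" if "m \<le> Suc d" for m
    using that
  proof (induction m)
    case 0
    have "stick_monomial d (\<lambda>_. 0) = (\<lambda>_. 1)" by (simp add: stick_monomial_def fun_eq_iff)
    then show ?case using stick_span.add[OF stick_span.zero, where g = "\<lambda>_. 0" and c = 1 and d = d and n = 0] by simp
  next
    case (Suc m)
    have "stick_span d ((\<Sum>i=1..m. \<beta> i) + b)
        (\<lambda>x. (\<Prod>i=1..m. barycentric d x i ^ \<beta> i) * barycentric d x (Suc m) ^ b)" for b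
    proof (induction b)
      case 0
      then show ?case using Suc by simp
    next
      case (Suc b)
      then show ?case using stick_span_coord_mult[OF Suc, of "Suc m"] \<open>Suc m \<le> Suc d\<close>
        by (simp add: mult_ac)
    qed
    from this[of "\<beta> (Suc m)"] show ?case by simp
  qed
  then show ?thesis unfolding monomial_def by blast
qed

lemma jacobi_span_homogeneous:
  assumes \<kappa>: "\<forall>i\<in>{1..d+1}. -1 < \<kappa> i" and F: "homogeneous (Suc d) n F"
  shows "jacobi_span d \<kappa> n (\<lambda>x. F (barycentric d x))"
proof -
  obtain q where q: "\<And>y. F y = (\<Sum>\<beta>\<in>multi_indices (Suc d) n. q \<beta> * monomial (Suc d) \<beta> y)"
    using F unfolding homogeneous_def by blast
  have span: "jacobi_span d \<kappa> n f" if "stick_span d n f" for f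
    using that
  proof induction
    case zero
    show ?case using jacobi_span_sum[of "{}" d \<kappa> n] by simp
  next
    case (add f g c)
    then show ?case
      using jacobi_span_lincomb[OF add.IH jacobi_span_stick_monomial[OF \<kappa> add.hyps(2)], of 1 c] by simp
  qed
  have "jacobi_span d \<kappa> n (\<lambda>x. monomial (Suc d) \<beta> (barycentric d x))"
    if "\<beta> \<in> multi_indices (Suc d) n" for \<beta>
    using span[of "\<lambda>x. monomial (Suc d) \<beta> (barycentric d x)"] stick_span_monomial[of d \<beta>] that
    by (simp add: multi_indices_def)
  then show ?thesis unfolding q by (intro jacobi_span_sum)
qed

text \<open>
  A polynomial of lower degree is a combination of Jacobi polynomials of lower degree.
\<close>

lemma simplex_jacobi_orthogonal_lower:
  assumes d: "1 \<le> d" and \<kappa>: "\<forall>i\<in>{1..d+1}. -1 < \<kappa> i"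
    and F: "homogeneous (Suc d) m F" and m: "m < (\<Sum>i=1..d. \<nu> i)"
  shows "simplex_mean d \<kappa> (\<lambda>x. simplex_jacobi d \<kappa> \<nu> x * F (barycentric d x)) = 0"
proof -
  obtain a where a: "\<And>x. F (barycentric d x) = (\<Sum>\<mu>\<in>multi_indices_upto d m. a \<mu> * simplex_jacobi d \<kappa> \<mu> x)"
    using jacobi_span_homogeneous[OF \<kappa> F] unfolding jacobi_span_def by blast
  have "simplex_mean d \<kappa> (\<lambda>x. simplex_jacobi d \<kappa> \<nu> x * F (barycentric d x))
      = simplex_mean d \<kappa> (\<lambda>x. \<Sum>\<mu>\<in>multi_indices_upto d m. a \<mu> * (simplex_jacobi d \<kappa> \<nu> x * simplex_jacobi d \<kappa> \<mu> x))"
    unfolding a by (simp add: sum_distrib_left mult_ac)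
  also have "\<dots> = (\<Sum>\<mu>\<in>multi_indices_upto d m. a \<mu> * simplex_inner d \<kappa> (simplex_jacobi d \<kappa> \<nu>) (simplex_jacobi d \<kappa> \<mu>))"
    unfolding simplex_inner_eq_mean
    by (intro simplex_mean_sum simplex_jacobi_product_integrable d \<kappa>)
  also have "\<dots> = 0"
  proof (rule sum.neutral, rule ballI)
    fix \<mu> assume "\<mu> \<in> multi_indices_upto d m"
    then have "(\<Sum>i=1..d. \<mu> i) \<noteq> (\<Sum>i=1..d. \<nu> i)" using m by (simp add: multi_indices_upto_iff)
    then obtain j where "j \<in> {1..d}" "\<nu> j \<noteq> \<mu> j" by (metis sum.cong)
    then show "a \<mu> * simplex_inner d \<kappa> (simplex_jacobi d \<kappa> \<nu>) (simplex_jacobi d \<kappa> \<mu>) = 0"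
      using simplex_jacobi_orthogonal[OF d \<kappa>] by simp
  qed
  finally show ?thesis .
qed

section \<open>Permuting the variables of a Jacobi polynomial\<close>

lemma simplex_jacobi_permuted:
  assumes \<tau>: "\<tau> permutes {1..d+1}"
  shows "simplex_jacobi d \<kappa> \<nu> (simplex_perm d \<tau> x) = simplex_jacobi_hom d \<kappa> \<nu> (barycentric d x \<circ> \<tau>)"
proof -
  have coord: "simplex_perm d \<tau> x i = barycentric d x (\<tau> i)" if "i \<in> {1..d}" for i
    using that by (simp add: simplex_perm_def barycentric_def)
  have "barycentric d (simplex_perm d \<tau> x) i = (barycentric d x \<circ> \<tau>) i" if i: "i \<in> {1..Suc d}" for i
  proof (cases "i = Suc d")
    case True
    have "(\<Sum>i=1..Suc d. barycentric d x (\<tau> i)) = 1"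
      using sum.permute[OF \<tau>, of "barycentric d x"] barycentric_sum[of d x] by (simp add: o_def)
    moreover have "(\<Sum>i=1..d. simplex_perm d \<tau> x i) = (\<Sum>i=1..d. barycentric d x (\<tau> i))"
      using coord by (intro sum.cong) auto
    moreover have "barycentric d (simplex_perm d \<tau> x) i = 1 - (\<Sum>i=1..d. simplex_perm d \<tau> x i)"
      using True by (simp add: barycentric_def)
    ultimately show ?thesis using True by simp
  next
    case False
    then have "barycentric d (simplex_perm d \<tau> x) i = simplex_perm d \<tau> x i"
      by (simp add: barycentric_def)
    then show ?thesis using coord[of i] False i by simp
  qed
  then show ?thesis
    unfolding simplex_jacobi_homogeneous_coords
    by (intro homogeneous_cong[OF homogeneous_simplex_jacobi_hom])
qed

text \<open>
  The permuted polynomial has degree \<open>n\<close>, so it is a combination of Jacobi polynomials of degree at most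
  \<open>n\<close>. Undoing the permutation inside the mean moves it to the other factor of the inner product and keeps
  degrees, so the permuted polynomial is still orthogonal to all lower degrees. Hence only indices of
  degree exactly \<open>n\<close> occur.
\<close>

lemma simplex_jacobi_permuted_expansion:
  assumes d: "1 \<le> d" and \<kappa>: "\<forall>i\<in>{1..d+1}. -1 < \<kappa> i"
    and \<tau>: "\<tau> permutes {1..d+1}" and \<nu>: "\<nu> \<in> multi_indices d n"
  obtains c where "\<And>\<mu>. \<mu> \<notin> multi_indices d n \<Longrightarrow> c \<mu> = 0"
    and "\<And>x. simplex_jacobi d (\<kappa> \<circ> \<tau>) \<nu> (simplex_perm d \<tau> x)
      = (\<Sum>\<mu>\<in>multi_indices d n. c \<mu> * simplex_jacobi d \<kappa> \<mu> x)"
proof -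
  define f where "f x = simplex_jacobi d (\<kappa> \<circ> \<tau>) \<nu> (simplex_perm d \<tau> x)" for x
  define H where "H = simplex_jacobi_hom d (\<kappa> \<circ> \<tau>) \<nu>"
  have \<tau>': "\<tau> permutes {1..Suc d}" "inv \<tau> permutes {1..Suc d}" using \<tau> permutes_inv by auto
  have \<kappa>\<tau>: "\<forall>i\<in>{1..d+1}. -1 < (\<kappa> \<circ> \<tau>) i" using \<kappa> permutes_in_image[OF \<tau>] by simp
  have n: "(\<Sum>i=1..d. \<nu> i) = n" using \<nu> by (simp add: multi_indices_def)
  have H: "homogeneous (Suc d) n H"
    using homogeneous_simplex_jacobi_hom[of d \<nu> "\<kappa> \<circ> \<tau>"] n by (simp add: H_def)
  have f: "f x = H (barycentric d x \<circ> \<tau>)" for x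
    unfolding f_def H_def by (rule simplex_jacobi_permuted[OF \<tau>])
  have "jacobi_span d \<kappa> n f"
    using jacobi_span_homogeneous[OF \<kappa> homogeneous_permute[OF H \<tau>'(1)]]
    by (simp only: f[symmetric])
  then obtain a where a: "\<And>x. f x = (\<Sum>\<mu>\<in>multi_indices_upto d n. a \<mu> * simplex_jacobi d \<kappa> \<mu> x)"
    unfolding jacobi_span_def by blast
  have zero: "a \<rho> = 0" if \<rho>: "\<rho> \<in> multi_indices_upto d n - multi_indices d n" for \<rho>
  proof -
    define k where "k = (\<Sum>i=1..d. \<rho> i)"
    have "k < n" using \<rho> by (auto simp: k_def multi_indices_upto_iff order_le_less)
    define R where "R y = simplex_jacobi_hom d \<kappa> \<rho> (y \<circ> inv \<tau>)" for y
    have R: "homogeneous (Suc d) k R"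
      unfolding R_def k_def by (rule homogeneous_permute[OF homogeneous_simplex_jacobi_hom \<tau>'(2)])
    have "a \<rho> * simplex_norm d \<kappa> \<rho> = simplex_mean d \<kappa> (\<lambda>x. f x * simplex_jacobi d \<kappa> \<rho> x)"
      using \<rho> by (intro simplex_jacobi_coefficient[symmetric, OF d \<kappa> _ _ _ a])
        (auto simp: multi_indices_upto_iff)
    also have "\<dots> = simplex_mean d \<kappa> (\<lambda>x. H (barycentric d x \<circ> \<tau>) * R (barycentric d x \<circ> \<tau>))"
      by (simp add: f R_def simplex_jacobi_homogeneous_coords o_assoc[symmetric] permutes_inv_o[OF \<tau>])
    also have "\<dots> = simplex_mean d (\<kappa> \<circ> \<tau>) (\<lambda>x. H (barycentric d x) * R (barycentric d x))"
      using simplex_mean_homogeneous_permute[OF d \<kappa> homogeneous_mult[OF H R] \<tau>] .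
    also have "\<dots> = 0"
      unfolding H_def simplex_jacobi_homogeneous_coords[symmetric]
      using \<open>k < n\<close> n by (intro simplex_jacobi_orthogonal_lower[OF d \<kappa>\<tau> R]) simp
    finally show ?thesis using simplex_norm_nonzero[OF d \<kappa>] by simp
  qed
  define c where "c \<mu> = (if \<mu> \<in> multi_indices d n then a \<mu> else 0)" for \<mu>
  have "f x = (\<Sum>\<mu>\<in>multi_indices d n. c \<mu> * simplex_jacobi d \<kappa> \<mu> x)" for x
    unfolding a using zero
    by (intro sum.mono_neutral_cong_right) (auto simp: c_def multi_indices_upto_def)
  then show ?thesis using that[of c] by (simp add: c_def f_def)
qed

lemma simplex_jacobi_coeffs_unique:
  assumes d: "1 \<le> d" and \<kappa>: "\<forall>i\<in>{1..d+1}. -1 < \<kappa> i"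
    and eq: "\<And>x. x \<in> std_simplex d \<Longrightarrow> (\<Sum>\<mu>\<in>multi_indices d n. b \<mu> * simplex_jacobi d \<kappa> \<mu> x)
       = (\<Sum>\<mu>\<in>multi_indices d n. c \<mu> * simplex_jacobi d \<kappa> \<mu> x)"
    and \<rho>: "\<rho> \<in> multi_indices d n"
  shows "b \<rho> = c \<rho>"
proof -
  have A: "\<mu> \<in> multi_indices d (\<Sum>i=1..d. \<mu> i)" if "\<mu> \<in> multi_indices d n" for \<mu>
    using that by (simp add: multi_indices_def)
  have "b \<rho> * simplex_norm d \<kappa> \<rho> = c \<rho> * simplex_norm d \<kappa> \<rho>"
    using simplex_jacobi_coefficient[OF d \<kappa> A finite_multi_indices \<rho> refl, of b]
      simplex_jacobi_coefficient[OF d \<kappa> A finite_multi_indices \<rho> eq] by (rule trans[OF sym])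
  then show ?thesis using simplex_norm_nonzero[OF d \<kappa>] mult_cancel_right by blast
qed

section \<open>Powers of the sum of the variables\<close>

text \<open>
  The falling factorial \<open>a (a-1) \<cdots> (a-b+1)\<close>.
\<close>

definition falling :: "nat \<Rightarrow> nat \<Rightarrow> real" where
  "falling a b = (if b \<le> a then fact a / fact (a - b) else 0)"

lemma falling_Suc: "falling a (Suc b) = (real a - real b) * falling a b"
proof (cases "Suc b \<le> a")
  case True
  then have "a - b = Suc (a - Suc b)" by simp
  then have "fact (a - b) = (real a - real b) * fact (a - Suc b)"
    using True by (simp add: of_nat_diff)
  then show ?thesis using True by (simp add: falling_def)
qed (auto simp: falling_def)

text \<open>
  Lowering \<open>a\<close> multiplies \<open>1 / (a-b)!\<close> by \<open>a - b\<close>; with the conventions at \<open>a = 0\<close> and \<open>a < b\<close> this holds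
  without restriction.
\<close>

lemma falling_fact_pred:
  "(if a = 0 then 0 else falling (a - 1) b / fact (a - 1)) = (real a - real b) * (falling a b / fact a)"
proof (cases "a = 0 \<or> a < b")
  case True
  then show ?thesis by (auto simp: falling_def)
next
  case False
  show ?thesis
  proof (cases "a = b")
    case True
    then show ?thesis using False by (auto simp: falling_def)
  next
    case neq: False
    then have "a - b = Suc (a - 1 - b)" using False by linarith
    then have "fact (a - b) = (real a - real b) * fact (a - 1 - b)"
      using False neq by (simp add: of_nat_diff)
    moreover have "b < a" using False neq by simp
    then have "b \<le> a - 1" by simp
    ultimately show ?thesis using False neq by (simp add: falling_def)
  qed
qed

lemma coord_mult_monomial_sum:
  assumes i: "i \<in> {1..m}"
  shows "y i * (\<Sum>\<alpha>\<in>multi_indices m n. c \<alpha> * monomial m \<alpha> y)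
    = (\<Sum>\<alpha>\<in>multi_indices m (Suc n). (if \<alpha> i = 0 then 0 else c (\<alpha>(i := \<alpha> i - 1))) * monomial m \<alpha> y)"
proof -
  have sum_upd: "(\<Sum>j=1..m. (\<alpha>(i := b)) j) + \<alpha> i = (\<Sum>j=1..m. \<alpha> j) + b" for \<alpha> :: "nat \<Rightarrow> nat" and b
    using i by (simp add: sum.remove[of _ i])
  have mono: "monomial m (\<alpha>(i := Suc (\<alpha> i))) y = y i * monomial m \<alpha> y" for \<alpha>
    using i by (simp add: monomial_def prod.remove[of _ i])
  have "y i * (\<Sum>\<alpha>\<in>multi_indices m n. c \<alpha> * monomial m \<alpha> y)
      = (\<Sum>\<alpha>\<in>multi_indices m n. c \<alpha> * monomial m (\<alpha>(i := Suc (\<alpha> i))) y)"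
    by (simp add: mono sum_distrib_left mult.left_commute)
  also have "\<dots> = (\<Sum>\<alpha>\<in>{\<alpha>\<in>multi_indices m (Suc n). \<alpha> i \<noteq> 0}. c (\<alpha>(i := \<alpha> i - 1)) * monomial m \<alpha> y)"
  proof (rule sum.reindex_bij_witness[where j = "\<lambda>\<alpha>. \<alpha>(i := Suc (\<alpha> i))" and i = "\<lambda>\<alpha>. \<alpha>(i := \<alpha> i - 1)"])
    fix \<alpha> assume "\<alpha> \<in> multi_indices m n"
    then show "\<alpha>(i := Suc (\<alpha> i)) \<in> {\<alpha>\<in>multi_indices m (Suc n). \<alpha> i \<noteq> 0}"
      using sum_upd[of \<alpha> "Suc (\<alpha> i)"] i by (auto simp: multi_indices_def)
  next
    fix \<alpha> assume "\<alpha> \<in> {\<alpha>\<in>multi_indices m (Suc n). \<alpha> i \<noteq> 0}"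
    then show "\<alpha>(i := \<alpha> i - 1) \<in> multi_indices m n"
      using sum_upd[of \<alpha> "\<alpha> i - 1"] i by (auto simp: multi_indices_def)
  qed auto
  also have "\<dots> = (\<Sum>\<alpha>\<in>multi_indices m (Suc n). (if \<alpha> i = 0 then 0 else c (\<alpha>(i := \<alpha> i - 1))) * monomial m \<alpha> y)"
    by (intro sum.mono_neutral_cong_left) auto
  finally show ?thesis .
qed

text \<open>
  The multinomial theorem, multiplied by a monomial. Multiplying by one more factor \<open>|y|\<close> sums the
  differences \<open>\<alpha>\<^sub>i - \<beta>\<^sub>i\<close>, which gives the next factor \<open>M + 1\<close> of the factorial.
\<close>

lemma sum_power_mult_monomial:
  assumes \<beta>: "\<beta> \<in> multi_indices m n"
  shows "(\<Sum>i=1..m. y i) ^ M * monomial m \<beta> y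
    = (\<Sum>\<alpha>\<in>multi_indices m (n + M). (fact M * (\<Prod>i=1..m. falling (\<alpha> i) (\<beta> i) / fact (\<alpha> i))) * monomial m \<alpha> y)"
proof (induction M)
  case 0
  have "(\<Prod>i=1..m. falling (\<alpha> i) (\<beta> i) / fact (\<alpha> i)) = (if \<alpha> = \<beta> then 1 else 0)"
    if \<alpha>: "\<alpha> \<in> multi_indices m n" for \<alpha>
  proof (cases "\<forall>i\<in>{1..m}. \<beta> i \<le> \<alpha> i")
    case True
    have "\<alpha> i = \<beta> i" for i
    proof (cases "i \<in> {1..m}")
      case i: True
      show ?thesis
      proof (rule ccontr)
        assume "\<alpha> i \<noteq> \<beta> i"
        then have "(\<Sum>i=1..m. \<beta> i) < (\<Sum>i=1..m. \<alpha> i)"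
          using True i by (intro sum_strict_mono_ex1 ballI bexI[of _ i]) (auto simp: order_le_less)
        then show False using \<alpha> \<beta> by (simp add: multi_indices_def)
      qed
    next
      case False
      then show ?thesis using \<alpha> \<beta> by (simp add: multi_indices_def)
    qed
    then show ?thesis by (auto simp: falling_def)
  next
    case False
    then obtain i where "i \<in> {1..m}" "\<not> \<beta> i \<le> \<alpha> i" by blast
    then have "(\<Prod>i=1..m. falling (\<alpha> i) (\<beta> i) / fact (\<alpha> i)) = 0"
      by (intro prod_zero) (auto simp: falling_def intro!: bexI[of _ i])
    with False show ?thesis by auto
  qed
  then have "(\<Sum>\<alpha>\<in>multi_indices m n. (\<Prod>i=1..m. falling (\<alpha> i) (\<beta> i) / fact (\<alpha> i)) * monomial m \<alpha> y)
      = (\<Sum>\<alpha>\<in>multi_indices m n. if \<alpha> = \<beta> then monomial m \<beta> y else 0)"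
    by (intro sum.cong) auto
  then show ?case using \<beta> by simp
next
  case (Suc M)
  define W where "W \<alpha> = (\<Prod>i=1..m. falling (\<alpha> i) (\<beta> i) / fact (\<alpha> i))" for \<alpha>
  have pred: "(if \<alpha> i = 0 then 0 else W (\<alpha>(i := \<alpha> i - 1))) = (real (\<alpha> i) - real (\<beta> i)) * W \<alpha>"
    if i: "i \<in> {1..m}" for i \<alpha>
  proof -
    define Q where "Q = (\<Prod>j\<in>{1..m} - {i}. falling (\<alpha> j) (\<beta> j) / fact (\<alpha> j))"
    have W: "W \<alpha> = falling (\<alpha> i) (\<beta> i) / fact (\<alpha> i) * Q"
      unfolding W_def Q_def using i by (intro prod.remove) auto
    have "(\<Prod>j\<in>{1..m} - {i}. falling ((\<alpha>(i := \<alpha> i - 1)) j) (\<beta> j) / fact ((\<alpha>(i := \<alpha> i - 1)) j)) = Q"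
      unfolding Q_def by (intro prod.cong) auto
    then have W': "W (\<alpha>(i := \<alpha> i - 1)) = falling (\<alpha> i - 1) (\<beta> i) / fact (\<alpha> i - 1) * Q"
      unfolding W_def using i by (subst prod.remove[of _ i]) auto
    have "(if \<alpha> i = 0 then 0 else W (\<alpha>(i := \<alpha> i - 1)))
        = (if \<alpha> i = 0 then 0 else falling (\<alpha> i - 1) (\<beta> i) / fact (\<alpha> i - 1)) * Q"
      unfolding W' by simp
    then show ?thesis unfolding falling_fact_pred W by simp
  qed
  have "(\<Sum>i=1..m. y i) ^ Suc M * monomial m \<beta> y
      = (\<Sum>i=1..m. y i * (\<Sum>\<alpha>\<in>multi_indices m (n + M). (fact M * W \<alpha>) * monomial m \<alpha> y))"
    by (simp only: power_Suc mult.assoc Suc W_def sum_distrib_right)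
  also have "\<dots> = (\<Sum>i=1..m. \<Sum>\<alpha>\<in>multi_indices m (Suc (n + M)).
      fact M * ((real (\<alpha> i) - real (\<beta> i)) * W \<alpha>) * monomial m \<alpha> y)"
  proof (rule sum.cong)
    fix i assume i: "i \<in> {1..m}"
    show "y i * (\<Sum>\<alpha>\<in>multi_indices m (n + M). (fact M * W \<alpha>) * monomial m \<alpha> y)
      = (\<Sum>\<alpha>\<in>multi_indices m (Suc (n + M)). fact M * ((real (\<alpha> i) - real (\<beta> i)) * W \<alpha>) * monomial m \<alpha> y)"
      by (rule trans[OF coord_mult_monomial_sum[OF i]], unfold pred[OF i, symmetric], intro sum.cong) auto
  qed simp
  also have "\<dots> = (\<Sum>\<alpha>\<in>multi_indices m (Suc (n + M)).
      fact M * ((\<Sum>i=1..m. real (\<alpha> i) - real (\<beta> i)) * W \<alpha>) * monomial m \<alpha> y)"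
    by (subst sum.swap) (simp add: sum_distrib_left sum_distrib_right)
  also have "\<dots> = (\<Sum>\<alpha>\<in>multi_indices m (n + Suc M). (fact (Suc M) * W \<alpha>) * monomial m \<alpha> y)"
  proof (rule sum.cong)
    fix \<alpha> assume "\<alpha> \<in> multi_indices m (n + Suc M)"
    then have "real (\<Sum>i=1..m. \<alpha> i) = real (n + Suc M)" "real (\<Sum>i=1..m. \<beta> i) = real n"
      using \<beta> by (simp_all add: multi_indices_def)
    then have "(\<Sum>i=1..m. real (\<alpha> i) - real (\<beta> i)) = real (Suc M)"
      by (simp add: sum_subtractf)
    then show "fact M * ((\<Sum>i=1..m. real (\<alpha> i) - real (\<beta> i)) * W \<alpha>) * monomial m \<alpha> y
        = (fact (Suc M) * W \<alpha>) * monomial m \<alpha> y" by simp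
  qed simp
  finally show ?case by (simp only: W_def)
qed

section \<open>Hahn polynomials\<close>

lemma simplex_jacobi_at1_pos:
  assumes "\<forall>i\<in>{1..d+1}. -1 < \<kappa> i"
  shows "simplex_jacobi_at1 d \<kappa> \<nu> > 0"
  unfolding simplex_jacobi_at1_eq
proof (rule prod_pos)
  fix j assume "j \<in> {1..d}"
  then have "jacobi_param d \<kappa> \<nu> j + 1 > 0" using jacobi_param_gt[OF assms, of j \<nu>] by simp
  then show "0 < pochhammer (jacobi_param d \<kappa> \<nu> j + 1) (\<nu> j) / fact (\<nu> j)"
    by (simp add: pochhammer_pos)
qed

lemma simplex_jacobi_hom_coeffs:
  assumes "\<nu> \<in> multi_indices d n"
  obtains q where "\<And>y. simplex_jacobi_hom d \<kappa> \<nu> y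
    = (\<Sum>\<beta>\<in>multi_indices (Suc d) n. q \<beta> * monomial (Suc d) \<beta> y)"
  using homogeneous_simplex_jacobi_hom[of d \<nu> \<kappa>] assms
  unfolding homogeneous_def by (auto simp: multi_indices_def)

text \<open>
  Multiplying the homogenised Jacobi polynomial by \<open>|y|\<^sup>N\<^sup>-\<^sup>n\<close> clears the denominators of the generating
  function. The coefficients are read off from the multinomial theorem; they are unique because a
  polynomial is determined by its values on the positive orthant.
\<close>

lemma hahn_explicit:
  assumes \<nu>: "\<nu> \<in> multi_indices d n" and n: "n \<le> N"
    and q: "\<And>y. simplex_jacobi_hom d \<kappa> \<nu> y = (\<Sum>\<beta>\<in>multi_indices (Suc d) n. q \<beta> * monomial (Suc d) \<beta> y)"
  defines "H \<equiv> \<lambda>\<alpha>. if \<alpha> \<in> multi_indices (d + 1) N then fact (N - n) / (fact N * simplex_jacobi_at1 d \<kappa> \<nu>)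
     * (\<Sum>\<beta>\<in>multi_indices (Suc d) n. q \<beta> * (\<Prod>i=1..d+1. falling (\<alpha> i) (\<beta> i))) else 0"
  shows "hahn d \<kappa> N \<nu> = H"
    and "(\<Sum>i=1..d+1. y i) ^ (N - n) * simplex_jacobi_hom d \<kappa> \<nu> y / simplex_jacobi_at1 d \<kappa> \<nu>
      = (\<Sum>\<alpha>\<in>multi_indices (d + 1) N. fact N / (\<Prod>i=1..d+1. fact (\<alpha> i)) * H \<alpha> * monomial (d + 1) \<alpha> y)"
proof -
  define p where "p = simplex_jacobi_at1 d \<kappa> \<nu>"
  let ?m = "d + 1"
  have \<nu>sum: "(\<Sum>j=1..d. \<nu> j) = n" using \<nu> by (simp add: multi_indices_def)
  have gen: "(\<Sum>i=1..d+1. y i) ^ (N - n) * simplex_jacobi_hom d \<kappa> \<nu> y / p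
      = (\<Sum>\<alpha>\<in>multi_indices ?m N. fact N / (\<Prod>i=1..?m. fact (\<alpha> i)) * H \<alpha> * monomial ?m \<alpha> y)" for y
  proof -
    have "(\<Sum>i=1..d+1. y i) ^ (N - n) * simplex_jacobi_hom d \<kappa> \<nu> y / p
       = (\<Sum>\<beta>\<in>multi_indices ?m n. q \<beta> / p * ((\<Sum>i=1..?m. y i) ^ (N - n) * monomial ?m \<beta> y))"
      unfolding q sum_distrib_left sum_divide_distrib
      by (intro sum.cong) (simp_all add: mult_ac)
    also have "\<dots> = (\<Sum>\<beta>\<in>multi_indices ?m n. q \<beta> / p * (\<Sum>\<alpha>\<in>multi_indices ?m N. (fact (N - n) *
        (\<Prod>i=1..?m. falling (\<alpha> i) (\<beta> i) / fact (\<alpha> i))) * monomial ?m \<alpha> y))"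
      using n by (intro sum.cong refl) (simp only: sum_power_mult_monomial le_add_diff_inverse)
    also have "\<dots> = (\<Sum>\<alpha>\<in>multi_indices ?m N. \<Sum>\<beta>\<in>multi_indices ?m n. q \<beta> / p * ((fact (N - n) *
        (\<Prod>i=1..?m. falling (\<alpha> i) (\<beta> i) / fact (\<alpha> i))) * monomial ?m \<alpha> y))"
      unfolding sum_distrib_left by (rule sum.swap)
    also have "\<dots> = (\<Sum>\<alpha>\<in>multi_indices ?m N. fact N / (\<Prod>i=1..?m. fact (\<alpha> i)) * H \<alpha> * monomial ?m \<alpha> y)"
    proof (rule sum.cong)
      fix \<alpha> assume "\<alpha> \<in> multi_indices ?m N"
      then have "fact N / (\<Prod>i=1..?m. fact (\<alpha> i)) * H \<alpha> * monomial ?m \<alpha> y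
          = fact (N - n) / ((\<Prod>i=1..?m. fact (\<alpha> i)) * p) * (\<Sum>\<beta>\<in>multi_indices ?m n. q \<beta> *
             (\<Prod>i=1..?m. falling (\<alpha> i) (\<beta> i))) * monomial ?m \<alpha> y"
        by (simp add: H_def p_def)
      also have "\<dots> = (\<Sum>\<beta>\<in>multi_indices ?m n. fact (N - n) / ((\<Prod>i=1..?m. fact (\<alpha> i)) * p) * (q \<beta> *
             (\<Prod>i=1..?m. falling (\<alpha> i) (\<beta> i))) * monomial ?m \<alpha> y)"
        by (simp only: sum_distrib_left sum_distrib_right)
      also have "\<dots> = (\<Sum>\<beta>\<in>multi_indices ?m n. q \<beta> / p * ((fact (N - n) *
        (\<Prod>i=1..?m. falling (\<alpha> i) (\<beta> i) / fact (\<alpha> i))) * monomial ?m \<alpha> y))"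
        by (simp only: prod_dividef times_divide_eq_left times_divide_eq_right divide_divide_eq_left mult_ac)
      finally show "(\<Sum>\<beta>\<in>multi_indices ?m n. q \<beta> / p * ((fact (N - n) *
        (\<Prod>i=1..?m. falling (\<alpha> i) (\<beta> i) / fact (\<alpha> i))) * monomial ?m \<alpha> y))
          = fact N / (\<Prod>i=1..?m. fact (\<alpha> i)) * H \<alpha> * monomial ?m \<alpha> y" by (rule sym)
    qed simp
    finally show ?thesis .
  qed
  then show "(\<Sum>i=1..d+1. y i) ^ (N - n) * simplex_jacobi_hom d \<kappa> \<nu> y / simplex_jacobi_at1 d \<kappa> \<nu>
      = (\<Sum>\<alpha>\<in>multi_indices (d + 1) N. fact N / (\<Prod>i=1..d+1. fact (\<alpha> i)) * H \<alpha> * monomial (d + 1) \<alpha> y)"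
    by (simp only: p_def)
  have scale: "s ^ N * (simplex_jacobi d \<kappa> \<nu> (\<lambda>i. y i / s) / p) = s ^ (N - n) * simplex_jacobi_hom d \<kappa> \<nu> y / p"
    if "s = (\<Sum>i=1..d+1. y i)" "s \<noteq> 0" for s and y :: "nat \<Rightarrow> real"
  proof -
    have "s ^ N = s ^ (N - n) * s ^ n" using n by (simp flip: power_add)
    then show ?thesis
      using simplex_jacobi_scale[OF that, of \<nu> \<kappa>] unfolding \<nu>sum by (simp only: mult.assoc times_divide_eq_right)
  qed
  show "hahn d \<kappa> N \<nu> = H"
    unfolding hahn_def Let_def
  proof (rule the_equality, goal_cases)
    case 1
    show ?case
      using gen scale by (auto simp: H_def monomial_def p_def)
  next
    case (2 G)
    show "G = H"
    proof
      fix \<alpha>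
      show "G \<alpha> = H \<alpha>"
      proof (cases "\<alpha> \<in> multi_indices ?m N")
        case True
        have "fact N / (\<Prod>i=1..?m. fact (\<alpha> i)) * G \<alpha> = fact N / (\<Prod>i=1..?m. fact (\<alpha> i)) * H \<alpha>"
        proof (rule monomial_coeff_unique[OF _ True])
          fix y :: "nat \<Rightarrow> real" assume y: "\<And>i. y i > 0"
          have "(\<Sum>i=1..?m. y i) > 0" by (rule sum_pos) (use y in auto)
          then have s: "(\<Sum>i=1..?m. y i) \<noteq> 0" by linarith
          have "(\<Sum>i=1..?m. y i) ^ N * (simplex_jacobi d \<kappa> \<nu> (\<lambda>j. y j / (\<Sum>i=1..?m. y i)) / p)
              = (\<Sum>\<alpha>\<in>multi_indices ?m N. fact N / (\<Prod>i=1..?m. fact (\<alpha> i)) * G \<alpha> * monomial ?m \<alpha> y)"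
            using 2 s unfolding monomial_def p_def by blast
          note this[symmetric]
          also have "(\<Sum>i=1..?m. y i) ^ N * (simplex_jacobi d \<kappa> \<nu> (\<lambda>j. y j / (\<Sum>i=1..?m. y i)) / p) = (\<Sum>\<alpha>\<in>multi_indices ?m N. fact N / (\<Prod>i=1..?m. fact (\<alpha> i)) * H \<alpha> * monomial ?m \<alpha> y)"
            using scale[OF refl s] gen[of y] by (simp only:)
          finally show "(\<Sum>\<alpha>\<in>multi_indices ?m N. fact N / (\<Prod>i=1..?m. fact (\<alpha> i)) * G \<alpha> * monomial ?m \<alpha> y)
              = (\<Sum>\<alpha>\<in>multi_indices ?m N. fact N / (\<Prod>i=1..?m. fact (\<alpha> i)) * H \<alpha> * monomial ?m \<alpha> y)" .
        qed
        moreover have "fact N / (\<Prod>i=1..?m. fact (\<alpha> i)) \<noteq> (0::real)" by (simp add: prod_zero_iff)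
        ultimately show ?thesis using mult_cancel_left by blast
      next
        case False
        then show ?thesis using 2 by (simp add: H_def)
      qed
    qed
  qed
qed

lemma hahn_generating:
  assumes "\<nu> \<in> multi_indices d n" "n \<le> N"
  shows "(\<Sum>i=1..d+1. y i) ^ (N - n) * simplex_jacobi_hom d \<kappa> \<nu> y / simplex_jacobi_at1 d \<kappa> \<nu>
      = (\<Sum>\<alpha>\<in>multi_indices (d + 1) N. fact N / (\<Prod>i=1..d+1. fact (\<alpha> i)) * hahn d \<kappa> N \<nu> \<alpha> * monomial (d + 1) \<alpha> y)"
proof -
  obtain q where "\<And>y. simplex_jacobi_hom d \<kappa> \<nu> y = (\<Sum>\<beta>\<in>multi_indices (Suc d) n. q \<beta> * monomial (Suc d) \<beta> y)"
    using simplex_jacobi_hom_coeffs[OF assms(1), of \<kappa>] by blast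
  note explicit = hahn_explicit[OF assms this]
  show ?thesis unfolding explicit(1) by (rule explicit(2))
qed

text \<open>
  As functions of \<open>\<alpha>\<close> these are polynomials with the same top-degree part as the product of the falling
  factorials of the \<open>\<alpha>\<^sub>i\<close>. They appear because the Dirichlet moment of \<open>y\<^sup>\<alpha>\<^sup>+\<^sup>\<beta>\<close> is that of \<open>y\<^sup>\<alpha>\<close> times a value of
  such a product, up to a constant.
\<close>

definition rising_product :: "nat \<Rightarrow> (nat \<Rightarrow> real) \<Rightarrow> (nat \<Rightarrow> nat) \<Rightarrow> (nat \<Rightarrow> nat) \<Rightarrow> real" where
  "rising_product d \<kappa> \<beta> \<alpha> = (\<Prod>i=1..d+1. pochhammer (\<kappa> i + 1 + real (\<alpha> i)) (\<beta> i))"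

lemma hahn_inner_sum_right:
  "hahn_inner d \<kappa> N f (\<lambda>\<alpha>. \<Sum>i\<in>A. c i * g i \<alpha>) = (\<Sum>i\<in>A. c i * hahn_inner d \<kappa> N f (g i))"
  unfolding hahn_inner_def
  by (simp add: sum_distrib_left sum_distrib_right sum_divide_distrib sum.swap[of _ A] mult_ac)

lemma hahn_inner_cong_right:
  assumes "\<And>\<alpha>. \<alpha> \<in> multi_indices (d + 1) N \<Longrightarrow> g \<alpha> = h \<alpha>"
  shows "hahn_inner d \<kappa> N f g = hahn_inner d \<kappa> N f h"
  using assms by (simp add: hahn_inner_def)

text \<open>
  Integrating the generating function against \<open>y\<^sup>\<beta>\<close> term by term turns the Jacobi inner product into the
  Hahn inner product.
\<close>

lemma simplex_mean_jacobi_monomial: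
  assumes d: "1 \<le> d" and \<kappa>: "\<forall>i\<in>{1..d+1}. -1 < \<kappa> i"
    and \<nu>: "\<nu> \<in> multi_indices d n" and n: "n \<le> N"
  defines "S \<equiv> (\<Sum>i=1..d+1. \<kappa> i) + real d + 1"
  shows "simplex_mean d \<kappa> (\<lambda>x. simplex_jacobi d \<kappa> \<nu> x * monomial (Suc d) \<beta> (barycentric d x))
    = simplex_jacobi_at1 d \<kappa> \<nu> * pochhammer S N / pochhammer S (N + (\<Sum>i=1..d+1. \<beta> i))
      * hahn_inner d \<kappa> N (hahn d \<kappa> N \<nu>) (rising_product d \<kappa> \<beta>)"
proof -
  define p where "p = simplex_jacobi_at1 d \<kappa> \<nu>"
  define H where "H = hahn d \<kappa> N \<nu>"
  define b where "b = (\<Sum>i=1..d+1. \<beta> i)"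
  have p: "p \<noteq> 0" using simplex_jacobi_at1_pos[OF \<kappa>, of \<nu>] by (simp add: p_def)
  have Spos: "S > 0" unfolding S_def by (rule total_weight_pos[OF \<kappa>])
  have expand: "simplex_jacobi d \<kappa> \<nu> x * monomial (Suc d) \<beta> (barycentric d x)
      = (\<Sum>\<alpha>\<in>multi_indices (d+1) N. p * (fact N / (\<Prod>i=1..d+1. fact (\<alpha> i)) * H \<alpha>)
          * monomial (Suc d) (\<lambda>i. \<alpha> i + \<beta> i) (barycentric d x))" for x
  proof -
    have s: "(\<Sum>i=1..d+1. barycentric d x i) = 1" using barycentric_sum[of d x] by simp
    have "simplex_jacobi d \<kappa> \<nu> x = p *
        (\<Sum>\<alpha>\<in>multi_indices (d+1) N. fact N / (\<Prod>i=1..d+1. fact (\<alpha> i)) * H \<alpha> * monomial (d+1) \<alpha> (barycentric d x))"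
      using p unfolding H_def hahn_generating[OF \<nu> n, symmetric] s
      by (simp add: p_def simplex_jacobi_homogeneous_coords)
    then have "simplex_jacobi d \<kappa> \<nu> x * monomial (Suc d) \<beta> (barycentric d x)
        = (\<Sum>\<alpha>\<in>multi_indices (d+1) N. p * (fact N / (\<Prod>i=1..d+1. fact (\<alpha> i)) * H \<alpha> * monomial (d+1) \<alpha> (barycentric d x))
           * monomial (Suc d) \<beta> (barycentric d x))"
      by (simp only: sum_distrib_left sum_distrib_right)
    also have "\<dots> = (\<Sum>\<alpha>\<in>multi_indices (d+1) N. p * (fact N / (\<Prod>i=1..d+1. fact (\<alpha> i)) * H \<alpha>)
          * monomial (Suc d) (\<lambda>i. \<alpha> i + \<beta> i) (barycentric d x))"
      by (simp only: monomial_def power_add prod.distrib mult.assoc Suc_eq_plus1)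
    finally show ?thesis .
  qed
  have "simplex_mean d \<kappa> (\<lambda>x. simplex_jacobi d \<kappa> \<nu> x * monomial (Suc d) \<beta> (barycentric d x))
      = (\<Sum>\<alpha>\<in>multi_indices (d+1) N. p * (fact N / (\<Prod>i=1..d+1. fact (\<alpha> i)) * H \<alpha>)
          * simplex_mean d \<kappa> (\<lambda>x. monomial (Suc d) (\<lambda>i. \<alpha> i + \<beta> i) (barycentric d x)))"
    unfolding expand by (intro simplex_mean_sum simplex_mean_monomial d \<kappa>)
  also have "\<dots> = (\<Sum>\<alpha>\<in>multi_indices (d+1) N. p * fact N / pochhammer S (N + b)
      * (H \<alpha> * rising_product d \<kappa> \<beta> \<alpha> * hahn_weight d \<kappa> \<alpha>))"
  proof (rule sum.cong)
    fix \<alpha> assume "\<alpha> \<in> multi_indices (d+1) N"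
    then have "(\<Sum>i=1..d+1. \<alpha> i + \<beta> i) = N + b"
      by (simp add: multi_indices_def b_def sum.distrib)
    then have "simplex_mean d \<kappa> (\<lambda>x. monomial (Suc d) (\<lambda>i. \<alpha> i + \<beta> i) (barycentric d x))
        = (\<Prod>i=1..d+1. pochhammer (\<kappa> i + 1) (\<alpha> i)) * rising_product d \<kappa> \<beta> \<alpha> / pochhammer S (N + b)"
      unfolding simplex_mean_monomial(2)[OF d \<kappa>] S_def
      by (simp only: rising_product_def pochhammer_product' prod.distrib)
    then show "p * (fact N / (\<Prod>i=1..d+1. fact (\<alpha> i)) * H \<alpha>)
          * simplex_mean d \<kappa> (\<lambda>x. monomial (Suc d) (\<lambda>i. \<alpha> i + \<beta> i) (barycentric d x))
        = p * fact N / pochhammer S (N + b) * (H \<alpha> * rising_product d \<kappa> \<beta> \<alpha> * hahn_weight d \<kappa> \<alpha>)"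
      by (simp only: hahn_weight_def times_divide_eq_left times_divide_eq_right divide_divide_eq_left mult_ac)
  qed simp
  also have "\<dots> = p * pochhammer S N / pochhammer S (N + b) * hahn_inner d \<kappa> N H (rising_product d \<kappa> \<beta>)"
    using pochhammer_pos[OF Spos, of N] unfolding hahn_inner_def S_def[symmetric] sum_distrib_left[symmetric] by simp
  finally show ?thesis by (simp only: p_def H_def b_def)
qed

text \<open>
  Both families are monic in \<open>a\<close> with one polynomial in each degree; the recursion comes from writing
  \<open>a - b\<close> as \<open>(x + a + k) - (x + b + k)\<close>.
\<close>

lemma falling_rising_expansion:
  "\<exists>e. e b = 1 \<and> (\<forall>a. falling a b = (\<Sum>k\<le>b. e k * pochhammer (x + real a) k))"
proof (induction b)
  case 0
  then show ?case by (intro exI[of _ "\<lambda>_. 1"]) (simp add: falling_def)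
next
  case (Suc b)
  then obtain e where e: "e b = 1" "\<And>a. falling a b = (\<Sum>k\<le>b. e k * pochhammer (x + real a) k)" by blast
  define e' where "e' k = (if k = 0 then 0 else e (k - 1))
      - (if k \<le> b then e k * (x + real b + real k) else 0)" for k
  have "falling a (Suc b) = (\<Sum>k\<le>Suc b. e' k * pochhammer (x + real a) k)" for a
  proof -
    let ?P = "pochhammer (x + real a)"
    have "falling a (Suc b) = (\<Sum>k\<le>b. e k * ((real a - real b) * ?P k))"
      unfolding falling_Suc e(2) sum_distrib_left by (simp add: mult_ac)
    also have "\<dots> = (\<Sum>k\<le>b. e k * ?P (Suc k)) - (\<Sum>k\<le>b. e k * (x + real b + real k) * ?P k)"
      unfolding sum_subtractf[symmetric]
      by (intro sum.cong refl) (simp add: pochhammer_Suc algebra_simps)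
    also have "(\<Sum>k\<le>b. e k * ?P (Suc k)) = (\<Sum>k\<le>Suc b. (if k = 0 then 0 else e (k - 1)) * ?P k)"
      by (subst sum.atMost_Suc_shift) simp
    also have "(\<Sum>k\<le>b. e k * (x + real b + real k) * ?P k)
        = (\<Sum>k\<le>Suc b. (if k \<le> b then e k * (x + real b + real k) else 0) * ?P k)"
      by simp
    finally show ?thesis by (simp only: e'_def sum_subtractf left_diff_distrib)
  qed
  moreover have "e' (Suc b) = 1" by (simp add: e'_def e)
  ultimately show ?case by blast
qed

text \<open>
  The product of falling factorials and the rising product differ by rising products of degree below \<open>n\<close>.
  Against a Hahn polynomial of degree \<open>n\<close> these give 0, being means of the Jacobi polynomial against
  monomials of lower degree.
\<close>

lemma hahn_inner_falling:
  assumes d: "1 \<le> d" and \<kappa>: "\<forall>i\<in>{1..d+1}. -1 < \<kappa> i"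
    and \<nu>: "\<nu> \<in> multi_indices d n" and n: "n \<le> N" and \<beta>: "\<beta> \<in> multi_indices (d + 1) n"
  shows "hahn_inner d \<kappa> N (hahn d \<kappa> N \<nu>) (\<lambda>\<alpha>. \<Prod>i=1..d+1. falling (\<alpha> i) (\<beta> i))
    = hahn_inner d \<kappa> N (hahn d \<kappa> N \<nu>) (rising_product d \<kappa> \<beta>)"
proof -
  let ?L = "hahn_inner d \<kappa> N (hahn d \<kappa> N \<nu>)"
  have "\<exists>e. \<forall>i. e i (\<beta> i) = 1 \<and>
      (\<forall>a. falling a (\<beta> i) = (\<Sum>k\<le>\<beta> i. e i k * pochhammer (\<kappa> i + 1 + real a) k))"
    by (intro choice allI falling_rising_expansion)
  then obtain e where e: "\<And>i. e i (\<beta> i) = 1"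
    "\<And>i a. falling a (\<beta> i) = (\<Sum>k\<le>\<beta> i. e i k * pochhammer (\<kappa> i + 1 + real a) k)" by blast
  define K where "K = PiE {1..d+1} (\<lambda>i. {..\<beta> i})"
  have finK: "finite K" by (simp add: K_def finite_PiE)
  define k0 where "k0 = restrict \<beta> {1..d+1}"
  have k0: "k0 \<in> K" by (simp add: K_def k0_def)
  have lower: "?L (rising_product d \<kappa> k) = 0" if k: "k \<in> K - {k0}" for k
  proof -
    have le: "k i \<le> \<beta> i" if "i \<in> {1..d+1}" for i using k that by (auto simp: K_def PiE_def Pi_def)
    have "\<exists>i\<in>{1..d+1}. k i \<noteq> \<beta> i"
    proof (rule ccontr)
      assume "\<not> ?thesis"
      then have "restrict k {1..d+1} = k0" unfolding k0_def by (intro restrict_ext) blast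
      moreover have "restrict k {1..d+1} = k" using k unfolding K_def by (intro PiE_restrict) blast
      ultimately show False using k by simp
    qed
    then obtain i where "i \<in> {1..d+1}" "k i < \<beta> i" using le by (metis le_neq_implies_less)
    then have "(\<Sum>i=1..d+1. k i) < (\<Sum>i=1..d+1. \<beta> i)"
      using le by (intro sum_strict_mono_ex1) auto
    then have less: "(\<Sum>i=1..d+1. k i) < (\<Sum>i=1..d. \<nu> i)" using \<beta> \<nu> by (simp add: multi_indices_def)
    have "homogeneous (Suc d) (\<Sum>i=1..d+1. k i) (monomial (Suc d) k)"
      by (rule homogeneous_monomial) simp
    from simplex_jacobi_orthogonal_lower[OF d \<kappa> this less]
    have "simplex_jacobi_at1 d \<kappa> \<nu> * pochhammer ((\<Sum>i=1..d+1. \<kappa> i) + real d + 1) N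
        / pochhammer ((\<Sum>i=1..d+1. \<kappa> i) + real d + 1) (N + (\<Sum>i=1..d+1. k i)) * ?L (rising_product d \<kappa> k) = 0"
      by (simp only: simplex_mean_jacobi_monomial[OF d \<kappa> \<nu> n])
    moreover have "(\<Sum>i=1..d+1. \<kappa> i) + real d + 1 > 0" by (rule total_weight_pos[OF \<kappa>])
    then have "pochhammer ((\<Sum>i=1..d+1. \<kappa> i) + real d + 1) j \<noteq> 0" for j
      using pochhammer_pos[of "(\<Sum>i=1..d+1. \<kappa> i) + real d + 1" j] by linarith
    moreover have "simplex_jacobi_at1 d \<kappa> \<nu> \<noteq> 0"
      using simplex_jacobi_at1_pos[OF \<kappa>, of \<nu>] by linarith
    ultimately show ?thesis by (simp only: mult_eq_0_iff divide_eq_0_iff simp_thms)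
  qed
  have "(\<lambda>\<alpha>. \<Prod>i=1..d+1. falling (\<alpha> i) (\<beta> i))
      = (\<lambda>\<alpha>. \<Sum>k\<in>K. (\<Prod>i=1..d+1. e i (k i)) * rising_product d \<kappa> k \<alpha>)"
  proof
    fix \<alpha> :: "nat \<Rightarrow> nat"
    have "(\<Prod>i=1..d+1. falling (\<alpha> i) (\<beta> i))
        = (\<Sum>k\<in>K. \<Prod>i=1..d+1. e i (k i) * pochhammer (\<kappa> i + 1 + real (\<alpha> i)) (k i))"
      unfolding e(2) K_def by (rule prod_sum_PiE) auto
    then show "(\<Prod>i=1..d+1. falling (\<alpha> i) (\<beta> i)) = (\<Sum>k\<in>K. (\<Prod>i=1..d+1. e i (k i)) * rising_product d \<kappa> k \<alpha>)"
      by (simp only: prod.distrib rising_product_def)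
  qed
  then have "?L (\<lambda>\<alpha>. \<Prod>i=1..d+1. falling (\<alpha> i) (\<beta> i))
      = (\<Sum>k\<in>K. (\<Prod>i=1..d+1. e i (k i)) * ?L (rising_product d \<kappa> k))"
    by (simp only: hahn_inner_sum_right)
  also have "\<dots> = (\<Prod>i=1..d+1. e i (k0 i)) * ?L (rising_product d \<kappa> k0)
      + (\<Sum>k\<in>K - {k0}. (\<Prod>i=1..d+1. e i (k i)) * ?L (rising_product d \<kappa> k))"
    by (rule sum.remove[OF finK k0])
  also have "(\<Sum>k\<in>K - {k0}. (\<Prod>i=1..d+1. e i (k i)) * ?L (rising_product d \<kappa> k)) = 0"
    by (intro sum.neutral ballI) (simp only: lower mult_zero_right)
  also have "(\<Prod>i=1..d+1. e i (k0 i)) = 1"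
    by (intro prod.neutral) (simp add: k0_def e(1))
  also have "rising_product d \<kappa> k0 = rising_product d \<kappa> \<beta>"
    unfolding rising_product_def fun_eq_iff by (intro allI prod.cong) (simp_all add: k0_def)
  finally show ?thesis by simp
qed

text \<open>
  Write the homogenised Jacobi polynomial as \<open>\<Sum> q\<^sub>\<beta> y\<^sup>\<beta>\<close> with \<open>|\<beta>| = n\<close>. Its squared norm is the combination with
  coefficients \<open>q\<^sub>\<beta>\<close> of the Hahn inner products against rising products. The Hahn polynomial itself is, up to
  a factor, the same combination of falling products, which may be exchanged for the rising ones. The
  resulting factor between the two norms depends on \<open>\<kappa>\<close> only through \<open>|\<kappa>|\<close>, apart from the value \<open>p\<^sub>\<nu>\<close>.
\<close>

lemma hahn_norm_eq:
  assumes d: "1 \<le> d" and \<kappa>: "\<forall>i\<in>{1..d+1}. -1 < \<kappa> i"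
    and \<nu>: "\<nu> \<in> multi_indices d n" and n: "n \<le> N"
  defines "S \<equiv> (\<Sum>i=1..d+1. \<kappa> i) + real d + 1"
  shows "hahn_norm d \<kappa> N \<nu> = fact (N - n) * pochhammer S (N + n) / (fact N * pochhammer S N)
    * (simplex_norm d \<kappa> \<nu> / simplex_jacobi_at1 d \<kappa> \<nu> ^ 2)"
proof -
  define p where "p = simplex_jacobi_at1 d \<kappa> \<nu>"
  let ?L = "hahn_inner d \<kappa> N (hahn d \<kappa> N \<nu>)"
  have p: "p \<noteq> 0" using simplex_jacobi_at1_pos[OF \<kappa>, of \<nu>] by (simp add: p_def)
  have "S > 0" unfolding S_def by (rule total_weight_pos[OF \<kappa>])
  then have S: "pochhammer S j \<noteq> 0" for j using pochhammer_pos[of S j] by linarith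
  obtain q where q: "\<And>y. simplex_jacobi_hom d \<kappa> \<nu> y = (\<Sum>\<beta>\<in>multi_indices (Suc d) n. q \<beta> * monomial (Suc d) \<beta> y)"
    using simplex_jacobi_hom_coeffs[OF \<nu>, of \<kappa>] by blast
  define X where "X = (\<Sum>\<beta>\<in>multi_indices (Suc d) n. q \<beta> * ?L (rising_product d \<kappa> \<beta>))"
  have "simplex_norm d \<kappa> \<nu> = simplex_mean d \<kappa> (\<lambda>x. \<Sum>\<beta>\<in>multi_indices (Suc d) n.
      q \<beta> * (simplex_jacobi d \<kappa> \<nu> x * monomial (Suc d) \<beta> (barycentric d x)))"
    unfolding simplex_norm_def simplex_inner_eq_mean
    by (subst (2) simplex_jacobi_homogeneous_coords) (simp add: q sum_distrib_left mult_ac)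
  also have "\<dots> = (\<Sum>\<beta>\<in>multi_indices (Suc d) n.
      q \<beta> * simplex_mean d \<kappa> (\<lambda>x. simplex_jacobi d \<kappa> \<nu> x * monomial (Suc d) \<beta> (barycentric d x)))"
    unfolding simplex_jacobi_homogeneous_coords
    by (intro simplex_mean_sum
        homogeneous_integrable[OF d \<kappa> homogeneous_mult, OF homogeneous_simplex_jacobi_hom homogeneous_monomial[OF refl]])
  also have "\<dots> = (\<Sum>\<beta>\<in>multi_indices (Suc d) n.
      q \<beta> * (p * pochhammer S N / pochhammer S (N + n) * ?L (rising_product d \<kappa> \<beta>)))"
  proof (rule sum.cong)
    fix \<beta> assume "\<beta> \<in> multi_indices (Suc d) n"
    then have "(\<Sum>i=1..d+1. \<beta> i) = n" by (simp add: multi_indices_def)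
    then show "q \<beta> * simplex_mean d \<kappa> (\<lambda>x. simplex_jacobi d \<kappa> \<nu> x * monomial (Suc d) \<beta> (barycentric d x))
        = q \<beta> * (p * pochhammer S N / pochhammer S (N + n) * ?L (rising_product d \<kappa> \<beta>))"
      unfolding simplex_mean_jacobi_monomial[OF d \<kappa> \<nu> n] by (simp only: p_def S_def)
  qed simp
  also have "\<dots> = p * pochhammer S N / pochhammer S (N + n) * X"
    by (simp add: X_def sum_distrib_left sum_divide_distrib mult_ac)
  finally have A: "simplex_norm d \<kappa> \<nu> = p * pochhammer S N / pochhammer S (N + n) * X" .
  have "hahn_norm d \<kappa> N \<nu> = ?L (\<lambda>\<alpha>. \<Sum>\<beta>\<in>multi_indices (Suc d) n. (fact (N - n) / (fact N * p) * q \<beta>)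
      * (\<Prod>i=1..d+1. falling (\<alpha> i) (\<beta> i)))"
    unfolding hahn_norm_def
  proof (rule hahn_inner_cong_right)
    fix \<alpha> assume "\<alpha> \<in> multi_indices (d + 1) N"
    then show "hahn d \<kappa> N \<nu> \<alpha> = (\<Sum>\<beta>\<in>multi_indices (Suc d) n. (fact (N - n) / (fact N * p) * q \<beta>)
      * (\<Prod>i=1..d+1. falling (\<alpha> i) (\<beta> i)))"
      unfolding hahn_explicit(1)[OF \<nu> n q] p_def[symmetric]
      by (simp only: if_True sum_distrib_left mult.assoc)
  qed
  also have "\<dots> = (\<Sum>\<beta>\<in>multi_indices (Suc d) n. (fact (N - n) / (fact N * p) * q \<beta>)
      * ?L (rising_product d \<kappa> \<beta>))"
    unfolding hahn_inner_sum_right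
    by (intro sum.cong refl) (simp only: hahn_inner_falling[OF d \<kappa> \<nu> n] Suc_eq_plus1)
  also have "\<dots> = fact (N - n) / (fact N * p) * X"
    by (simp only: X_def sum_distrib_left mult.assoc)
  finally show ?thesis
    unfolding A p_def[symmetric] using p S by (simp add: power2_eq_square)
qed

section \<open>Comparison of the connection coefficients\<close>

lemma hahn_permuted_generating:
  assumes \<tau>: "\<tau> permutes {1..d+1}" and \<nu>: "\<nu> \<in> multi_indices d n" and n: "n \<le> N"
  shows "(\<Sum>\<alpha>\<in>multi_indices (d + 1) N. fact N / (\<Prod>i=1..d+1. fact (\<alpha> i)) * hahn d \<kappa> N \<nu> (\<alpha> \<circ> \<tau>) * monomial (d + 1) \<alpha> y)
    = (\<Sum>i=1..d+1. y i) ^ (N - n) * simplex_jacobi_hom d \<kappa> \<nu> (y \<circ> \<tau>) / simplex_jacobi_at1 d \<kappa> \<nu>"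
proof -
  have perm: "\<alpha> \<circ> \<sigma> \<in> multi_indices (d + 1) N" if "\<alpha> \<in> multi_indices (d + 1) N" "\<sigma> permutes {1..d+1}" for \<alpha> \<sigma>
  proof -
    have "(\<Sum>i=1..d+1. (\<alpha> \<circ> \<sigma>) i) = (\<Sum>i=1..d+1. \<alpha> i)" by (rule sum.permute[OF that(2), symmetric])
    moreover have "(\<alpha> \<circ> \<sigma>) i = 0" if "i \<notin> {1..d+1}" for i
    proof -
      have "\<sigma> i \<notin> {1..d+1}" using permutes_in_image[OF \<open>\<sigma> permutes {1..d+1}\<close>, of i] that by simp
      then show ?thesis using \<open>\<alpha> \<in> multi_indices (d + 1) N\<close> unfolding multi_indices_def by simp
    qed
    ultimately show ?thesis using that(1) unfolding multi_indices_def by simp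
  qed
  have "(\<Sum>i=1..d+1. y i) = (\<Sum>i=1..d+1. (y \<circ> \<tau>) i)" by (rule sum.permute[OF \<tau>])
  then have "(\<Sum>i=1..d+1. y i) ^ (N - n) * simplex_jacobi_hom d \<kappa> \<nu> (y \<circ> \<tau>) / simplex_jacobi_at1 d \<kappa> \<nu>
      = (\<Sum>\<alpha>\<in>multi_indices (d + 1) N. fact N / (\<Prod>i=1..d+1. fact (\<alpha> i)) * hahn d \<kappa> N \<nu> \<alpha> * monomial (d + 1) \<alpha> (y \<circ> \<tau>))"
    by (simp only: hahn_generating[OF \<nu> n])
  also have "\<dots> = (\<Sum>\<alpha>\<in>multi_indices (d + 1) N. fact N / (\<Prod>i=1..d+1. fact (\<alpha> i)) * hahn d \<kappa> N \<nu> (\<alpha> \<circ> \<tau>) * monomial (d + 1) \<alpha> y)"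
  proof (rule sum.reindex_bij_witness[where i = "\<lambda>\<alpha>. \<alpha> \<circ> \<tau>" and j = "\<lambda>\<alpha>. \<alpha> \<circ> inv \<tau>"])
    fix \<alpha> assume \<alpha>: "\<alpha> \<in> multi_indices (d + 1) N"
    show "\<alpha> \<circ> \<tau> \<in> multi_indices (d + 1) N" by (rule perm[OF \<alpha> \<tau>])
    show "\<alpha> \<circ> inv \<tau> \<in> multi_indices (d + 1) N" by (rule perm[OF \<alpha> permutes_inv[OF \<tau>]])
    show "\<alpha> \<circ> \<tau> \<circ> inv \<tau> = \<alpha>" by (simp add: o_assoc[symmetric] permutes_inv_o[OF \<tau>])
    have inv: "\<alpha> \<circ> inv \<tau> \<circ> \<tau> = \<alpha>" by (simp add: o_assoc[symmetric] permutes_inv_o[OF \<tau>])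
    then show "\<alpha> \<circ> inv \<tau> \<circ> \<tau> = \<alpha>" .
    have "(\<Prod>i=1..d+1. fact ((\<alpha> \<circ> inv \<tau>) i)) = (\<Prod>i=1..d+1. fact (\<alpha> i) :: real)"
      using prod.permute[OF permutes_inv[OF \<tau>], of "\<lambda>i. fact (\<alpha> i) :: real"] by (simp add: o_def)
    then show "fact N / (\<Prod>i=1..d+1. fact ((\<alpha> \<circ> inv \<tau>) i)) * hahn d \<kappa> N \<nu> (\<alpha> \<circ> inv \<tau> \<circ> \<tau>) * monomial (d + 1) (\<alpha> \<circ> inv \<tau>) y
        = fact N / (\<Prod>i=1..d+1. fact (\<alpha> i)) * hahn d \<kappa> N \<nu> \<alpha> * monomial (d + 1) \<alpha> (y \<circ> \<tau>)"
      by (simp only: inv monomial_permute[OF \<tau>])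
  qed
  finally show ?thesis by (rule sym)
qed

lemma simplex_conn_expansion:
  assumes d: "1 \<le> d" and \<kappa>: "\<forall>i\<in>{1..d+1}. -1 < \<kappa> i"
    and \<tau>: "\<tau> permutes {1..d+1}" and \<nu>: "\<nu> \<in> multi_indices d n"
  shows "simplex_jacobi d (\<kappa> \<circ> \<tau>) \<nu> (simplex_perm d \<tau> x)
      = (\<Sum>\<mu>\<in>multi_indices d n. simplex_conn d \<kappa> \<tau> \<nu> \<mu> * simplex_jacobi d \<kappa> \<mu> x)"
    and "\<mu> \<notin> multi_indices d n \<Longrightarrow> simplex_conn d \<kappa> \<tau> \<nu> \<mu> = 0"
proof -
  obtain c where c: "\<And>\<mu>. \<mu> \<notin> multi_indices d n \<Longrightarrow> c \<mu> = 0"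
    and eq: "\<And>x. simplex_jacobi d (\<kappa> \<circ> \<tau>) \<nu> (simplex_perm d \<tau> x)
      = (\<Sum>\<mu>\<in>multi_indices d n. c \<mu> * simplex_jacobi d \<kappa> \<mu> x)"
    using simplex_jacobi_permuted_expansion[OF d \<kappa> \<tau> \<nu>] by blast
  have n: "(\<Sum>i=1..d. \<nu> i) = n" using \<nu> by (simp add: multi_indices_def)
  have "simplex_conn d \<kappa> \<tau> \<nu> = c"
    unfolding simplex_conn_def Let_def n
  proof (rule the_equality, goal_cases)
    case 1
    show ?case using c eq by blast
  next
    case (2 b)
    show "b = c"
    proof
      fix \<rho>
      show "b \<rho> = c \<rho>"
      proof (cases "\<rho> \<in> multi_indices d n")
        case True
        show ?thesis
        proof (rule simplex_jacobi_coeffs_unique[OF d \<kappa> _ True])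
          fix x assume "x \<in> std_simplex d"
          then have "simplex_jacobi d (\<kappa> \<circ> \<tau>) \<nu> (simplex_perm d \<tau> x)
              = (\<Sum>\<mu>\<in>multi_indices d n. b \<mu> * simplex_jacobi d \<kappa> \<mu> x)" using 2 by blast
          then show "(\<Sum>\<mu>\<in>multi_indices d n. b \<mu> * simplex_jacobi d \<kappa> \<mu> x)
              = (\<Sum>\<mu>\<in>multi_indices d n. c \<mu> * simplex_jacobi d \<kappa> \<mu> x)" by (simp only: eq)
        qed
      qed (use 2 c in simp)
    qed
  qed
  then show "simplex_jacobi d (\<kappa> \<circ> \<tau>) \<nu> (simplex_perm d \<tau> x)
      = (\<Sum>\<mu>\<in>multi_indices d n. simplex_conn d \<kappa> \<tau> \<nu> \<mu> * simplex_jacobi d \<kappa> \<mu> x)"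
    and "\<mu> \<notin> multi_indices d n \<Longrightarrow> simplex_conn d \<kappa> \<tau> \<nu> \<mu> = 0"
    using c eq by simp_all
qed

text \<open>
  The connection identity holds on the hyperplane \<open>|y| = 1\<close> and extends by homogeneity.
\<close>

lemma simplex_jacobi_hom_conn:
  assumes d: "1 \<le> d" and \<kappa>: "\<forall>i\<in>{1..d+1}. -1 < \<kappa> i"
    and \<tau>: "\<tau> permutes {1..d+1}" and \<nu>: "\<nu> \<in> multi_indices d n" and s: "(\<Sum>i=1..Suc d. y i) \<noteq> 0"
  shows "simplex_jacobi_hom d (\<kappa> \<circ> \<tau>) \<nu> (y \<circ> \<tau>)
      = (\<Sum>\<mu>\<in>multi_indices d n. simplex_conn d \<kappa> \<tau> \<nu> \<mu> * simplex_jacobi_hom d \<kappa> \<mu> y)"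
proof -
  define s where "s = (\<Sum>i=1..Suc d. y i)"
  define x where "x i = y i / s" for i
  have hom: "homogeneous (Suc d) n (simplex_jacobi_hom d \<kappa>' \<mu>)" if "\<mu> \<in> multi_indices d n" for \<kappa>' \<mu>
    using homogeneous_simplex_jacobi_hom[of d \<mu> \<kappa>'] that by (simp add: multi_indices_def)
  have "(\<Sum>i=1..d. y i) + y (Suc d) = s" by (simp add: s_def)
  then have "barycentric d x (Suc d) = x (Suc d)"
    using s unfolding s_def[symmetric]
    by (simp add: barycentric_def x_def sum_divide_distrib[symmetric] field_simps)
  then have lx: "barycentric d x = x" by (auto simp: barycentric_def)
  have y: "y = (\<lambda>i. s * x i)" using s by (auto simp: x_def s_def)
  have "simplex_jacobi_hom d (\<kappa> \<circ> \<tau>) \<nu> (y \<circ> \<tau>) = s ^ n * simplex_jacobi_hom d (\<kappa> \<circ> \<tau>) \<nu> (x \<circ> \<tau>)"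
    using homogeneous_scale[OF hom[OF \<nu>], of "\<kappa> \<circ> \<tau>" s "x \<circ> \<tau>"] by (simp add: y o_def)
  also have "simplex_jacobi_hom d (\<kappa> \<circ> \<tau>) \<nu> (x \<circ> \<tau>)
      = (\<Sum>\<mu>\<in>multi_indices d n. simplex_conn d \<kappa> \<tau> \<nu> \<mu> * simplex_jacobi_hom d \<kappa> \<mu> x)"
    using simplex_conn_expansion(1)[OF d \<kappa> \<tau> \<nu>, of x]
    unfolding simplex_jacobi_permuted[OF \<tau>] unfolding simplex_jacobi_homogeneous_coords lx .
  also have "s ^ n * \<dots> = (\<Sum>\<mu>\<in>multi_indices d n. simplex_conn d \<kappa> \<tau> \<nu> \<mu> * simplex_jacobi_hom d \<kappa> \<mu> y)"
    unfolding sum_distrib_left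
    by (intro sum.cong refl) (simp add: y homogeneous_scale[OF hom])
  finally show ?thesis .
qed

text \<open>
  An expansion of the permuted Hahn polynomial and one of the permuted Jacobi polynomial are the same
  statement about coefficients and about generating functions, up to the normalisations at 1. The
  generating function determines its coefficients, which gives existence; evaluating it at barycentric
  coordinates gives uniqueness.
\<close>

lemma hahn_conn_eq:
  assumes d: "1 \<le> d" and \<kappa>: "\<forall>i\<in>{1..d+1}. -1 < \<kappa> i"
    and \<tau>: "\<tau> permutes {1..d+1}" and \<nu>: "\<nu> \<in> multi_indices d n" and n: "n \<le> N"
  shows "hahn_conn d \<kappa> N \<tau> \<nu> \<mu>
    = simplex_jacobi_at1 d \<kappa> \<mu> / simplex_jacobi_at1 d (\<kappa> \<circ> \<tau>) \<nu> * simplex_conn d \<kappa> \<tau> \<nu> \<mu>"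
proof -
  let ?m = "d + 1"
  let ?F = "\<lambda>\<alpha>. fact N / (\<Prod>i=1..?m. fact (\<alpha> i)) :: real"
  define p where "p = simplex_jacobi_at1 d \<kappa>"
  define p' where "p' = simplex_jacobi_at1 d (\<kappa> \<circ> \<tau>) \<nu>"
  define c where "c = simplex_conn d \<kappa> \<tau> \<nu>"
  define h where "h \<mu> = p \<mu> / p' * c \<mu>" for \<mu>
  have \<kappa>\<tau>: "\<forall>i\<in>{1..d+1}. -1 < (\<kappa> \<circ> \<tau>) i" using \<kappa> permutes_in_image[OF \<tau>] by simp
  have p: "p \<mu> \<noteq> 0" for \<mu> using simplex_jacobi_at1_pos[OF \<kappa>, of \<mu>] by (simp add: p_def)
  have p': "p' \<noteq> 0" using simplex_jacobi_at1_pos[OF \<kappa>\<tau>, of \<nu>] unfolding p'_def by linarith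
  have \<nu>n: "(\<Sum>i=1..d. \<nu> i) = n" using \<nu> by (simp add: multi_indices_def)
  have comb: "(\<Sum>\<alpha>\<in>multi_indices ?m N. ?F \<alpha> * (\<Sum>\<mu>\<in>multi_indices d n. g \<mu> * hahn d \<kappa> N \<mu> \<alpha>) * monomial ?m \<alpha> y)
      = (\<Sum>\<mu>\<in>multi_indices d n. g \<mu> * ((\<Sum>i=1..d+1. y i) ^ (N - n) * simplex_jacobi_hom d \<kappa> \<mu> y / p \<mu>))" for g y
  proof -
    have "(\<Sum>\<alpha>\<in>multi_indices ?m N. ?F \<alpha> * (\<Sum>\<mu>\<in>multi_indices d n. g \<mu> * hahn d \<kappa> N \<mu> \<alpha>) * monomial ?m \<alpha> y)
       = (\<Sum>\<alpha>\<in>multi_indices ?m N. \<Sum>\<mu>\<in>multi_indices d n. g \<mu> * (?F \<alpha> * hahn d \<kappa> N \<mu> \<alpha> * monomial ?m \<alpha> y))"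
      by (simp only: sum_distrib_left sum_distrib_right mult_ac)
    also have "\<dots> = (\<Sum>\<mu>\<in>multi_indices d n. g \<mu> * (\<Sum>\<alpha>\<in>multi_indices ?m N. ?F \<alpha> * hahn d \<kappa> N \<mu> \<alpha> * monomial ?m \<alpha> y))"
      unfolding sum_distrib_left by (rule sum.swap)
    also have "\<dots> = (\<Sum>\<mu>\<in>multi_indices d n. g \<mu> * ((\<Sum>i=1..d+1. y i) ^ (N - n) * simplex_jacobi_hom d \<kappa> \<mu> y / p \<mu>))"
      by (intro sum.cong refl) (simp only: hahn_generating[OF _ n] p_def)
    finally show ?thesis .
  qed
  have "hahn_conn d \<kappa> N \<tau> \<nu> = h"
    unfolding hahn_conn_def Let_def \<nu>n
  proof (rule the_equality, goal_cases)
    case 1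
    have "hahn d (\<kappa> \<circ> \<tau>) N \<nu> (\<alpha> \<circ> \<tau>) = (\<Sum>\<mu>\<in>multi_indices d n. h \<mu> * hahn d \<kappa> N \<mu> \<alpha>)"
      if \<alpha>: "\<alpha> \<in> multi_indices ?m N" for \<alpha>
    proof -
      have "?F \<alpha> * hahn d (\<kappa> \<circ> \<tau>) N \<nu> (\<alpha> \<circ> \<tau>) = ?F \<alpha> * (\<Sum>\<mu>\<in>multi_indices d n. h \<mu> * hahn d \<kappa> N \<mu> \<alpha>)"
      proof (rule monomial_coeff_unique[OF _ \<alpha>])
        fix y :: "nat \<Rightarrow> real" assume y: "\<And>i. y i > 0"
        have "(\<Sum>i=1..Suc d. y i) > 0" by (rule sum_pos) (use y in auto)
        then have s: "(\<Sum>i=1..Suc d. y i) \<noteq> 0" by linarith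
        show "(\<Sum>\<alpha>\<in>multi_indices ?m N. ?F \<alpha> * hahn d (\<kappa> \<circ> \<tau>) N \<nu> (\<alpha> \<circ> \<tau>) * monomial ?m \<alpha> y)
            = (\<Sum>\<alpha>\<in>multi_indices ?m N. ?F \<alpha> * (\<Sum>\<mu>\<in>multi_indices d n. h \<mu> * hahn d \<kappa> N \<mu> \<alpha>) * monomial ?m \<alpha> y)"
          unfolding hahn_permuted_generating[OF \<tau> \<nu> n] comb simplex_jacobi_hom_conn[OF d \<kappa> \<tau> \<nu> s]
            p'_def[symmetric] c_def[symmetric]
          unfolding sum_distrib_left sum_divide_distrib
          using p by (intro sum.cong refl) (simp add: h_def mult_ac)
      qed
      moreover have "?F \<alpha> \<noteq> 0" by (simp add: prod_zero_iff)
      ultimately show ?thesis using mult_cancel_left by blast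
    qed
    moreover have "h \<mu> = 0" if "\<mu> \<notin> multi_indices d n" for \<mu>
      using simplex_conn_expansion(2)[OF d \<kappa> \<tau> \<nu> that] by (simp add: h_def c_def)
    ultimately show ?case by blast
  next
    case (2 g)
    show "g = h"
    proof
      fix \<rho>
      show "g \<rho> = h \<rho>"
      proof (cases "\<rho> \<in> multi_indices d n")
        case False
        then show ?thesis using 2 simplex_conn_expansion(2)[OF d \<kappa> \<tau> \<nu> False] by (simp add: h_def c_def)
      next
        case True
        have "p' * g \<rho> / p \<rho> = c \<rho>"
        proof (rule simplex_jacobi_coeffs_unique[OF d \<kappa> _ True])
          fix x assume "x \<in> std_simplex d"
          let ?y = "barycentric d x"
          have s: "(\<Sum>i=1..d+1. ?y i) = 1" using barycentric_sum[of d x] by simp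
          have "simplex_jacobi_hom d (\<kappa> \<circ> \<tau>) \<nu> (?y \<circ> \<tau>) / p'
              = (\<Sum>\<alpha>\<in>multi_indices ?m N. ?F \<alpha> * hahn d (\<kappa> \<circ> \<tau>) N \<nu> (\<alpha> \<circ> \<tau>) * monomial ?m \<alpha> ?y)"
            unfolding hahn_permuted_generating[OF \<tau> \<nu> n] s p'_def by simp
          also have "\<dots> = (\<Sum>\<alpha>\<in>multi_indices ?m N. ?F \<alpha> * (\<Sum>\<mu>\<in>multi_indices d n. g \<mu> * hahn d \<kappa> N \<mu> \<alpha>) * monomial ?m \<alpha> ?y)"
            using 2 by (intro sum.cong refl) simp
          also have "\<dots> = (\<Sum>\<mu>\<in>multi_indices d n. g \<mu> * (simplex_jacobi d \<kappa> \<mu> x / p \<mu>))"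
            unfolding comb s simplex_jacobi_homogeneous_coords by simp
          finally have "simplex_jacobi d (\<kappa> \<circ> \<tau>) \<nu> (simplex_perm d \<tau> x)
              = p' * (\<Sum>\<mu>\<in>multi_indices d n. g \<mu> * (simplex_jacobi d \<kappa> \<mu> x / p \<mu>))"
            using p' unfolding simplex_jacobi_permuted[OF \<tau>] by (simp add: field_simps)
          then show "(\<Sum>\<mu>\<in>multi_indices d n. p' * g \<mu> / p \<mu> * simplex_jacobi d \<kappa> \<mu> x)
              = (\<Sum>\<mu>\<in>multi_indices d n. c \<mu> * simplex_jacobi d \<kappa> \<mu> x)"
            unfolding simplex_conn_expansion(1)[OF d \<kappa> \<tau> \<nu>] c_def[symmetric]
            by (simp add: sum_distrib_left mult.assoc)
        qed
        then show ?thesis using p[of \<rho>] p' by (simp add: h_def field_simps)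
      qed
    qed
  qed
  then show ?thesis by (simp only: h_def p_def p'_def c_def)
qed

theorem theorem7p5:
  fixes d N n :: nat and \<kappa> :: "nat \<Rightarrow> real" and \<tau> \<nu> \<mu> :: "nat \<Rightarrow> nat"
  assumes "1 \<le> d"
    and "\<forall>i\<in>{1..d+1}. -1 < \<kappa> i"
    and "\<tau> permutes {1..d+1}"
    and "\<nu> \<in> multi_indices d n" and "\<mu> \<in> multi_indices d n" and "n \<le> N"
  shows "hahn_conn d \<kappa> N \<tau> \<nu> \<mu> =
           simplex_jacobi_at1 d \<kappa> \<mu> / simplex_jacobi_at1 d (\<kappa> \<circ> \<tau>) \<nu> * simplex_conn d \<kappa> \<tau> \<nu> \<mu>
       \<and> hahn_conn_normalized d \<kappa> N \<tau> \<nu> \<mu> = simplex_conn_normalized d \<kappa> \<tau> \<nu> \<mu>"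
proof
  show conn: "hahn_conn d \<kappa> N \<tau> \<nu> \<mu> =
      simplex_jacobi_at1 d \<kappa> \<mu> / simplex_jacobi_at1 d (\<kappa> \<circ> \<tau>) \<nu> * simplex_conn d \<kappa> \<tau> \<nu> \<mu>"
    by (rule hahn_conn_eq[OF assms(1-4,6)])
  define p where "p = simplex_jacobi_at1 d \<kappa> \<mu>"
  define p' where "p' = simplex_jacobi_at1 d (\<kappa> \<circ> \<tau>) \<nu>"
  define A where "A = simplex_norm d \<kappa> \<mu>"
  define A' where "A' = simplex_norm d (\<kappa> \<circ> \<tau>) \<nu>"
  define S where "S = (\<Sum>i=1..d+1. \<kappa> i) + real d + 1"
  define K where "K = fact (N - n) * pochhammer S (N + n) / (fact N * pochhammer S N)"
  have \<kappa>\<tau>: "\<forall>i\<in>{1..d+1}. -1 < (\<kappa> \<circ> \<tau>) i" using assms(2) permutes_in_image[OF assms(3)] by simp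
  have p: "p > 0" "p' > 0"
    unfolding p_def p'_def by (rule simplex_jacobi_at1_pos[OF assms(2)], rule simplex_jacobi_at1_pos[OF \<kappa>\<tau>])
  have "S > 0" unfolding S_def by (rule total_weight_pos[OF assms(2)])
  then have K: "K > 0" unfolding K_def by (intro divide_pos_pos mult_pos_pos pochhammer_pos) auto
  have B: "hahn_norm d \<kappa> N \<mu> = K * (A / p ^ 2)"
    unfolding hahn_norm_eq[OF assms(1,2,5,6)] by (simp only: K_def S_def A_def p_def)
  have "(\<Sum>i=1..d+1. (\<kappa> \<circ> \<tau>) i) = (\<Sum>i=1..d+1. \<kappa> i)" by (rule sum.permute[OF assms(3), symmetric])
  then have B': "hahn_norm d (\<kappa> \<circ> \<tau>) N \<nu> = K * (A' / p' ^ 2)"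
    unfolding hahn_norm_eq[OF assms(1) \<kappa>\<tau> assms(4,6)] by (simp only: K_def S_def A'_def p'_def)
  have "hahn_norm d \<kappa> N \<mu> / hahn_norm d (\<kappa> \<circ> \<tau>) N \<nu> = A / A' * (p' / p) ^ 2"
    unfolding B B' using p K by (simp add: power_divide)
  then have "sqrt (hahn_norm d \<kappa> N \<mu> / hahn_norm d (\<kappa> \<circ> \<tau>) N \<nu>) = sqrt (A / A') * (p' / p)"
    using p by (simp only: real_sqrt_mult real_sqrt_abs abs_of_pos divide_pos_pos)
  then show "hahn_conn_normalized d \<kappa> N \<tau> \<nu> \<mu> = simplex_conn_normalized d \<kappa> \<tau> \<nu> \<mu>"
    unfolding hahn_conn_normalized_def simplex_conn_normalized_def conn
    using p by (simp add: A_def A'_def p_def p'_def)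
qed

end
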